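(* Suppose that $(G,X)$ is a free second-countable transformation group and let $\nu$ be a right Haar measure on $G$. Let $M\in\mathbb{R}$ with $M\geq 1$, let $z\in X$ and let $(x_n)_{n\geq 1}$ be a sequence in $X$. Assume that $G\cdot z$ is locally closed in $X$. Suppose that there exists an open neighbourhood $V$ of $z$ in $X$ such that $\phi_z^{-1}(V)$ is relatively compact and $$\nu(\phi_{x_n}^{-1}(V))\leq M\,\nu(\phi_z^{-1}(V))<\infty$$ eventually. Then $M_U(\operatorname{Ind}\epsilon_z,(\operatorname{Ind}\epsilon_{x_n}))\leq\lfloor M\rfloor$.
   Context: Transformation groups. A transformation group $(G,X)$ consists of a locally compact Hausdorff group $G$ and a locally compact Hausdorff space $X$ with a jointly continuous action $G\times X\to X$, $(s,x)\mapsto s\cdot x$. It is second countable if both $G$ and $X$ are, and free if $s\cdot x=x$ implies $s=e$. $G\cdot x=\{s\cdot x:s\in G\}$ is the orbit of $x$. For $x\in X$, $\phi_x:G\to G\cdot x$ is $\phi_x(s)=s\cdot x$, so $\phi_x^{-1}(V)=\{s\in G:s\cdot x\in V\}$ for $V\subset X$. A subset is locally closed if it is relatively open in its closure. "Eventually" means for all sufficiently large $n$. The $C^*$-algebra and induced representations. $C_0(X)\times G$ is the transformation-group $C^*$-algebra (full crossed product of $C_0(X)$ by the action $\operatorname{lt}_s(f)(x)=f(s^{-1}\cdot x)$), i.e. the enveloping $C^*$-algebra of $L^1(G,C_0(X))$. Let $\mu$ be a left Haar measure with modular function $\Delta$, and $\nu(E)=\mu(E^{-1})$. For $x\in X$,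 with $\epsilon_x:C_0(X)\to\mathbb{C}$ evaluation at $x$, $\operatorname{Ind}\epsilon_x$ is the representation $\tilde\epsilon_x\times\lambda$ of $C_0(X)\times G$ on $L^2(G,\nu)$ given by the covariant pair $(\tilde\epsilon_x(f)\xi)(s)=f(s\cdot x)\xi(s)$, $(\lambda_t\xi)(s)=\Delta(t)^{1/2}\xi(t^{-1}s)$. For free actions it is irreducible. Multiplicities. Let $A$ be a $C^*$-algebra with spectrum $\hat A$ and set of pure states $P(A)$. Let $\mathcal N$ be the weak*-neighbourhood base at $0$ in $A^*$ of all sets $\{\psi\in A^*:|\psi(a_i)|<\epsilon,\ 1\le i\le n\}$ ($\epsilon>0$, $a_1,\dots,a_n\in A$). Let $\pi\in\hat A$ and let $\phi$ be a pure state associated with $\pi$. For $\sigma\in\hat A$ (on Hilbert space $H_\sigma$) and $N\in\mathcal N$ let $\mathrm{Vec}(\sigma,\phi,N)=\{\eta\in H_\sigma:\|\eta\|=1,\ \langle\sigma(\cdot)\eta,\eta\rangle\in\phi+N\}$ and let $d(\sigma,\phi,N)\in\mathbb{N}\cup\{\infty\}$ be the supremum of the cardinalities of finite orthonormal subsets of $\mathrm{Vec}(\sigma,\phi,N)$ ($0$ if it is empty). For a net $\Omega=(\pi_\alpha)$ in $\hat A$, $M_U(\pi,\Omega)=\inf_{N\in\mathcal N}\limsup_\alpha d(\pi_\alpha,\phi,N)$; this is independent of the choice of $\phi$. *)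

theory Defs
  imports "HOL-Analysis.Analysis"
begin

section \<open>The Banach algebra of continuous functions vanishing at infinity\<close>

typedef (overloaded) 'x c0 =
  "{f :: 'x::topological_space \<Rightarrow>\<^sub>C complex. \<forall>e>0. compact {x. e \<le> cmod (apply_bcontfun f x)}}"
  morphisms bcontfun_of_c0 Abs_c0
  by (rule exI[of _ 0]) (auto simp: not_le)

definition c0_apply :: "'x::topological_space c0 \<Rightarrow> 'x \<Rightarrow> complex" where
  "c0_apply f = apply_bcontfun (bcontfun_of_c0 f)"

text \<open>Only meaningful if \<open>h\<close> is continuous and vanishes at infinity.\<close>

definition c0_of :: "('x::topological_space \<Rightarrow> complex) \<Rightarrow> 'x c0" where
  "c0_of h = Abs_c0 (Bcontfun h)"

lemma continuous_on_c0_apply [continuous_intros]: "continuous_on S (c0_apply f)"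
  by (simp add: c0_apply_def)

lemma compact_c0_apply: "0 < e \<Longrightarrow> compact {x. e \<le> cmod (c0_apply f x)}"
  using bcontfun_of_c0[of f] by (auto simp: c0_apply_def)

lemma bounded_c0_apply: "bounded (range (c0_apply f))"
  by (simp add: c0_apply_def)

lemma c0_eqI: "(\<And>x. c0_apply f x = c0_apply g x) \<Longrightarrow> f = g"
  by (metis bcontfun_eqI bcontfun_of_c0_inject c0_apply_def)

lemma compact_ge_subset:
  assumes "continuous_on UNIV h" and "compact K" and "{x. e \<le> cmod (h x)} \<subseteq> K"
  shows "compact {x::'x::topological_space. e \<le> cmod (h x)}"
proof -
  have "closed {x. e \<le> cmod (h x)}"
    using assms(1) by (intro closed_Collect_le continuous_intros)
  then have "compact (K \<inter> {x. e \<le> cmod (h x)})"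
    using assms(2) by (rule compact_Int_closed[rotated])
  then show ?thesis
    using assms(3) by (simp add: Int_absorb1)
qed

lemma bcontfun_vanishing_at_infinity:
  fixes h :: "'x::topological_space \<Rightarrow> complex"
  assumes "continuous_on UNIV h" and "\<And>e. 0 < e \<Longrightarrow> compact {x. e \<le> cmod (h x)}"
  shows "h \<in> bcontfun"
proof -
  have "compact (h ` {x. 1 \<le> cmod (h x)})"
    using assms by (intro compact_continuous_image) (auto intro: continuous_on_subset)
  then obtain B where "\<forall>x. 1 \<le> cmod (h x) \<longrightarrow> cmod (h x) \<le> B"
    by (auto dest!: compact_imp_bounded simp: bounded_iff)
  then have "cmod (h x) \<le> max 1 B" for x
    by (cases "1 \<le> cmod (h x)") (auto simp: le_max_iff_disj)
  then show ?thesis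
    using assms(1) by (auto simp: bcontfun_def bounded_iff)
qed

lemma c0_apply_c0_of:
  assumes "continuous_on UNIV h" and "\<And>e. 0 < e \<Longrightarrow> compact {x. e \<le> cmod (h x)}"
  shows "c0_apply (c0_of h) = h"
  using bcontfun_vanishing_at_infinity[OF assms] assms
  by (simp add: c0_apply_def c0_of_def Abs_c0_inverse Bcontfun_inverse)

lemma c0_apply_c0_of_dominated:
  fixes f g :: "'x::topological_space c0"
  assumes "continuous_on UNIV h" and "0 \<le> C"
    and "\<And>x. cmod (h x) \<le> C * (cmod (c0_apply f x) + cmod (c0_apply g x))"
  shows "c0_apply (c0_of h) = h"
proof (rule c0_apply_c0_of[OF assms(1)])
  fix e :: real assume "0 < e"
  define d where "d = e / (2 * (C + 1))"
  have "0 < d" using \<open>0 < e\<close> assms(2) by (simp add: d_def)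
  have "d \<le> cmod (c0_apply f x) \<or> d \<le> cmod (c0_apply g x)" if "e \<le> cmod (h x)" for x
  proof (rule ccontr)
    assume "\<not> ?thesis"
    then have "cmod (c0_apply f x) + cmod (c0_apply g x) \<le> 2 * d" by simp
    then have "cmod (h x) \<le> C * (2 * d)"
      using assms(2,3) by (meson mult_left_mono order_trans)
    also have "\<dots> < (C + 1) * (2 * d)" using \<open>0 < d\<close> by (simp add: algebra_simps)
    also have "\<dots> = e" using assms(2) by (simp add: d_def field_simps)
    finally show False using that by simp
  qed
  then show "compact {x. e \<le> cmod (h x)}"
    by (intro compact_ge_subset[OF assms(1)
          compact_Un[OF compact_c0_apply[OF \<open>0 < d\<close>, of f] compact_c0_apply[OF \<open>0 < d\<close>, of g]]]) auto
qed

instantiation c0 :: (topological_space) real_vector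
begin

definition "0 = c0_of (\<lambda>x. 0)"
definition "f + g = c0_of (\<lambda>x. c0_apply f x + c0_apply g x)"
definition "f - g = c0_of (\<lambda>x. c0_apply f x - c0_apply g x)"
definition "- f = c0_of (\<lambda>x. - c0_apply f x)"
definition "r *\<^sub>R f = c0_of (\<lambda>x. r *\<^sub>R c0_apply f x)"

lemma c0_apply_zero [simp]: "c0_apply 0 x = 0"
  by (simp add: zero_c0_def c0_apply_c0_of not_le)

lemma c0_apply_add [simp]: "c0_apply (f + g) x = c0_apply f x + c0_apply g x"
  unfolding plus_c0_def
  by (subst c0_apply_c0_of_dominated[where C = 1 and f = f and g = g])
     (auto intro!: continuous_intros norm_triangle_ineq)

lemma c0_apply_diff [simp]: "c0_apply (f - g) x = c0_apply f x - c0_apply g x"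
  unfolding minus_c0_def
  by (subst c0_apply_c0_of_dominated[where C = 1 and f = f and g = g])
     (auto intro!: continuous_intros norm_triangle_ineq4)

lemma c0_apply_uminus [simp]: "c0_apply (- f) x = - c0_apply f x"
  unfolding uminus_c0_def
  by (subst c0_apply_c0_of_dominated[where C = 1 and f = f and g = f])
     (auto intro!: continuous_intros)

lemma c0_apply_scaleR [simp]: "c0_apply (r *\<^sub>R f) x = r *\<^sub>R c0_apply f x"
  unfolding scaleR_c0_def
  by (subst c0_apply_c0_of_dominated[where C = "\<bar>r\<bar>" and f = f and g = f])
     (auto intro!: continuous_intros mult_left_mono)

instance
  by standard (auto intro!: c0_eqI simp: algebra_simps)

end

instantiation c0 :: (topological_space) real_normed_algebra
begin

definition "f * g = c0_of (\<lambda>x. c0_apply f x * c0_apply g x)"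
definition norm_c0 :: "'a c0 \<Rightarrow> real" where "norm_c0 f = norm (bcontfun_of_c0 f)"
definition dist_c0 :: "'a c0 \<Rightarrow> 'a c0 \<Rightarrow> real" where "dist_c0 f g = norm (f - g)"
definition "sgn f = f /\<^sub>R norm f" for f :: "'a c0"
definition uniformity_c0 :: "('a c0 \<times> 'a c0) filter" where
  "uniformity_c0 = (INF e\<in>{0<..}. principal {(f, g). dist f g < e})"
definition open_c0 :: "'a c0 set \<Rightarrow> bool" where
  "open_c0 S = (\<forall>f\<in>S. \<forall>\<^sub>F (f', g) in uniformity. f' = f \<longrightarrow> g \<in> S)"

lemma norm_c0_apply_le: "cmod (c0_apply f x) \<le> norm f"
  by (simp add: c0_apply_def norm_c0_def norm_bounded)

lemma norm_c0_le: "(\<And>x. cmod (c0_apply f x) \<le> b) \<Longrightarrow> norm f \<le> b"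
  by (simp add: c0_apply_def norm_c0_def norm_bound)

lemma c0_apply_mult [simp]: "c0_apply (f * g) x = c0_apply f x * c0_apply g x"
proof -
  have "cmod (c0_apply f x * c0_apply g x)
      \<le> norm f * (cmod (c0_apply f x) + cmod (c0_apply g x))" for x
  proof -
    have "cmod (c0_apply f x) * cmod (c0_apply g x) \<le> norm f * cmod (c0_apply g x)"
      by (intro mult_right_mono norm_c0_apply_le) simp
    moreover have "0 \<le> norm f * cmod (c0_apply f x)" by (simp add: norm_c0_def)
    ultimately show ?thesis by (simp add: norm_mult distrib_left)
  qed
  then show ?thesis
    unfolding times_c0_def
    by (subst c0_apply_c0_of_dominated[where C = "norm f" and f = f and g = g])
       (auto intro!: continuous_intros simp: norm_c0_def)
qed

lemma bcontfun_of_c0_simps: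
  "bcontfun_of_c0 0 = 0"
  "bcontfun_of_c0 (f + g) = bcontfun_of_c0 f + bcontfun_of_c0 g"
  "bcontfun_of_c0 (f - g) = bcontfun_of_c0 f - bcontfun_of_c0 g"
  "bcontfun_of_c0 (r *\<^sub>R f) = r *\<^sub>R bcontfun_of_c0 f"
  using c0_apply_zero c0_apply_add[of f g] c0_apply_diff[of f g] c0_apply_scaleR[of r f]
  by (auto intro!: bcontfun_eqI simp: c0_apply_def)

instance
proof
  fix f g :: "'a c0"
  show "norm f = 0 \<longleftrightarrow> f = 0"
    by (metis bcontfun_of_c0_inject bcontfun_of_c0_simps(1) norm_c0_def norm_eq_zero)
  have "cmod (c0_apply (f * g) x) \<le> norm f * norm g" for x
    by (auto simp: norm_mult intro!: mult_mono norm_c0_apply_le) (simp add: norm_c0_def)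
  then show "norm (f * g) \<le> norm f * norm g"
    by (rule norm_c0_le)
qed (auto intro!: c0_eqI simp: algebra_simps dist_c0_def sgn_c0_def norm_c0_def
      bcontfun_of_c0_simps norm_triangle_ineq uniformity_c0_def open_c0_def)

end

lemma dist_bcontfun_of_c0: "dist (bcontfun_of_c0 f) (bcontfun_of_c0 g) = dist f g"
  by (simp add: dist_norm norm_c0_def bcontfun_of_c0_simps)

lemma dist_c0_apply_le: "dist (c0_apply f x) (c0_apply g x) \<le> dist f g"
  using norm_c0_apply_le[of "f - g" x] by (simp add: dist_norm)

lemma dist_c0_le: "(\<And>x. dist (c0_apply f x) (c0_apply g x) \<le> b) \<Longrightarrow> dist f g \<le> b"
  using norm_c0_le[of "f - g" b] by (simp add: dist_norm)

instance c0 :: (topological_space) banach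
proof
  fix F :: "nat \<Rightarrow> 'a c0"
  assume Cauchy: "Cauchy F"
  have ptw: "Cauchy (\<lambda>n. c0_apply (F n) x)" for x
  proof (rule metric_CauchyI)
    fix e :: real assume "0 < e"
    then show "\<exists>M. \<forall>m\<ge>M. \<forall>n\<ge>M. dist (c0_apply (F m) x) (c0_apply (F n) x) < e"
      using metric_CauchyD[OF Cauchy] dist_c0_apply_le by (meson le_less_trans)
  qed
  define h where "h x = lim (\<lambda>n. c0_apply (F n) x)" for x
  have lim: "(\<lambda>n. c0_apply (F n) x) \<longlonglongrightarrow> h x" for x
    unfolding h_def using ptw Cauchy_convergent_iff convergent_LIMSEQ_iff by blast
  have unif: "\<exists>N. \<forall>n\<ge>N. \<forall>x. dist (c0_apply (F n) x) (h x) \<le> e" if e: "0 < e" for e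
  proof -
    obtain N where N: "\<And>m n. m \<ge> N \<Longrightarrow> n \<ge> N \<Longrightarrow> dist (F m) (F n) < e"
      using metric_CauchyD[OF Cauchy e] by blast
    have "dist (c0_apply (F n) x) (h x) \<le> e" if "n \<ge> N" for n x
    proof (rule LIMSEQ_le_const2[OF tendsto_dist[OF tendsto_const lim]])
      show "\<exists>M. \<forall>m\<ge>M. dist (c0_apply (F n) x) (c0_apply (F m) x) \<le> e"
        using N[OF that] dist_c0_apply_le by (meson less_le_not_le order_trans)
    qed
    then show ?thesis by blast
  qed
  have "uniform_limit UNIV (\<lambda>n. c0_apply (F n)) h sequentially"
  proof (rule uniform_limitI)
    fix e :: real assume "0 < e"
    then obtain N where "\<forall>n\<ge>N. \<forall>x. dist (c0_apply (F n) x) (h x) \<le> e / 2"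
      using unif[of "e / 2"] by auto
    then show "\<forall>\<^sub>F n in sequentially. \<forall>x\<in>UNIV. dist (c0_apply (F n) x) (h x) < e"
      using \<open>0 < e\<close> by (auto simp: eventually_sequentially intro!: exI[of _ N]) (smt (verit) field_sum_of_halves)
  qed
  then have cont: "continuous_on UNIV h"
    by (rule uniform_limit_theorem[rotated]) (auto intro!: always_eventually continuous_intros)
  have "c0_apply (c0_of h) = h"
  proof (rule c0_apply_c0_of[OF cont])
    fix e :: real assume "0 < e"
    then obtain N where N: "\<forall>x. dist (c0_apply (F N) x) (h x) \<le> e / 2"
      using unif[of "e / 2"] by auto
    have "e / 2 \<le> cmod (c0_apply (F N) x)" if "e \<le> cmod (h x)" for x
      using N[rule_format, of x] norm_triangle_ineq2[of "h x" "c0_apply (F N) x"] that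
      by (simp add: dist_norm norm_minus_commute)
    then show "compact {x. e \<le> cmod (h x)}"
      using \<open>0 < e\<close> by (intro compact_ge_subset[OF cont compact_c0_apply[of "e / 2" "F N"]]) auto
  qed
  then have "F \<longlonglongrightarrow> c0_of h"
  proof (intro metric_LIMSEQ_I)
    fix e :: real assume "0 < e"
    then obtain N where N: "\<forall>n\<ge>N. \<forall>x. dist (c0_apply (F n) x) (h x) \<le> e / 2"
      using unif[of "e / 2"] by auto
    have "dist (F n) (c0_of h) \<le> e / 2" if "n \<ge> N" for n
      using N that \<open>c0_apply (c0_of h) = h\<close> by (intro dist_c0_le) simp
    then show "\<exists>N. \<forall>n\<ge>N. dist (F n) (c0_of h) < e"
      using \<open>0 < e\<close> by (intro exI[of _ N]) force
  qed
  then show "convergent F" by (rule convergentI)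
qed

lemma countable_dense_c0:
  "\<exists>D :: 'x::second_countable_topology c0 set. countable D \<and> (\<forall>f e. 0 < e \<longrightarrow> (\<exists>g\<in>D. dist f g < e))"
proof -
  obtain B :: "'x set set" where B: "countable B" "topological_basis B"
    using ex_countable_basis by blast
  obtain C :: "complex set set" where C: "countable C" "topological_basis C"
    using ex_countable_basis by blast
  define W where "W P n = {g. (\<forall>(U, V)\<in>P. \<forall>x\<in>U. c0_apply g x \<in> V) \<and>
      (\<forall>x. x \<notin> \<Union>(fst ` P) \<longrightarrow> cmod (c0_apply g x) < 1 / real (Suc n))}"
    for P :: "('x set \<times> complex set) set" and n :: nat
  define I where "I = {P. finite P \<and> P \<subseteq> B \<times> C}"
  define D where "D = (\<lambda>(P, n). SOME g. g \<in> W P n) ` (I \<times> UNIV)"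
  have "countable I"
    unfolding I_def using B(1) C(1) by (intro countable_Collect_finite_subset) auto
  then have "countable D"
    unfolding D_def by (intro countable_image countable_SIGMA) auto
  moreover have "\<exists>g\<in>D. dist f g < e" if "0 < e" for f :: "'x c0" and e :: real
  proof -
    obtain n where n: "1 / real (Suc n) < e / 4"
      using \<open>0 < e\<close> nat_approx_posE[of "e / 4"] by auto
    define K where "K = {x. 1 / real (Suc n) \<le> cmod (c0_apply f x)}"
    have "compact K" unfolding K_def by (rule compact_c0_apply) simp
    define Q where "Q x p \<longleftrightarrow> fst p \<in> B \<and> snd p \<in> C \<and> x \<in> fst p \<and>
        (\<forall>y\<in>fst p. c0_apply f y \<in> snd p) \<and> (\<forall>v\<in>snd p. \<forall>w\<in>snd p. dist v w < e / 2)"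
      for x and p :: "'x set \<times> complex set"
    have "\<exists>p. Q x p" for x
    proof -
      obtain V where V: "V \<in> C" "c0_apply f x \<in> V" "V \<subseteq> ball (c0_apply f x) (e / 4)"
      proof (rule topological_basisE[OF C(2)])
        show "c0_apply f x \<in> ball (c0_apply f x) (e / 4)" using \<open>0 < e\<close> by simp
      qed simp
      have "open V" by (rule topological_basis_open[OF C(2) V(1)])
      then have "open (c0_apply f -` V)"
        by (intro open_vimage continuous_on_c0_apply)
      then obtain U where U: "U \<in> B" "x \<in> U" "U \<subseteq> c0_apply f -` V"
      proof (rule topological_basisE[OF B(2)])
        show "x \<in> c0_apply f -` V" using V(2) by simp
      qed
      have "dist v w < e / 2" if "v \<in> V" "w \<in> V" for v w
        using subsetD[OF V(3) that(1)] subsetD[OF V(3) that(2)]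
          dist_triangle_half_r[of "c0_apply f x" v "e / 2" w] by simp
      then have "Q x (U, V)" using U V by (auto simp: Q_def)
      then show ?thesis ..
    qed
    then have "\<forall>x. \<exists>p. Q x p" by simp
    then obtain p where p: "\<forall>x. Q x (p x)" by (rule exE[OF choice])
    define U V where "U x = fst (p x)" and "V x = snd (p x)" for x
    have UV: "\<And>x. U x \<in> B" "\<And>x. V x \<in> C" "\<And>x. x \<in> U x"
      "\<And>x y. y \<in> U x \<Longrightarrow> c0_apply f y \<in> V x"
      "\<And>x v w. v \<in> V x \<Longrightarrow> w \<in> V x \<Longrightarrow> dist v w < e / 2"
      using p unfolding Q_def U_def V_def by simp_all
    obtain J where J: "finite J" "K \<subseteq> (\<Union>x\<in>J. U x)"
    proof (rule compactE_image[OF \<open>compact K\<close>, of K U])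
      show "open (U x)" for x by (rule topological_basis_open[OF B(2) UV(1)])
      show "K \<subseteq> \<Union>(U ` K)" by (intro subsetI UN_I) (auto intro: UV(3))
    next
      fix J assume "J \<subseteq> K" "finite J" "K \<subseteq> (\<Union>x\<in>J. U x)"
      then show thesis by (intro that)
    qed
    define P where "P = (\<lambda>x. (U x, V x)) ` J"
    have "P \<in> I" using J(1) UV(1,2) by (auto simp: I_def P_def)
    have f: "f \<in> W P n"
      using J(2) UV(4) by (auto simp: W_def P_def K_def not_le[symmetric])
    define g where "g = (SOME g. g \<in> W P n)"
    have g: "g \<in> W P n" unfolding g_def using f by (rule someI)
    have "dist (c0_apply f x) (c0_apply g x) \<le> e / 2" for x
    proof (cases "x \<in> \<Union>(fst ` P)")
      case True
      then obtain y where "y \<in> J" "x \<in> U y" by (auto simp: P_def)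
      then have "c0_apply f x \<in> V y" "c0_apply g x \<in> V y"
        using f g by (auto simp: W_def P_def)
      then show ?thesis by (intro less_imp_le UV(5))
    next
      case False
      then have "cmod (c0_apply f x) < 1 / real (Suc n)" "cmod (c0_apply g x) < 1 / real (Suc n)"
        using f g by (auto simp: W_def)
      then show ?thesis
        using n norm_triangle_ineq4[of "c0_apply f x" "c0_apply g x"] by (simp add: dist_norm)
    qed
    then have "dist f g \<le> e / 2" by (rule dist_c0_le)
    moreover have "g \<in> D" using \<open>P \<in> I\<close> by (auto simp: D_def g_def)
    ultimately show ?thesis using \<open>0 < e\<close> by (intro bexI[of _ g]) auto
  qed
  ultimately show ?thesis by blast
qed

instance c0 :: (second_countable_topology) second_countable_topology
proof
  obtain D :: "'a c0 set" where D: "countable D" "\<And>f e. 0 < e \<Longrightarrow> \<exists>g\<in>D. dist f g < e"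
    using countable_dense_c0 by blast
  define B where "B = (\<lambda>(g, n). ball g (1 / real (Suc n))) ` (D \<times> (UNIV :: nat set))"
  have "topological_basis B"
  proof (rule topological_basisI)
    fix S and f :: "'a c0"
    assume "open S" "f \<in> S"
    then obtain e where e: "0 < e" "ball f e \<subseteq> S" by (auto simp: open_contains_ball)
    obtain n where n: "1 / real (Suc n) < e / 2"
      using e(1) nat_approx_posE[of "e / 2"] by auto
    obtain g where g: "g \<in> D" "dist f g < 1 / real (Suc n)"
      using D(2)[of "1 / real (Suc n)" f] by auto
    have "ball g (1 / real (Suc n)) \<subseteq> ball f e"
    proof
      fix h assume "h \<in> ball g (1 / real (Suc n))"
      then show "h \<in> ball f e"
        using dist_triangle[of f h g] g(2) n by simp
    qed
    then show "\<exists>B'\<in>B. f \<in> B' \<and> B' \<subseteq> S"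
      using g e(2) by (intro bexI[of _ "ball g (1 / real (Suc n))"]) (auto simp: B_def dist_commute)
  qed (auto simp: B_def)
  moreover have "countable B" using D(1) by (auto simp: B_def)
  ultimately show "\<exists>B :: 'a c0 set set. countable B \<and> open = generate_topology B"
    using topological_basis_imp_subbasis by blast
qed

definition c0_scale :: "complex \<Rightarrow> 'x::topological_space c0 \<Rightarrow> 'x c0" where
  "c0_scale c f = c0_of (\<lambda>x. c * c0_apply f x)"

definition c0_cnj :: "'x::topological_space c0 \<Rightarrow> 'x c0" where
  "c0_cnj f = c0_of (\<lambda>x. cnj (c0_apply f x))"

lemma c0_apply_scale [simp]: "c0_apply (c0_scale c f) x = c * c0_apply f x"
  unfolding c0_scale_def
  by (subst c0_apply_c0_of_dominated[where C = "cmod c" and f = f and g = f])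
     (auto intro!: continuous_intros mult_left_mono simp: norm_mult)

lemma c0_apply_cnj [simp]: "c0_apply (c0_cnj f) x = cnj (c0_apply f x)"
  unfolding c0_cnj_def
  by (subst c0_apply_c0_of_dominated[where C = 1 and f = f and g = f])
     (auto intro!: continuous_intros)


section \<open>Transformation groups\<close>

text \<open>The group is written additively (but it need not be commutative), since the library's class
  of topological groups is \<^class>\<open>topological_group_add\<close>. So \<open>s + t\<close>, \<open>- s\<close>, \<open>0\<close> stand for
  \<open>st\<close>, \<open>s\<close> inverse, \<open>e\<close>. Separation and countability are sort constraints.\<close>

definition transformation_group ::
  "('g::{topological_group_add,t2_space} \<Rightarrow> 'x::t2_space \<Rightarrow> 'x) \<Rightarrow> bool" where
  "transformation_group act \<longleftrightarrow>
     locally_compact_space (euclidean :: 'g topology) \<and>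
     locally_compact_space (euclidean :: 'x topology) \<and>
     continuous_on UNIV (\<lambda>(s, x). act s x) \<and>
     (\<forall>x. act 0 x = x) \<and>
     (\<forall>s t x. act (s + t) x = act s (act t x))"

definition free_action :: "('g::group_add \<Rightarrow> 'x \<Rightarrow> 'x) \<Rightarrow> bool" where
  "free_action act \<longleftrightarrow> (\<forall>s x. act s x = x \<longrightarrow> s = 0)"

definition action_orbit :: "('g \<Rightarrow> 'x \<Rightarrow> 'x) \<Rightarrow> 'x \<Rightarrow> 'x set" where
  "action_orbit act x = range (\<lambda>s. act s x)"

definition orbit_map :: "('g \<Rightarrow> 'x \<Rightarrow> 'x) \<Rightarrow> 'x \<Rightarrow> 'g \<Rightarrow> 'x" where
  "orbit_map act x s = act s x"

definition locally_closed :: "'x::topological_space set \<Rightarrow> bool" where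
  "locally_closed S \<longleftrightarrow> openin (top_of_set (closure S)) S"

definition c0_translate ::
  "('g::group_add \<Rightarrow> 'x::topological_space \<Rightarrow> 'x) \<Rightarrow> 'g \<Rightarrow> 'x c0 \<Rightarrow> 'x c0" where
  "c0_translate act s f = c0_of (\<lambda>x. c0_apply f (act (- s) x))"

lemma c0_apply_translate:
  fixes act :: "'g::{topological_group_add,t2_space} \<Rightarrow> 'x::t2_space \<Rightarrow> 'x"
  assumes "transformation_group act"
  shows "c0_apply (c0_translate act s f) x = c0_apply f (act (- s) x)"
proof -
  have cont: "continuous_on UNIV (act t)" for t
  proof -
    have "continuous_on UNIV (\<lambda>(s, x). act s x)"
      using assms unfolding transformation_group_def by (elim conjE)
    moreover have "continuous_on UNIV (\<lambda>x::'x. (t, x))"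
      by (rule continuous_on_Pair[OF continuous_on_const continuous_on_id])
    ultimately have "continuous_on UNIV (\<lambda>x. case (t, x) of (s, x) \<Rightarrow> act s x)"
      by (rule continuous_on_compose2) simp
    then show ?thesis by simp
  qed
  have act: "act 0 y = y" "act a (act b y) = act (a + b) y" for a b y
    using assms unfolding transformation_group_def by simp_all
  have inv: "act s (act (- s) y) = y" "act (- s) (act s y) = y" for y
    by (simp_all add: act)
  have "c0_apply (c0_of (\<lambda>x. c0_apply f (act (- s) x))) = (\<lambda>x. c0_apply f (act (- s) x))"
  proof (rule c0_apply_c0_of)
    show "continuous_on UNIV (\<lambda>x. c0_apply f (act (- s) x))"
      by (rule continuous_on_compose2[OF continuous_on_c0_apply[of UNIV] cont]) simp
    fix e :: real assume "0 < e"
    have "{x. e \<le> cmod (c0_apply f (act (- s) x))} = act s ` {x. e \<le> cmod (c0_apply f x)}"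
    proof (intro equalityI subsetI)
      fix y assume "y \<in> {x. e \<le> cmod (c0_apply f (act (- s) x))}"
      then show "y \<in> act s ` {x. e \<le> cmod (c0_apply f x)}"
        by (intro image_eqI[of _ _ "act (- s) y"]) (simp_all add: inv)
    qed (auto simp: inv)
    then show "compact {x. e \<le> cmod (c0_apply f (act (- s) x))}"
      using compact_continuous_image[OF continuous_on_subset[OF cont subset_UNIV]
          compact_c0_apply[OF \<open>0 < e\<close>]]
      by simp
  qed
  then show ?thesis by (simp add: c0_translate_def)
qed


section \<open>Haar measure\<close>

text \<open>Regularity is automatic, because all groups below are second countable.\<close>

definition left_haar_measure :: "'g::topological_group_add measure \<Rightarrow> bool" where
  "left_haar_measure mu \<longleftrightarrow> sets mu = sets borel \<and>
     (\<forall>s. \<forall>E\<in>sets borel. emeasure mu ((\<lambda>t. s + t) ` E) = emeasure mu E) \<and>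
     (\<forall>K. compact K \<longrightarrow> emeasure mu K < \<infinity>) \<and> emeasure mu UNIV \<noteq> 0"

definition right_haar_measure :: "'g::topological_group_add measure \<Rightarrow> bool" where
  "right_haar_measure nu \<longleftrightarrow> sets nu = sets borel \<and>
     (\<forall>s. \<forall>E\<in>sets borel. emeasure nu ((\<lambda>t. t + s) ` E) = emeasure nu E) \<and>
     (\<forall>K. compact K \<longrightarrow> emeasure nu K < \<infinity>) \<and> emeasure nu UNIV \<noteq> 0"

definition reflect :: "'g::topological_group_add measure \<Rightarrow> 'g measure" where
  "reflect m = distr m borel uminus"

lemma vimage_uminus_group: "uminus -` E = uminus ` E" for E :: "'g::group_add set"
proof (intro equalityI subsetI)
  fix x assume "x \<in> uminus -` E"
  then show "x \<in> uminus ` E" by (intro image_eqI[of _ _ "- x"]) simp_all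
qed auto

lemma borel_measurable_uminus_group:
  "(uminus :: 'g::topological_group_add \<Rightarrow> 'g) \<in> borel_measurable borel"
  by (intro borel_measurable_continuous_onI continuous_on_minus continuous_on_id)

lemma emeasure_reflect:
  fixes E :: "'g::topological_group_add set"
  assumes "sets m = sets borel" and "E \<in> sets borel"
  shows "emeasure (reflect m) E = emeasure m (uminus ` E)"
proof -
  have "uminus \<in> measurable m (borel :: 'g measure)"
    using borel_measurable_uminus_group by (simp add: measurable_cong_sets[OF assms(1) refl])
  then show ?thesis
    using assms(2) sets_eq_imp_space_eq[OF assms(1)]
    by (simp add: reflect_def emeasure_distr vimage_uminus_group)
qed

lemma left_haar_measure_reflect:
  fixes nu :: "'g::{topological_group_add,t2_space} measure"
  assumes "right_haar_measure nu"
  shows "left_haar_measure (reflect nu)"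
proof -
  have nu: "sets nu = sets borel" using assms by (simp add: right_haar_measure_def)
  have inv: "emeasure nu ((\<lambda>t. t + s) ` E) = emeasure nu E" if "E \<in> sets borel" for s E
    using assms that unfolding right_haar_measure_def by (elim conjE) (erule allE, erule (1) bspec)
  have bor: "uminus ` E \<in> sets borel" if "E \<in> sets borel" for E :: "'g set"
    using measurable_sets[OF borel_measurable_uminus_group that] by (simp add: vimage_uminus_group)
  have bor': "(\<lambda>t. s + t) ` E \<in> sets borel" if "E \<in> sets borel" for s and E :: "'g set"
  proof -
    have "(\<lambda>t. - s + t) \<in> borel_measurable borel"
      by (intro borel_measurable_continuous_onI continuous_on_add continuous_on_const
          continuous_on_id)
    moreover have "(\<lambda>t. - s + t) -` E = (\<lambda>t. s + t) ` E"
    proof (intro equalityI subsetI)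
      fix x assume "x \<in> (\<lambda>t. - s + t) -` E"
      then show "x \<in> (\<lambda>t. s + t) ` E"
        by (intro image_eqI[of _ _ "- s + x"]) (simp_all flip: add.assoc)
    qed (auto simp flip: add.assoc)
    ultimately show ?thesis
      using measurable_sets[of "\<lambda>t. - s + t" borel borel E] that by simp
  qed
  have "emeasure (reflect nu) ((\<lambda>t. s + t) ` E) = emeasure (reflect nu) E"
    if "E \<in> sets borel" for s E
  proof -
    have "uminus ` (\<lambda>t. s + t) ` E = (\<lambda>t. t + - s) ` uminus ` E"
      by (simp only: image_image minus_add)
    moreover have "emeasure nu ((\<lambda>t. t + - s) ` uminus ` E) = emeasure nu (uminus ` E)"
      by (rule inv[OF bor[OF that]])
    ultimately show ?thesis
      using that by (simp add: emeasure_reflect nu bor')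
  qed
  moreover have "emeasure (reflect nu) K < \<infinity>" if "compact K" for K
  proof -
    have "compact (uminus ` K)"
      by (rule compact_continuous_image[OF continuous_on_minus[OF continuous_on_id] that])
    then show ?thesis
      using assms that by (simp add: emeasure_reflect nu compact_imp_closed right_haar_measure_def)
  qed
  moreover have "emeasure (reflect nu) UNIV \<noteq> 0"
  proof -
    have "uminus ` (UNIV :: 'g set) = UNIV"
      by (rule surjI[of uminus uminus]) (rule minus_minus)
    moreover have "emeasure nu UNIV \<noteq> 0"
      using assms unfolding right_haar_measure_def by (elim conjE)
    ultimately show ?thesis
      using emeasure_reflect[OF nu, of UNIV] by simp
  qed
  moreover have "sets (reflect nu) = sets borel"
    by (simp add: reflect_def)
  ultimately show ?thesis
    unfolding left_haar_measure_def by blast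
qed

text \<open>Convention: \<open>mu (E t) = \<Delta> t * mu E\<close> for the left Haar measure \<open>mu\<close>.\<close>

definition modular_function :: "'g::topological_group_add measure \<Rightarrow> 'g \<Rightarrow> real" where
  "modular_function mu t = (THE d. 0 < d \<and>
     (\<forall>E\<in>sets borel. emeasure mu ((\<lambda>s. s + t) ` E) = ennreal d * emeasure mu E))"


section \<open>Normed *-algebras and enveloping C*-algebras\<close>

text \<open>Carrier-based, because the algebras below depend on the action and on the Haar measure.
  The norm may be a seminorm.\<close>

record 'a star_algebra =
  elems :: "'a set"
  sadd :: "'a \<Rightarrow> 'a \<Rightarrow> 'a"
  sscale :: "complex \<Rightarrow> 'a \<Rightarrow> 'a"
  smult :: "'a \<Rightarrow> 'a \<Rightarrow> 'a"
  sstar :: "'a \<Rightarrow> 'a"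
  snorm :: "'a \<Rightarrow> real"

definition sdiff :: "'a star_algebra \<Rightarrow> 'a \<Rightarrow> 'a \<Rightarrow> 'a" where
  "sdiff B a b = sadd B a (sscale B (- 1) b)"

definition cstar_seminorm :: "'a star_algebra \<Rightarrow> ('a \<Rightarrow> real) \<Rightarrow> bool" where
  "cstar_seminorm B p \<longleftrightarrow>
     (\<forall>a\<in>elems B. 0 \<le> p a \<and> p a \<le> snorm B a \<and> p (smult B (sstar B a) a) = (p a)\<^sup>2 \<and>
        (\<forall>c. p (sscale B c a) = cmod c * p a) \<and>
        (\<forall>b\<in>elems B. p (sadd B a b) \<le> p a + p b \<and> p (smult B a b) \<le> p a * p b))"

text \<open>The enveloping C*-algebra is the Hausdorff completion in the largest C*-seminorm. By
  Gelfand--Naimark, C*-seminorms are exactly the seminorms \<open>b \<mapsto> \<parallel>\<rho> b\<parallel>\<close> of *-representations \<open>\<rho>\<close> on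
  Hilbert spaces, so this is the usual supremum over all *-representations, phrased without
  quantifying over the types on which Hilbert spaces may live.\<close>

definition enveloping_norm :: "'a star_algebra \<Rightarrow> 'a \<Rightarrow> real" where
  "enveloping_norm B b = Sup {p b | p. cstar_seminorm B p}"

definition enveloping_cauchy :: "'a star_algebra \<Rightarrow> (nat \<Rightarrow> 'a) set" where
  "enveloping_cauchy B = {u. (\<forall>n. u n \<in> elems B) \<and>
     (\<forall>e>0. \<exists>N. \<forall>m\<ge>N. \<forall>n\<ge>N. enveloping_norm B (sdiff B (u m) (u n)) < e)}"

definition enveloping_class :: "'a star_algebra \<Rightarrow> (nat \<Rightarrow> 'a) \<Rightarrow> (nat \<Rightarrow> 'a) set" where
  "enveloping_class B u = {v \<in> enveloping_cauchy B.
     (\<lambda>n. enveloping_norm B (sdiff B (u n) (v n))) \<longlonglongrightarrow> 0}"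

definition some_in :: "'b set \<Rightarrow> 'b" where
  "some_in X = (SOME u. u \<in> X)"

definition enveloping_cstar_algebra :: "'a star_algebra \<Rightarrow> (nat \<Rightarrow> 'a) set star_algebra" where
  "enveloping_cstar_algebra B = \<lparr>
     elems = enveloping_class B ` enveloping_cauchy B,
     sadd = (\<lambda>X Y. enveloping_class B (\<lambda>n. sadd B (some_in X n) (some_in Y n))),
     sscale = (\<lambda>c X. enveloping_class B (\<lambda>n. sscale B c (some_in X n))),
     smult = (\<lambda>X Y. enveloping_class B (\<lambda>n. smult B (some_in X n) (some_in Y n))),
     sstar = (\<lambda>X. enveloping_class B (\<lambda>n. sstar B (some_in X n))),
     snorm = (\<lambda>X. lim (\<lambda>n. enveloping_norm B (some_in X n))) \<rparr>"


section \<open>The transformation-group C*-algebra\<close>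

text \<open>Elements of \<open>L\<^sup>1(G, C\<^sub>0(X))\<close> are represented by Bochner integrable functions. Functions that
  agree almost everywhere are identified only in the enveloping C*-algebra.\<close>

definition L1_algebra ::
  "('g::topological_group_add \<Rightarrow> 'x::second_countable_topology \<Rightarrow> 'x) \<Rightarrow> 'g measure
    \<Rightarrow> ('g \<Rightarrow> 'x c0) star_algebra" where
  "L1_algebra act mu = \<lparr>
     elems = {f. integrable mu f},
     sadd = (\<lambda>f g s. f s + g s),
     sscale = (\<lambda>c f s. c0_scale c (f s)),
     smult = (\<lambda>f g s. \<integral>r. f r * c0_translate act r (g (- r + s)) \<partial>mu),
     sstar = (\<lambda>f s. modular_function mu (- s) *\<^sub>R c0_translate act s (c0_cnj (f (- s)))),
     snorm = (\<lambda>f. \<integral>s. norm (f s) \<partial>mu) \<rparr>"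

definition crossed_product ::
  "('g::topological_group_add \<Rightarrow> 'x::second_countable_topology \<Rightarrow> 'x) \<Rightarrow> 'g measure
    \<Rightarrow> (nat \<Rightarrow> 'g \<Rightarrow> 'x c0) set star_algebra" where
  "crossed_product act mu = enveloping_cstar_algebra (L1_algebra act mu)"


section \<open>Hilbert spaces and representations\<close>

text \<open>Inner products are linear in the first argument.\<close>

record 'h hilbert =
  vecs :: "'h set"
  hadd :: "'h \<Rightarrow> 'h \<Rightarrow> 'h"
  hscale :: "complex \<Rightarrow> 'h \<Rightarrow> 'h"
  hinner :: "'h \<Rightarrow> 'h \<Rightarrow> complex"

definition hnorm :: "'h hilbert \<Rightarrow> 'h \<Rightarrow> real" where
  "hnorm H \<xi> = sqrt (Re (hinner H \<xi> \<xi>))"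

definition hdiff :: "'h hilbert \<Rightarrow> 'h \<Rightarrow> 'h \<Rightarrow> 'h" where
  "hdiff H \<xi> \<eta> = hadd H \<xi> (hscale H (- 1) \<eta>)"

definition orthonormal :: "'h hilbert \<Rightarrow> 'h set \<Rightarrow> bool" where
  "orthonormal H S \<longleftrightarrow> (\<forall>\<xi>\<in>S. \<forall>\<eta>\<in>S. hinner H \<xi> \<eta> = (if \<xi> = \<eta> then 1 else 0))"

definition L2_funs :: "'g measure \<Rightarrow> ('g \<Rightarrow> complex) set" where
  "L2_funs nu = {f \<in> borel_measurable nu. integrable nu (\<lambda>s. (cmod (f s))\<^sup>2)}"

definition L2_class :: "'g measure \<Rightarrow> ('g \<Rightarrow> complex) \<Rightarrow> ('g \<Rightarrow> complex) set" where
  "L2_class nu f = {g \<in> L2_funs nu. AE s in nu. g s = f s}"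

definition L2 :: "'g measure \<Rightarrow> ('g \<Rightarrow> complex) set hilbert" where
  "L2 nu = \<lparr>
     vecs = L2_class nu ` L2_funs nu,
     hadd = (\<lambda>\<xi> \<eta>. L2_class nu (\<lambda>s. some_in \<xi> s + some_in \<eta> s)),
     hscale = (\<lambda>c \<xi>. L2_class nu (\<lambda>s. c * some_in \<xi> s)),
     hinner = (\<lambda>\<xi> \<eta>. \<integral>s. some_in \<xi> s * cnj (some_in \<eta> s) \<partial>nu) \<rparr>"

record ('a, 'h) representation =
  rspace :: "'h hilbert"
  rop :: "'a \<Rightarrow> 'h \<Rightarrow> 'h"

text \<open>The operator \<open>\<integral> P (f s) U s d mu(s)\<close> as a weak integral.\<close>

definition integrated_form ::
  "'g measure \<Rightarrow> 'h hilbert \<Rightarrow> ('c \<Rightarrow> 'h \<Rightarrow> 'h) \<Rightarrow> ('g \<Rightarrow> 'h \<Rightarrow> 'h) \<Rightarrow> ('g \<Rightarrow> 'c) \<Rightarrow> 'h \<Rightarrow> 'h" where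
  "integrated_form mu H P U f \<xi> = (THE \<zeta>. \<zeta> \<in> vecs H \<and>
     (\<forall>\<eta>\<in>vecs H. hinner H \<zeta> \<eta> = (\<integral>s. hinner H (P (f s) (U s \<xi>)) \<eta> \<partial>mu)))"

text \<open>Extension by continuity of a representation \<open>\<sigma>\<close> to the enveloping C*-algebra.\<close>

definition enveloping_extension ::
  "'h hilbert \<Rightarrow> ('a \<Rightarrow> 'h \<Rightarrow> 'h) \<Rightarrow> (nat \<Rightarrow> 'a) set \<Rightarrow> 'h \<Rightarrow> 'h" where
  "enveloping_extension H \<sigma> X \<xi> = (THE \<zeta>. \<zeta> \<in> vecs H \<and>
     (\<forall>u\<in>X. (\<lambda>n. hnorm H (hdiff H (\<sigma> (u n) \<xi>) \<zeta>)) \<longlonglongrightarrow> 0))"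

definition eval_rep ::
  "('g \<Rightarrow> 'x::topological_space \<Rightarrow> 'x) \<Rightarrow> 'g measure \<Rightarrow> 'x \<Rightarrow> 'x c0
    \<Rightarrow> ('g \<Rightarrow> complex) set \<Rightarrow> ('g \<Rightarrow> complex) set" where
  "eval_rep act nu x f \<xi> = L2_class nu (\<lambda>s. c0_apply f (act s x) * some_in \<xi> s)"

definition translation_rep ::
  "'g::topological_group_add measure \<Rightarrow> 'g measure \<Rightarrow> 'g
    \<Rightarrow> ('g \<Rightarrow> complex) set \<Rightarrow> ('g \<Rightarrow> complex) set" where
  "translation_rep mu nu t \<xi> =
     L2_class nu (\<lambda>s. complex_of_real (sqrt (modular_function mu t)) * some_in \<xi> (- t + s))"

definition Ind ::
  "('g::topological_group_add \<Rightarrow> 'x::second_countable_topology \<Rightarrow> 'x) \<Rightarrow> 'g measure \<Rightarrow> 'x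
    \<Rightarrow> ((nat \<Rightarrow> 'g \<Rightarrow> 'x c0) set, ('g \<Rightarrow> complex) set) representation" where
  "Ind act mu x = (let nu = reflect mu in
     \<lparr> rspace = L2 nu,
       rop = enveloping_extension (L2 nu)
         (integrated_form mu (L2 nu) (eval_rep act nu x) (translation_rep mu nu)) \<rparr>)"


section \<open>Pure states and upper multiplicity\<close>

text \<open>Functionals on a carrier-based algebra are extended by 0 outside the carrier.\<close>

definition cstar_dual :: "'a star_algebra \<Rightarrow> ('a \<Rightarrow> complex) set" where
  "cstar_dual A = {\<psi>. (\<forall>a. a \<notin> elems A \<longrightarrow> \<psi> a = 0) \<and>
     (\<forall>a\<in>elems A. \<forall>b\<in>elems A. \<psi> (sadd A a b) = \<psi> a + \<psi> b) \<and>
     (\<forall>c. \<forall>a\<in>elems A. \<psi> (sscale A c a) = c * \<psi> a) \<and>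
     (\<exists>C. \<forall>a\<in>elems A. cmod (\<psi> a) \<le> C * snorm A a)}"

definition dual_norm :: "'a star_algebra \<Rightarrow> ('a \<Rightarrow> complex) \<Rightarrow> real" where
  "dual_norm A \<psi> = Sup {cmod (\<psi> a) | a. a \<in> elems A \<and> snorm A a \<le> 1}"

definition positive_functionals :: "'a star_algebra \<Rightarrow> ('a \<Rightarrow> complex) set" where
  "positive_functionals A = {\<psi> \<in> cstar_dual A. \<forall>a\<in>elems A. \<psi> (smult A (sstar A a) a) \<in> \<real>\<^sub>\<ge>\<^sub>0}"

definition pure_states :: "'a star_algebra \<Rightarrow> ('a \<Rightarrow> complex) set" where
  "pure_states A = {\<phi> \<in> positive_functionals A. dual_norm A \<phi> = 1 \<and>
     (\<forall>\<psi>\<in>positive_functionals A. (\<lambda>a. \<phi> a - \<psi> a) \<in> positive_functionals A \<longrightarrow>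
        (\<exists>t::real. 0 \<le> t \<and> t \<le> 1 \<and> \<psi> = (\<lambda>a. complex_of_real t * \<phi> a)))}"

definition vector_functional ::
  "'a star_algebra \<Rightarrow> ('a, 'h) representation \<Rightarrow> 'h \<Rightarrow> 'a \<Rightarrow> complex" where
  "vector_functional A \<sigma> \<eta> a =
     (if a \<in> elems A then hinner (rspace \<sigma>) (rop \<sigma> a \<eta>) \<eta> else 0)"

definition associated_pure_states ::
  "'a star_algebra \<Rightarrow> ('a, 'h) representation \<Rightarrow> ('a \<Rightarrow> complex) set" where
  "associated_pure_states A \<pi> = {\<phi> \<in> pure_states A.
     \<exists>\<xi>\<in>vecs (rspace \<pi>). hnorm (rspace \<pi>) \<xi> = 1 \<and> \<phi> = vector_functional A \<pi> \<xi>}"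

definition weak_star_nhds :: "'a star_algebra \<Rightarrow> ('a \<Rightarrow> complex) set set" where
  "weak_star_nhds A =
     {{\<psi> \<in> cstar_dual A. \<forall>a\<in>F. cmod (\<psi> a) < \<epsilon>} | F \<epsilon>. finite F \<and> F \<subseteq> elems A \<and> 0 < \<epsilon>}"

definition Vec ::
  "'a star_algebra \<Rightarrow> ('a, 'h) representation \<Rightarrow> ('a \<Rightarrow> complex) \<Rightarrow> ('a \<Rightarrow> complex) set \<Rightarrow> 'h set"
  where
  "Vec A \<sigma> \<phi> N = {\<eta> \<in> vecs (rspace \<sigma>). hnorm (rspace \<sigma>) \<eta> = 1 \<and>
     (\<exists>\<psi>\<in>N. vector_functional A \<sigma> \<eta> = (\<lambda>a. \<phi> a + \<psi> a))}"

definition vec_dim ::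
  "'a star_algebra \<Rightarrow> ('a, 'h) representation \<Rightarrow> ('a \<Rightarrow> complex) \<Rightarrow> ('a \<Rightarrow> complex) set \<Rightarrow> enat"
  where
  "vec_dim A \<sigma> \<phi> N =
     Sup {enat (card S) | S. finite S \<and> S \<subseteq> Vec A \<sigma> \<phi> N \<and> orthonormal (rspace \<sigma>) S}"

text \<open>\<open>M\<^sub>U(\<pi>, \<Omega>)\<close>, computed at a pure state \<open>\<phi>\<close> associated with \<open>\<pi>\<close>; the value is the same for all
  such \<open>\<phi>\<close>. The net \<open>\<Omega>\<close> is a family together with the filter along which it is considered.\<close>

definition upper_multiplicity ::
  "'a star_algebra \<Rightarrow> ('a \<Rightarrow> complex) \<Rightarrow> 'i filter \<Rightarrow> ('i \<Rightarrow> ('a, 'h) representation) \<Rightarrow> enat"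
  where
  "upper_multiplicity A \<phi> F \<Omega> =
     (INF N\<in>weak_star_nhds A. Limsup F (\<lambda>i. vec_dim A (\<Omega> i) \<phi> N))"

end

theory Submission
  imports Defs
begin

text \<open>Fix a unit vector \<open>\<xi>\<close> defining the pure state. Near the orbit of \<open>z\<close> the orbit map is a
  homeomorphism on relatively compact sets, so \<open>\<xi>\<close> is approximated in \<open>L\<^sup>2\<close> by \<open>s \<mapsto> g(s\<cdot>z)\<close> with \<open>g\<close> in
  \<open>C\<^sub>0(X)\<close>. Choose \<open>f\<close> in \<open>C\<^sub>0(X)\<close> close to the indicator of \<open>V\<close>, and let \<open>D\<close> be the element of the algebra
  that \<open>Ind \<epsilon>\<^sub>x\<close> maps to the operator with kernel \<open>f(s\<cdot>x) cnj(g(r\<cdot>x)) 1\<^sub>B(sr\<inverse>)\<close>, where the compact set \<open>B\<close> is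
  so large that the truncation is invisible at \<open>x = z\<close>. There the operator has rank one, and
  \<open>\<phi>(D\<^sup>*D)\<close> is nearly \<open>nu(\<phi>\<^sub>z\<inverse>(V))\<close>. At \<open>x\<^sub>n\<close> the squared Hilbert--Schmidt norm is at most about
  \<open>nu(\<phi>\<^bsub>x\<^sub>n\<^esub>\<inverse>(V)) \<le> M nu(\<phi>\<^sub>z\<inverse>(V))\<close>: the \<open>L\<^sup>2\<close>-norm of a row of the kernel is a continuous
  function of \<open>s\<cdot>x\<close>, at most \<open>\<parallel>s \<mapsto> g(s\<cdot>z)\<parallel>\<close> on the orbit of \<open>z\<close>, and \<open>f\<close> is supported where it is
  nearly that small. Each vector of an orthonormal family whose states are close to \<open>\<phi>\<close> at \<open>D\<^sup>*D\<close>
  contributes nearly \<open>nu(\<phi>\<^sub>z\<inverse>(V))\<close> to that norm, so there are at most \<open>\<lfloor>M\<rfloor>\<close> of them.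

  To evaluate representations of the enveloping algebra on \<open>L\<^sup>1\<close> elements one needs that the operator
  norm of \<open>Ind \<epsilon>\<^sub>x\<close> is a C*-seminorm on \<open>L\<^sup>1(G, C\<^sub>0(X))\<close>, and for this the uniqueness of Haar measure.\<close>

section \<open>Measurability in spaces of continuous functions\<close>

text \<open>The truncation to \<open>B\<close> cures two defects. Without it the function of
  \<open>t\<close> that represents the kernel need not be integrable, and the rows at
  \<open>x_n\<close> need not be square integrable, since an orbit passing near that of
  \<open>z\<close> may return to the support of \<open>g\<close> again and again. With it each row
  integral runs over a fixed compact set, and continuity in X carries the bound from the orbit of
  \<open>z\<close> to an open set containing it. \<open>D\<close> is tested through D-star D because
  a vector state takes the value |D eta|^2 there. These numbers add up over an orthonormal family,
  whereas a bound for an operator norm says nothing about how many vectors there are. One element,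
  hence one weak-star neighbourhood, suffices; it comes from L^1, so the completion is entered only
  through classes of constant sequences. Since M is strictly below floor M + 1, a small relative
  loss \<open>d\<close> is affordable in each of the finitely many estimates.\<close>

lemma continuous_on_c0_apply_pair:
  "continuous_on UNIV (\<lambda>p :: 'x::topological_space c0 \<times> 'x. c0_apply (fst p) (snd p))"
  unfolding continuous_on_def
proof (clarify, rule tendstoI)
  fix F :: "'x c0" and y :: 'x and e :: real assume "0 < e"
  have "(c0_apply F \<longlongrightarrow> c0_apply F y) (nhds y)"
    using continuous_on_c0_apply[of UNIV F] by (simp add: continuous_on_def tendsto_at_iff_tendsto_nhds)
  then have "\<forall>\<^sub>F y' in nhds y. dist (c0_apply F y') (c0_apply F y) < e / 2"
    using \<open>0 < e\<close> by (intro tendstoD) simp_all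
  moreover have "\<forall>\<^sub>F F' in nhds F. dist F' F < e / 2"
    using \<open>0 < e\<close> by (intro eventually_nhds_metric[THEN iffD2]) (auto intro!: exI[of _ "e / 2"])
  ultimately have "\<forall>\<^sub>F p in nhds (F, y). dist (fst p) F < e / 2 \<and> dist (c0_apply F (snd p)) (c0_apply F y) < e / 2"
    by (auto simp: nhds_prod eventually_prod_filter)
  moreover have "dist (c0_apply (fst p) (snd p)) (c0_apply F y)
      \<le> dist (fst p) F + dist (c0_apply F (snd p)) (c0_apply F y)" for p
    using dist_triangle[of "c0_apply (fst p) (snd p)" "c0_apply F y" "c0_apply F (snd p)"]
      dist_c0_apply_le[of "fst p" "snd p" F] by simp
  ultimately have "\<forall>\<^sub>F p in nhds (F, y). dist (c0_apply (fst p) (snd p)) (c0_apply F y) < e"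
    by (elim eventually_mono) (smt (verit, best) field_sum_of_halves)
  then show "\<forall>\<^sub>F p in at (F, y). dist (c0_apply (fst p) (snd p))
      (c0_apply (fst (F, y)) (snd (F, y))) < e"
    by (simp add: eventually_at_filter eventually_mono)
qed

lemma borel_measurable_c0_apply [measurable (raw)]:
  fixes f :: "'a \<Rightarrow> 'x::second_countable_topology c0"
  assumes [measurable]: "f \<in> borel_measurable M" "k \<in> borel_measurable M"
  shows "(\<lambda>t. c0_apply (f t) (k t)) \<in> borel_measurable M"
proof -
  have "(\<lambda>p::'x c0 \<times> 'x. c0_apply (fst p) (snd p)) \<in> borel_measurable borel"
    by (rule borel_measurable_continuous_onI[OF continuous_on_c0_apply_pair])
  then have "(\<lambda>t. (\<lambda>p. c0_apply (fst p) (snd p)) (f t, k t)) \<in> borel_measurable M"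
    by (rule measurable_compose[rotated]) measurable
  then show ?thesis by simp
qed

text \<open>Norm balls are countable intersections of conditions on point evaluations at a dense set, so
  no strong continuity of the action on the function algebra is ever needed.\<close>

lemma borel_measurable_c0I:
  fixes h :: "'a \<Rightarrow> 'x::second_countable_topology c0"
  assumes [measurable]: "\<And>y. (\<lambda>t. c0_apply (h t) y) \<in> borel_measurable M"
  shows "h \<in> borel_measurable M"
proof (rule borel_measurableI)
  fix S :: "'x c0 set" assume "open S"
  obtain Y :: "'x set" where Y: "countable Y" "\<And>U. open U \<Longrightarrow> U \<noteq> {} \<Longrightarrow> \<exists>y\<in>Y. y \<in> U"
    using countable_dense_setE by blast
  obtain D :: "'x c0 set" where D: "countable D" "\<And>f e. 0 < e \<Longrightarrow> \<exists>g\<in>D. dist f g < e"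
    using countable_dense_c0 by blast
  have dist_le: "dist f g \<le> e \<longleftrightarrow> (\<forall>y\<in>Y. dist (c0_apply f y) (c0_apply g y) \<le> e)" for f g :: "'x c0" and e
  proof
    assume *: "\<forall>y\<in>Y. dist (c0_apply f y) (c0_apply g y) \<le> e"
    have "open {x. e < dist (c0_apply f x) (c0_apply g x)}"
      by (intro open_Collect_less continuous_intros)
    then have "{x. e < dist (c0_apply f x) (c0_apply g x)} = {}"
      using Y(2) * by fastforce
    then show "dist f g \<le> e"
      by (intro dist_c0_le) (auto simp: not_less)
  qed (use dist_c0_apply_le order_trans in blast)
  define I where "I = {(g, n). g \<in> D \<and> cball g (1 / real (Suc n)) \<subseteq> S}"
  have "countable I"
    using D(1) by (intro countable_subset[of I "D \<times> UNIV"]) (auto simp: I_def)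
  \<comment> \<open>Closed balls rather than open ones: only the non-strict condition
    \<open>dist \<le> e\<close> passes from the dense set \<open>Y\<close> to all points.\<close>
  have S_eq: "S = (\<Union>(g, n)\<in>I. cball g (1 / real (Suc n)))"
  proof (intro equalityI subsetI)
    fix f assume "f \<in> S"
    then obtain e where e: "0 < e" "ball f e \<subseteq> S" using \<open>open S\<close> by (auto simp: open_contains_ball)
    obtain n where n: "1 / real (Suc n) < e / 2"
      using e(1) nat_approx_posE[of "e / 2"] by auto
    obtain g where g: "g \<in> D" "dist f g < 1 / real (Suc n)"
      using D(2)[of "1 / real (Suc n)" f] by auto
    have "cball g (1 / real (Suc n)) \<subseteq> ball f e"
    proof
      fix h assume "h \<in> cball g (1 / real (Suc n))"
      then show "h \<in> ball f e"
        using dist_triangle[of f h g] g(2) n by simp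
    qed
    then have "(g, n) \<in> I" "f \<in> cball g (1 / real (Suc n))"
      using g e(2) by (auto simp: I_def dist_commute)
    then show "f \<in> (\<Union>(g, n)\<in>I. cball g (1 / real (Suc n)))" by blast
  qed (auto simp: I_def)
  have "h -` S \<inter> space M = (\<Union>(g, n)\<in>I. {t\<in>space M. dist g (h t) \<le> 1 / real (Suc n)})"
    by (subst S_eq) (auto intro!: bexI[of _ "(_, _)"])
  also have "\<dots> \<in> sets M"
  proof (rule sets.countable_UN'[OF \<open>countable I\<close>], clarify)
    fix g n
    have "{t\<in>space M. dist g (h t) \<le> 1 / real (Suc n)}
        = {t\<in>space M. \<forall>y\<in>Y. dist (c0_apply g y) (c0_apply (h t) y) \<le> 1 / real (Suc n)}"
      by (simp only: dist_le)
    also have "\<dots> \<in> sets M"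
      using Y(1) by measurable
    finally show "{t\<in>space M. dist g (h t) \<le> 1 / real (Suc n)} \<in> sets M" .
  qed
  finally show "h -` S \<inter> space M \<in> sets M" .
qed

lemma bounded_linear_c0_apply: "bounded_linear (\<lambda>f. c0_apply f y)"
  by (rule bounded_linear_intro[of _ 1]) (auto simp: norm_c0_apply_le)

lemma norm_c0_translate:
  fixes act :: "'g::{topological_group_add,t2_space} \<Rightarrow> 'x::t2_space \<Rightarrow> 'x"
  assumes "transformation_group act"
  shows "norm (c0_translate act s f) \<le> norm f"
  by (rule norm_c0_le) (simp add: c0_apply_translate[OF assms] norm_c0_apply_le)

lemma norm_c0_cnj: "norm (c0_cnj f) \<le> norm f"
  by (rule norm_c0_le) (simp add: norm_c0_apply_le)

lemma norm_c0_scale: "norm (c0_scale c f) \<le> cmod c * norm f"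
  by (rule norm_c0_le) (auto simp: norm_mult norm_c0_apply_le intro!: mult_left_mono)

declare borel_measurable_uminus_group [measurable]

lemma group_image_eq_vimage:
  fixes s :: "'g::group_add"
  shows "(\<lambda>t. s + t) ` E = (\<lambda>t. - s + t) -` E" "(\<lambda>t. t + s) ` E = (\<lambda>t. t + - s) -` E"
    "uminus ` E = uminus -` E"
proof -
  have "x \<in> (\<lambda>t. s + t) ` E" if "- s + x \<in> E" for x
    using that by (intro image_eqI[of _ _ "- s + x"]) (simp_all flip: add.assoc)
  then show "(\<lambda>t. s + t) ` E = (\<lambda>t. - s + t) -` E"
    by (auto simp flip: add.assoc)
  have "x \<in> (\<lambda>t. t + s) ` E" if "x + - s \<in> E" for x
    using that by (intro image_eqI[of _ _ "x + - s"]) (simp_all add: add.assoc)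
  then show "(\<lambda>t. t + s) ` E = (\<lambda>t. t + - s) -` E"
    by (auto simp add: add.assoc simp del: add_uminus_conv_diff)
  show "uminus ` E = uminus -` E"
    by (simp add: vimage_uminus_group)
qed

section \<open>Haar measure\<close>

locale left_haar =
  fixes mu :: "'g::{topological_group_add,t2_space,second_countable_topology} measure"
  assumes locally_compact: "locally_compact_space (euclidean :: 'g topology)"
    and haar: "left_haar_measure mu"
begin

lemma sets_mu [measurable_cong]: "sets mu = sets borel"
  using haar by (simp add: left_haar_measure_def)

lemma space_mu [simp]: "space mu = UNIV"
  using sets_eq_imp_space_eq[OF sets_mu] by simp

lemma emeasure_compact: "compact K \<Longrightarrow> emeasure mu K < \<infinity>"
  using haar unfolding left_haar_measure_def by (elim conjE) (erule (1) allE[THEN mp])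

lemma emeasure_mu_UNIV: "emeasure mu UNIV \<noteq> 0"
  using haar unfolding left_haar_measure_def by (elim conjE)

lemma open_compact_nbhd:
  obtains U K where "open U" "compact K" "(x::'g) \<in> U" "U \<subseteq> K"
proof -
  have "\<exists>U K. openin euclidean U \<and> compactin euclidean K \<and> x \<in> U \<and> U \<subseteq> K"
    using bspec[OF locally_compact[unfolded locally_compact_space_def], of x] by simp
  then obtain U K where "open U" "compact K" "x \<in> U" "U \<subseteq> K"
    by auto
  then show thesis by (rule that)
qed

text \<open>Lindelof applied to the open sets with compact hull. Both \<open>mu\<close> and its
  reflection get sigma-finiteness, and with it Fubini, from this cover.\<close>

lemma countable_open_compact_cover:
  obtains \<U> :: "'g set set" where "countable \<U>" "\<Union>\<U> = UNIV"
    "\<And>U. U \<in> \<U> \<Longrightarrow> open U \<and> (\<exists>K. compact K \<and> U \<subseteq> K)"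
proof -
  define \<C> where "\<C> = {U::'g set. open U \<and> (\<exists>K. compact K \<and> U \<subseteq> K)}"
  have "x \<in> \<Union>\<C>" for x :: 'g
  proof -
    obtain U K where "open U" "compact K" "x \<in> U" "U \<subseteq> K"
      by (rule open_compact_nbhd)
    then have "U \<in> \<C>" unfolding \<C>_def by blast
    with \<open>x \<in> U\<close> show ?thesis by blast
  qed
  then have UN: "\<Union>\<C> = UNIV" by blast
  have op: "open U" if "U \<in> \<C>" for U using that by (simp add: \<C>_def)
  obtain \<U> where \<U>: "\<U> \<subseteq> \<C>" "countable \<U>" "\<Union>\<U> = \<Union>\<C>"
    by (rule Lindelof[OF op])
  show thesis
  proof (rule that[of \<U>])
    show "open U \<and> (\<exists>K. compact K \<and> U \<subseteq> K)" if "U \<in> \<U>" for U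
      using subsetD[OF \<U>(1) that] by (simp add: \<C>_def)
  qed (use \<U> UN in simp_all)
qed

sublocale sigma_finite_measure mu
proof
  obtain \<U> :: "'g set set" where \<U>: "countable \<U>" "\<Union>\<U> = UNIV"
    "\<And>U. U \<in> \<U> \<Longrightarrow> open U \<and> (\<exists>K. compact K \<and> U \<subseteq> K)"
    using countable_open_compact_cover by blast
  have "emeasure mu U \<noteq> \<infinity>" if U: "U \<in> \<U>" for U
  proof -
    obtain K where K: "compact K" "U \<subseteq> K" using \<U>(3)[OF U] by blast
    have "K \<in> sets mu" using compact_imp_closed[OF K(1)] by (simp add: sets_mu)
    then have "emeasure mu U \<le> emeasure mu K" using K by (intro emeasure_mono)
    then show ?thesis using emeasure_compact[OF K(1)] by (auto simp: top_unique)
  qed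
  then show "\<exists>A. countable A \<and> A \<subseteq> sets mu \<and> \<Union>A = space mu \<and> (\<forall>a\<in>A. emeasure mu a \<noteq> \<infinity>)"
    using \<U> by (intro exI[of _ \<U>]) (auto simp: sets_mu)
qed

lemma distr_translate: "distr mu borel (\<lambda>t. s + t) = mu"
proof (rule measure_eqI)
  fix A assume "A \<in> sets (distr mu borel (\<lambda>t. s + t))"
  then have A: "A \<in> sets borel" by simp
  have "(\<lambda>t. s + t) -` A = (\<lambda>t. - s + t) ` A"
    by (simp add: group_image_eq_vimage)
  moreover have "emeasure mu ((\<lambda>t. - s + t) ` A) = emeasure mu A"
    using haar A unfolding left_haar_measure_def by (elim conjE) (erule allE, erule (1) bspec)
  ultimately show "emeasure (distr mu borel (\<lambda>t. s + t)) A = emeasure mu A"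
    using A by (simp add: emeasure_distr)
qed (simp add: sets_mu)

lemma nn_integral_translate:
  assumes [measurable]: "f \<in> borel_measurable borel"
  shows "(\<integral>\<^sup>+t. f (s + t) \<partial>mu) = (\<integral>\<^sup>+t. f t \<partial>mu)"
  by (subst (2) distr_translate[of s, symmetric]) (simp add: nn_integral_distr)

lemma integral_translate:
  fixes f :: "'g \<Rightarrow> 'b::{banach,second_countable_topology}"
  assumes [measurable]: "f \<in> borel_measurable borel"
  shows "(\<integral>t. f (s + t) \<partial>mu) = (\<integral>t. f t \<partial>mu)"
  by (subst (2) distr_translate[of s, symmetric]) (simp add: integral_distr)

text \<open>By Lindelof countably many translates of \<open>U\<close> cover the group. If
  \<open>U\<close> were null, so would be all translates and then the whole group.\<close>

lemma emeasure_open_pos: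
  assumes "open U" "U \<noteq> {}"
  shows "0 < emeasure mu U"
proof (rule ccontr)
  assume "\<not> 0 < emeasure mu U"
  then have 0: "emeasure mu U = 0" by simp
  have op: "open ((\<lambda>t. s + t) -` U)" for s
    by (intro open_vimage assms continuous_intros)
  obtain u where "u \<in> U" using assms by blast
  obtain \<F> where \<F>: "\<F> \<subseteq> range (\<lambda>s. (\<lambda>t. s + t) -` U)" "countable \<F>"
    "\<Union>\<F> = \<Union>(range (\<lambda>s. (\<lambda>t. s + t) -` U))"
    by (rule Lindelof[of "range (\<lambda>s. (\<lambda>t. s + t) -` U)"]) (use op in auto)
  have "x \<in> (\<lambda>t. (u + - x) + t) -` U" for x
    using \<open>u \<in> U\<close> by (simp add: add.assoc del: add_uminus_conv_diff)
  then have "x \<in> \<Union>(range (\<lambda>s. (\<lambda>t. s + t) -` U))" for x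
    by (rule UN_I[OF UNIV_I])
  then have "\<Union>\<F> = UNIV" unfolding \<F>(3) by (rule UNIV_eq_I[symmetric])
  moreover have "A \<in> null_sets mu" if A: "A \<in> \<F>" for A
  proof -
    obtain s where s: "A = (\<lambda>t. s + t) -` U" using subsetD[OF \<F>(1) A] by (rule imageE)
    have "emeasure mu A = emeasure (distr mu borel (\<lambda>t. s + t)) U"
      using assms(1) by (simp add: s emeasure_distr)
    then show ?thesis using 0 op[of s] by (simp add: distr_translate null_sets_def sets_mu s)
  qed
  ultimately have "UNIV \<in> null_sets mu"
    using null_sets_UN'[OF \<F>(2), of "\<lambda>A. A" mu] by simp
  then show False using emeasure_mu_UNIV by auto
qed

end

text \<open>Evaluate the double integral of \<open>f x g(yx) / \<integral>g(tx) dt\<close> in two ways, shifting by \<open>x \<mapsto> y\<inverse>x\<close>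
  and then \<open>y \<mapsto> xy\<close>: the second factor on the right does not depend on \<open>mu\<close>.\<close>

lemma left_haar_measure_unique_aux:
  fixes mu la :: "'g::{topological_group_add,t2_space,second_countable_topology} measure"
  assumes "left_haar mu" "left_haar la"
  and [measurable]: "f \<in> borel_measurable borel" "g \<in> borel_measurable borel"
  and G: "\<And>x. 0 < (\<integral>\<^sup>+t. g (t + x) \<partial>la)" "\<And>x. (\<integral>\<^sup>+t. g (t + x) \<partial>la) < \<infinity>"
  shows "(\<integral>\<^sup>+t. f t \<partial>mu) = (\<integral>\<^sup>+t. g t \<partial>mu) * (\<integral>\<^sup>+y. f (- y) / (\<integral>\<^sup>+t. g (t + - y) \<partial>la) \<partial>la)"
proof -
  interpret mu: left_haar mu by fact
  interpret la: left_haar la by fact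
  interpret P: pair_sigma_finite la mu ..
  note [measurable_cong] = mu.sets_mu la.sets_mu
  \<comment> \<open>Dividing by \<open>H x\<close> normalizes: the inner integral of
    \<open>g (y + x) / H x\<close> over \<open>y\<close> is 1, so it can be inserted under the
    integral of \<open>f\<close>. Positivity and finiteness in \<open>G\<close> make the division
    harmless.\<close>
  define H where "H x = (\<integral>\<^sup>+t. g (t + x) \<partial>la)" for x
  have [measurable]: "H \<in> borel_measurable borel" unfolding H_def by measurable
  have "(\<integral>\<^sup>+x. f x \<partial>mu) = (\<integral>\<^sup>+x. (\<integral>\<^sup>+y. f x / H x * g (y + x) \<partial>la) \<partial>mu)"
  proof (rule nn_integral_cong)
    fix x
    have "(\<integral>\<^sup>+y. f x / H x * g (y + x) \<partial>la) = f x / H x * H x"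
      by (subst nn_integral_cmult) (simp_all add: H_def)
    also have "\<dots> = f x"
      using G[of x] by (simp add: H_def ennreal_divide_times ennreal_divide_self)
    finally show "f x = (\<integral>\<^sup>+y. f x / H x * g (y + x) \<partial>la)" ..
  qed
  also have "\<dots> = (\<integral>\<^sup>+y. (\<integral>\<^sup>+x. f x / H x * g (y + x) \<partial>mu) \<partial>la)"
    by (rule P.Fubini') measurable
  also have "\<dots> = (\<integral>\<^sup>+y. (\<integral>\<^sup>+x. f (- y + x) / H (- y + x) * g x \<partial>mu) \<partial>la)"
  proof (rule nn_integral_cong)
    fix y
    show "(\<integral>\<^sup>+x. f x / H x * g (y + x) \<partial>mu) = (\<integral>\<^sup>+x. f (- y + x) / H (- y + x) * g x \<partial>mu)"
      by (subst mu.nn_integral_translate[of "\<lambda>x. f x / H x * g (y + x)" "- y", symmetric])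
        (simp_all flip: add.assoc)
  qed
  also have "\<dots> = (\<integral>\<^sup>+x. (\<integral>\<^sup>+y. f (- y + x) / H (- y + x) * g x \<partial>la) \<partial>mu)"
    by (rule P.Fubini'[symmetric]) measurable
  also have "\<dots> = (\<integral>\<^sup>+x. (\<integral>\<^sup>+y. f (- y) / H (- y) * g x \<partial>la) \<partial>mu)"
  proof (rule nn_integral_cong)
    fix x
    show "(\<integral>\<^sup>+y. f (- y + x) / H (- y + x) * g x \<partial>la) = (\<integral>\<^sup>+y. f (- y) / H (- y) * g x \<partial>la)"
      by (subst la.nn_integral_translate[of "\<lambda>y. f (- y + x) / H (- y + x) * g x" x, symmetric])
        (simp_all add: minus_add add.assoc del: add_uminus_conv_diff)
  qed
  also have "\<dots> = (\<integral>\<^sup>+x. (\<integral>\<^sup>+y. f (- y) / H (- y) \<partial>la) * g x \<partial>mu)"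
    by (intro nn_integral_cong nn_integral_multc) measurable
  also have "\<dots> = (\<integral>\<^sup>+y. f (- y) / H (- y) \<partial>la) * (\<integral>\<^sup>+x. g x \<partial>mu)"
    by (intro nn_integral_cmult) measurable
  finally show ?thesis by (simp add: H_def mult.commute)
qed

text \<open>The auxiliary identity is used twice with the same indicators of \<open>E\<close> and
  \<open>U\<close>, once for the pair \<open>mu\<close>, \<open>la\<close> and once with
  \<open>la\<close> in both roles. The factor \<open>C\<close> is the same, so
  \<open>mu E / mu U = la E / la U\<close>. This reaches every Borel set \<open>E\<close> at once,
  without a detour through regularity.\<close>

theorem left_haar_measure_unique:
  fixes mu la :: "'g::{topological_group_add,t2_space,second_countable_topology} measure"
  assumes "left_haar mu" "left_haar la"
  obtains c :: real where "0 < c" "\<And>E. E \<in> sets borel \<Longrightarrow> emeasure mu E = ennreal c * emeasure la E"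
proof -
  interpret mu: left_haar mu by fact
  interpret la: left_haar la by fact
  note [measurable_cong] = mu.sets_mu la.sets_mu
  obtain U K where UK: "open U" "compact K" "(0::'g) \<in> U" "U \<subseteq> K"
    using mu.open_compact_nbhd by blast
  have [measurable]: "U \<in> sets borel" using UK by simp
  have K[measurable]: "K \<in> sets borel" using UK(2) by (simp add: compact_imp_closed)
  have eq: "(\<integral>\<^sup>+t. indicator U (t + x) \<partial>la) = emeasure la ((\<lambda>t. t + x) -` U)" for x
  proof -
    have "(\<integral>\<^sup>+t. indicator U (t + x) \<partial>la) = (\<integral>\<^sup>+t. indicator ((\<lambda>t. t + x) -` U) t \<partial>la)"
      by (intro nn_integral_cong) (auto simp: indicator_def)
    also have "\<dots> = emeasure la ((\<lambda>t. t + x) -` U)"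
      using measurable_sets[of "\<lambda>t. t + x" borel borel U] by (intro nn_integral_indicator) (simp add: la.sets_mu)
    finally show ?thesis .
  qed
  have pos: "0 < (\<integral>\<^sup>+t. indicator U (t + x) \<partial>la)" for x
    unfolding eq
  proof (rule la.emeasure_open_pos)
    show "open ((\<lambda>t. t + x) -` U)" by (intro open_vimage UK continuous_intros)
    have "- x \<in> (\<lambda>t. t + x) -` U" using UK(3) by simp
    then show "(\<lambda>t. t + x) -` U \<noteq> {}" by blast
  qed
  have fin: "(\<integral>\<^sup>+t. indicator U (t + x) \<partial>la) < \<infinity>" for x
  proof -
    have eq': "(\<lambda>t. t + x) -` K = (\<lambda>t. t + - x) ` K"
      by (simp add: group_image_eq_vimage(2) del: add_uminus_conv_diff)
    have "compact ((\<lambda>t. t + x) -` K)"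
      unfolding eq' by (intro compact_continuous_image UK continuous_intros)
    moreover have "emeasure la ((\<lambda>t. t + x) -` U) \<le> emeasure la ((\<lambda>t. t + x) -` K)"
      using UK(4) measurable_sets[of "\<lambda>t. t + x" borel borel K] by (intro emeasure_mono) (auto simp: la.sets_mu)
    ultimately show ?thesis unfolding eq using la.emeasure_compact le_less_trans by blast
  qed
  define A where "A = measure mu U"
  define A' where "A' = measure la U"
  have "emeasure mu U \<le> emeasure mu K" "emeasure la U \<le> emeasure la K"
    using UK by (auto intro!: emeasure_mono simp: mu.sets_mu la.sets_mu)
  then have "emeasure mu U < \<infinity>" "emeasure la U < \<infinity>"
    using mu.emeasure_compact[OF UK(2)] la.emeasure_compact[OF UK(2)] le_less_trans by blast+
  then have A: "emeasure mu U = ennreal A" "emeasure la U = ennreal A'"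
    by (auto simp: A_def A'_def emeasure_eq_ennreal_measure less_top)
  have "0 < emeasure mu U" "0 < emeasure la U"
    using mu.emeasure_open_pos[OF UK(1)] la.emeasure_open_pos[OF UK(1)] UK(3) by blast+
  then have A0: "0 < A" "0 < A'" unfolding A by simp_all
  show thesis
  proof (rule that[of "A / A'"])
    show "0 < A / A'" using A0 by simp
    fix E :: "'g set" assume [measurable]: "E \<in> sets borel"
    define C where "C = (\<integral>\<^sup>+y. indicator E (- y) / (\<integral>\<^sup>+t. indicator U (t + - y) \<partial>la) \<partial>la)"
    have "emeasure mu E = ennreal A * C" 
      using left_haar_measure_unique_aux[OF assms, of "indicator E" "indicator U"] pos fin
      by (simp add: C_def mu.sets_mu A)
    moreover have "emeasure la E = ennreal A' * C" 
      using left_haar_measure_unique_aux[OF assms(2,2), of "indicator E" "indicator U"] pos fin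
      by (simp add: C_def la.sets_mu A)
    moreover have "ennreal A = ennreal (A / A') * ennreal A'"
      using A0 by (subst ennreal_mult[symmetric]) auto
    ultimately show "emeasure mu E = ennreal (A / A') * emeasure la E"
      by (simp add: mult.assoc)
  qed
qed

lemma ennreal_mult_right_cancel:
  fixes a b c :: ennreal
  assumes "a * c = b * c" "0 < c" "c < \<infinity>"
  shows "a = b"
  using assms by (metis ennreal_mult_divide_eq infinity_ennreal_def less_irrefl)

section \<open>The modular function\<close>

context left_haar
begin

lemma open_finite_emeasure:
  obtains U where "open U" "0 \<in> U" "0 < emeasure mu U" "emeasure mu U < \<infinity>"
proof -
  obtain U K where UK: "open U" "compact K" "(0::'g) \<in> U" "U \<subseteq> K"
    using open_compact_nbhd by blast
  have "emeasure mu U \<le> emeasure mu K"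
    using UK by (intro emeasure_mono) (auto simp: sets_mu compact_imp_closed)
  then have "emeasure mu U < \<infinity>" using emeasure_compact[OF UK(2)] by (rule le_less_trans)
  then show thesis using UK emeasure_open_pos[OF UK(1)] by (intro that[of U]) blast+
qed

text \<open>Right and left translations commute, so the right translate of \<open>mu\<close> is
  again a left Haar measure and uniqueness supplies the constant. Comparing on a set of positive
  finite measure shows that the constant is unique, so the definite description in
  \<open>modular_function\<close> is resolved.\<close>

lemma modular_function_aux:
  "0 < modular_function mu t \<and>
     (\<forall>E\<in>sets borel. emeasure mu ((\<lambda>s. s + t) ` E) = ennreal (modular_function mu t) * emeasure mu E)"
proof -
  define mt where "mt = distr mu borel (\<lambda>s. s + - t)"
  have eq: "emeasure mt E = emeasure mu ((\<lambda>s. s + t) ` E)" if "E \<in> sets borel" for E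
    using that unfolding group_image_eq_vimage(2) mt_def
    by (subst emeasure_distr) (simp_all del: add_uminus_conv_diff)
  have "left_haar mt"
  proof (unfold_locales, rule locally_compact, unfold left_haar_measure_def, intro conjI allI ballI impI)
    fix s E assume E: "E \<in> sets (borel :: 'g measure)"
    have E': "(\<lambda>r. s + r) ` E \<in> sets borel" "(\<lambda>r. r + t) ` E \<in> sets borel"
      unfolding group_image_eq_vimage
      using E measurable_sets[of "\<lambda>r. - s + r" borel borel E] measurable_sets[of "\<lambda>r. r + - t" borel borel E]
      by (simp_all del: add_uminus_conv_diff)
    have "(\<lambda>r. r + t) ` (\<lambda>r. s + r) ` E = (\<lambda>r. s + r) ` (\<lambda>r. r + t) ` E"
      by (simp add: image_image add.assoc)
    moreover have "emeasure mu ((\<lambda>r. s + r) ` (\<lambda>r. r + t) ` E) = emeasure mu ((\<lambda>r. r + t) ` E)"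
      using haar E' unfolding left_haar_measure_def by (elim conjE) (erule allE, erule (1) bspec)
    ultimately show "emeasure mt ((\<lambda>r. s + r) ` E) = emeasure mt E"
      using E E' by (simp add: eq)
  next
    fix K :: "'g set" assume K: "compact K"
    have "compact ((\<lambda>s. s + t) ` K)"
      by (intro compact_continuous_image K continuous_intros)
    then show "emeasure mt K < \<infinity>"
      using K emeasure_compact by (simp add: eq compact_imp_closed)
  next
    have "(\<lambda>s. s + t) ` UNIV = UNIV" by (simp add: group_image_eq_vimage)
    then show "emeasure mt UNIV \<noteq> 0" using emeasure_mu_UNIV by (simp add: eq)
  qed (simp add: mt_def)
  moreover have "left_haar mu" ..
  ultimately obtain c where c: "0 < c" "\<And>E. E \<in> sets borel \<Longrightarrow> emeasure mt E = ennreal c * emeasure mu E"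
    by (rule left_haar_measure_unique) blast
  obtain U where U: "open U" "0 \<in> U" "0 < emeasure mu U" "emeasure mu U < \<infinity>"
    by (rule open_finite_emeasure)
  show ?thesis
    unfolding modular_function_def
  proof (rule theI2[where a = c])
    show "0 < c \<and> (\<forall>E\<in>sets borel. emeasure mu ((\<lambda>s. s + t) ` E) = ennreal c * emeasure mu E)"
      using c by (auto simp: eq)
    fix d assume d: "0 < d \<and> (\<forall>E\<in>sets borel. emeasure mu ((\<lambda>s. s + t) ` E) = ennreal d * emeasure mu E)"
    have "ennreal d * emeasure mu U = ennreal c * emeasure mu U"
      using d c(2)[of U] U(1) by (simp add: eq)
    then have "ennreal d = ennreal c"
      using U(3,4) by (rule ennreal_mult_right_cancel)
    then show "d = c" using d c by simp
  qed simp
qed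

abbreviation "Mod \<equiv> modular_function mu"

lemma Mod_pos [simp]: "0 < Mod t" 
  using modular_function_aux by blast

lemma Mod_nonneg [simp]: "0 \<le> Mod t" and Mod_neq_0 [simp]: "Mod t \<noteq> 0"
  using Mod_pos[of t] by linarith+

lemma emeasure_right_translate:
  "E \<in> sets borel \<Longrightarrow> emeasure mu ((\<lambda>s. s + t) ` E) = ennreal (Mod t) * emeasure mu E"
  using modular_function_aux by blast

lemma Mod_eqI:
  assumes "0 \<le> d" "\<And>E. E \<in> sets borel \<Longrightarrow> emeasure mu ((\<lambda>s. s + t) ` E) = ennreal d * emeasure mu E"
  shows "Mod t = d"
proof -
  obtain U where U: "open U" "0 \<in> U" "0 < emeasure mu U" "emeasure mu U < \<infinity>"
    by (rule open_finite_emeasure)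
  have "ennreal d * emeasure mu U = ennreal (Mod t) * emeasure mu U"
    using assms(2)[of U] emeasure_right_translate[of U t] U(1) by simp
  then have "ennreal d = ennreal (Mod t)"
    using U(3,4) by (rule ennreal_mult_right_cancel)
  then show ?thesis using assms(1) by simp
qed

lemma Mod_0 [simp]: "Mod 0 = 1"
  by (rule Mod_eqI) auto

lemma Mod_add: "Mod (s + t) = Mod s * Mod t"
proof (rule Mod_eqI)
  fix E assume E: "E \<in> sets (borel :: 'g measure)"
  have E': "(\<lambda>r. r + s) ` E \<in> sets borel"
    unfolding group_image_eq_vimage
    using E measurable_sets[of "\<lambda>r. r + - s" borel borel E] by (simp del: add_uminus_conv_diff)
  have "(\<lambda>r. r + (s + t)) ` E = (\<lambda>r. r + t) ` (\<lambda>r. r + s) ` E"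
    by (simp add: image_image add.assoc)
  then show "emeasure mu ((\<lambda>r. r + (s + t)) ` E) = ennreal (Mod s * Mod t) * emeasure mu E"
    using E E' by (simp add: emeasure_right_translate ennreal_mult ac_simps)
qed simp

lemma Mod_minus: "Mod (- t) = inverse (Mod t)"
  using Mod_add[of t "- t"] by (simp add: field_simps)

text \<open>The sign: the preimage of a set under \<open>s \<mapsto> s + t\<close> is its translate
  by \<open>- t\<close>.\<close>

lemma nn_integral_right_translate:
  assumes [measurable]: "f \<in> borel_measurable borel"
  shows "(\<integral>\<^sup>+s. f (s + t) \<partial>mu) = ennreal (Mod (- t)) * (\<integral>\<^sup>+s. f s \<partial>mu)"
proof -
  have "distr mu borel (\<lambda>s. s + t) = density mu (\<lambda>_. ennreal (Mod (- t)))"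
  proof (rule measure_eqI)
    fix A assume "A \<in> sets (distr mu borel (\<lambda>s. s + t))"
    then have A[measurable]: "A \<in> sets borel" by simp
    have "(\<lambda>s. s + t) -` A = (\<lambda>s. s + - t) ` A"
      unfolding group_image_eq_vimage(2) by simp
    then show "emeasure (distr mu borel (\<lambda>s. s + t)) A = emeasure (density mu (\<lambda>_. ennreal (Mod (- t)))) A"
      using emeasure_right_translate[of A "- t"]
      by (simp add: emeasure_distr emeasure_density_const sets_mu)
  qed (simp add: sets_mu)
  then have "(\<integral>\<^sup>+s. f s \<partial>distr mu borel (\<lambda>s. s + t)) = (\<integral>\<^sup>+s. f s \<partial>density mu (\<lambda>_. ennreal (Mod (- t))))"
    by simp
  then show ?thesis
    by (simp add: nn_integral_distr nn_integral_density nn_integral_cmult)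
qed

text \<open>\<open>Mod t\<close> is the quotient of the measures of \<open>U + t\<close> and
  \<open>U\<close>, and the numerator is a parameter integral, measurable by Tonelli.\<close>

lemma borel_measurable_Mod [measurable]: "Mod \<in> borel_measurable borel"
proof -
  obtain U where U: "open U" "0 \<in> U" "0 < emeasure mu U" "emeasure mu U < \<infinity>"
    by (rule open_finite_emeasure)
  have [measurable]: "U \<in> sets borel" using U(1) by simp
  have "(\<integral>\<^sup>+s. indicator U (s + - t) \<partial>mu) / emeasure mu U = ennreal (Mod t)" for t
  proof -
    have "(\<integral>\<^sup>+s. indicator U (s + - t) \<partial>mu) = ennreal (Mod t) * emeasure mu U"
      by (subst nn_integral_right_translate) (simp_all add: sets_mu)
    then show ?thesis
      using U by (simp add: ennreal_mult_divide_eq less_top[symmetric])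
  qed
  moreover have "(\<lambda>t. (\<integral>\<^sup>+s. indicator U (s + - t) \<partial>mu) / emeasure mu U) \<in> borel_measurable borel"
    by measurable
  ultimately have "(\<lambda>t. ennreal (Mod t)) \<in> borel_measurable borel" by simp
  then have "(\<lambda>t. enn2real (ennreal (Mod t))) \<in> borel_measurable borel" by measurable
  then show ?thesis by simp
qed

text \<open>For \<open>t\<close> in \<open>K\<close> the translate \<open>L + t\<close> stays in the
  compact set \<open>L + K\<close>, whose finite measure bounds \<open>Mod t\<close> times the
  measure of \<open>L\<close>. This takes the place of continuity of \<open>Mod\<close>.\<close>

lemma Mod_bounded_on_compact:
  assumes "compact K"
  obtains C where "\<And>t. t \<in> K \<Longrightarrow> Mod t \<le> C"
proof -
  obtain U L where UL: "open U" "compact L" "(0::'g) \<in> U" "U \<subseteq> L"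
    using open_compact_nbhd by blast
  have L[measurable]: "L \<in> sets borel" using UL(2) by (simp add: compact_imp_closed)
  have "0 < emeasure mu U" using emeasure_open_pos[OF UL(1)] UL(3) by blast
  also have "\<dots> \<le> emeasure mu L" using UL(4) by (intro emeasure_mono) (auto simp: sets_mu)
  finally have pos: "0 < emeasure mu L" .
  define P where "P = (\<lambda>(a, b). a + b) ` (L \<times> K)"
  have "compact P" unfolding P_def case_prod_beta
    by (intro compact_continuous_image compact_Times UL assms continuous_intros)
  have bound: "ennreal (Mod t) \<le> emeasure mu P / emeasure mu L" if "t \<in> K" for t
  proof -
    have "ennreal (Mod t) * emeasure mu L = emeasure mu ((\<lambda>s. s + t) ` L)"
      by (simp add: emeasure_right_translate)
    also have "\<dots> \<le> emeasure mu P"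
      using that \<open>compact P\<close> by (intro emeasure_mono) (auto simp: P_def sets_mu compact_imp_closed)
    finally have "ennreal (Mod t) * emeasure mu L / emeasure mu L \<le> emeasure mu P / emeasure mu L"
      by (rule divide_right_mono_ennreal)
    then show ?thesis
      using pos emeasure_compact[OF UL(2)] by (simp add: ennreal_mult_divide_eq less_top[symmetric])
  qed
  have fin: "emeasure mu P / emeasure mu L < \<infinity>"
    using pos emeasure_compact[OF \<open>compact P\<close>]
    by (auto simp: ennreal_divide_eq_top_iff simp flip: less_top)
  show thesis
  proof (rule that)
    fix t assume "t \<in> K"
    show "Mod t \<le> enn2real (emeasure mu P / emeasure mu L)"
      using enn2real_mono[OF bound[OF \<open>t \<in> K\<close>]] fin by simp
  qed
qed

text \<open>The left-hand side is a left Haar measure, hence a multiple \<open>c\<close> of \<open>mu\<close>; the transformation is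
  an involution, so \<open>c\<^sup>2 = 1\<close>.\<close>

lemma density_reflect_eq: "density (distr mu borel uminus) (\<lambda>t. ennreal (Mod t)) = mu" (is "?mu' = mu")
proof -
  have nn': "(\<integral>\<^sup>+t. f t \<partial>?mu') = (\<integral>\<^sup>+t. ennreal (Mod (- t)) * f (- t) \<partial>mu)"
    if [measurable]: "f \<in> borel_measurable borel" for f
    by (simp add: nn_integral_density nn_integral_distr)
  have em': "emeasure ?mu' E = (\<integral>\<^sup>+t. ennreal (Mod (- t)) * indicator E (- t) \<partial>mu)"
    if [measurable]: "E \<in> sets borel" for E
    using nn'[of "indicator E"] by simp
  have "left_haar ?mu'"
  proof (unfold_locales, rule locally_compact, unfold left_haar_measure_def, intro conjI allI ballI impI)
    fix s E assume E[measurable]: "E \<in> sets (borel :: 'g measure)"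
    have E'[measurable]: "(\<lambda>r. s + r) ` E \<in> sets borel" 
      unfolding group_image_eq_vimage
      using E measurable_sets[of "\<lambda>r. - s + r" borel borel E] by simp
    define H :: "'g \<Rightarrow> ennreal" where "H t = ennreal (Mod (- t)) * indicator E (- t)" for t
    have [measurable]: "H \<in> borel_measurable borel" unfolding H_def by measurable
    have "ennreal (Mod (- t)) = ennreal (Mod s) * ennreal (Mod (- (t + s)))" for t
      unfolding minus_add Mod_add by (simp add: Mod_minus mult.assoc[symmetric] ennreal_mult[symmetric])
    then have "ennreal (Mod (- t)) * indicator ((\<lambda>r. s + r) ` E) (- t) = ennreal (Mod s) * H (t + s)" for t
      by (simp add: H_def minus_add group_image_eq_vimage indicator_def del: add_uminus_conv_diff)
    then have "emeasure ?mu' ((\<lambda>r. s + r) ` E) = (\<integral>\<^sup>+t. ennreal (Mod s) * H (t + s) \<partial>mu)"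
      by (simp add: em'[OF E'])
    also have "\<dots> = ennreal (Mod s) * (\<integral>\<^sup>+t. H (t + s) \<partial>mu)"
      by (rule nn_integral_cmult) measurable
    also have "\<dots> = (\<integral>\<^sup>+t. H t \<partial>mu)"
      by (simp add: nn_integral_right_translate Mod_minus mult.assoc[symmetric] ennreal_mult[symmetric])
    also have "\<dots> = emeasure ?mu' E"
      by (simp add: em'[OF E] H_def)
    finally show "emeasure ?mu' ((\<lambda>r. s + r) ` E) = emeasure ?mu' E" .
  next
    fix K :: "'g set" assume K: "compact K"
    then have [measurable]: "K \<in> sets borel" by (simp add: compact_imp_closed)
    obtain C where C: "\<And>t. t \<in> K \<Longrightarrow> Mod t \<le> C" using Mod_bounded_on_compact[OF K] by blast
    have K': "compact (uminus ` K)" by (intro compact_continuous_image K continuous_intros)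
    then have [measurable]: "uminus ` K \<in> sets borel" by (simp add: compact_imp_closed)
    have "emeasure ?mu' K \<le> (\<integral>\<^sup>+t. ennreal C * indicator (uminus ` K) t \<partial>mu)"
      unfolding em'[OF \<open>K \<in> sets borel\<close>] 
      by (intro nn_integral_mono) (auto simp: indicator_def group_image_eq_vimage intro!: ennreal_leI C)
    also have "\<dots> = ennreal C * emeasure mu (uminus ` K)"
      by (simp add: nn_integral_cmult_indicator sets_mu)
    also have "\<dots> < \<infinity>" using emeasure_compact[OF K'] by (simp add: ennreal_mult_less_top)
    finally show "emeasure ?mu' K < \<infinity>" .
  next
    have "{t. ennreal (Mod (- t)) \<noteq> 0} = UNIV" by (auto simp: less_le_not_le[symmetric])
    then show "emeasure ?mu' UNIV \<noteq> 0"
      using emeasure_mu_UNIV em'[of UNIV] by (simp add: nn_integral_0_iff)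
  qed simp
  moreover have "left_haar mu" ..
  ultimately obtain c where c: "0 < c" "\<And>E. E \<in> sets borel \<Longrightarrow> emeasure ?mu' E = ennreal c * emeasure mu E"
    by (rule left_haar_measure_unique) blast
  have eq: "?mu' = density mu (\<lambda>_. ennreal c)"
    by (rule measure_eqI) (auto simp: sets_mu c(2) emeasure_density_const)
  obtain U where U: "open U" "0 \<in> U" "0 < emeasure mu U" "emeasure mu U < \<infinity>"
    by (rule open_finite_emeasure)
  have [measurable]: "U \<in> sets borel" using U(1) by simp
  \<comment> \<open>\<open>f\<close> is the transform of the indicator of \<open>U\<close>.
    Transforming once more gives the indicator back, so \<open>c\<close> enters twice below.\<close>
  define f :: "'g \<Rightarrow> ennreal" where "f t = ennreal (Mod (- t)) * indicator U (- t)" for t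
  have [measurable]: "f \<in> borel_measurable borel" unfolding f_def by measurable
  have "emeasure mu U = (\<integral>\<^sup>+t. f t \<partial>?mu')"
    by (subst nn') (auto simp: f_def Mod_minus mult.assoc[symmetric] ennreal_mult[symmetric] sets_mu)
  also have "\<dots> = ennreal c * (\<integral>\<^sup>+t. f t \<partial>mu)"
    unfolding eq by (simp add: nn_integral_density nn_integral_cmult)
  also have "(\<integral>\<^sup>+t. f t \<partial>mu) = emeasure ?mu' U"
    by (simp add: em' f_def)
  also have "\<dots> = ennreal c * emeasure mu U" by (rule c) simp
  finally have "emeasure mu U = ennreal (c * c) * emeasure mu U"
    using c(1) by (simp add: ennreal_mult mult.assoc)
  then have "ennreal 1 * emeasure mu U = ennreal (c * c) * emeasure mu U" by simp
  then have "ennreal 1 = ennreal (c * c)"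
    using U(3,4) by (rule ennreal_mult_right_cancel)
  then have "c * c = 1" using c(1) by (metis ennreal_inj mult_nonneg_nonneg less_imp_le zero_le_one)
  then have "c = 1" using c(1) square_eq_1_iff[of c] by auto
  then show ?thesis unfolding eq by (simp add: density_1)
qed

lemma nn_integral_reflect:
  assumes [measurable]: "f \<in> borel_measurable borel"
  shows "(\<integral>\<^sup>+t. ennreal (Mod (- t)) * f (- t) \<partial>mu) = (\<integral>\<^sup>+t. f t \<partial>mu)"
  by (subst (3) density_reflect_eq[symmetric]) (simp add: nn_integral_density nn_integral_distr)

lemma integral_reflect:
  fixes f :: "'g \<Rightarrow> 'b::{banach,second_countable_topology}"
  assumes [measurable]: "f \<in> borel_measurable borel"
  shows "(\<integral>t. Mod (- t) *\<^sub>R f (- t) \<partial>mu) = (\<integral>t. f t \<partial>mu)"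
  by (subst (3) density_reflect_eq[symmetric]) (simp add: integral_density integral_distr)

section \<open>The right Haar measure\<close>

abbreviation "nu \<equiv> reflect mu"

lemma sets_nu [measurable_cong]: "sets nu = sets borel"
  by (simp add: reflect_def)

lemma space_nu [simp]: "space nu = UNIV"
  by (simp add: reflect_def)

lemma nn_integral_nu:
  assumes [measurable]: "f \<in> borel_measurable borel"
  shows "(\<integral>\<^sup>+t. f t \<partial>nu) = (\<integral>\<^sup>+t. f (- t) \<partial>mu)"
  by (simp add: reflect_def nn_integral_distr)

lemma integral_nu:
  fixes f :: "'g \<Rightarrow> 'b::{banach,second_countable_topology}"
  assumes [measurable]: "f \<in> borel_measurable borel"
  shows "(\<integral>t. f t \<partial>nu) = (\<integral>t. f (- t) \<partial>mu)"
  by (simp add: reflect_def integral_distr)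

lemma emeasure_nu_compact:
  assumes "compact K"
  shows "emeasure nu K < \<infinity>"
proof -
  have "compact (uminus ` K)" by (intro compact_continuous_image assms continuous_intros)
  then show ?thesis
    using emeasure_compact assms by (simp add: emeasure_reflect[OF sets_mu] compact_imp_closed)
qed

lemma emeasure_nu_open_pos:
  assumes "open U" "U \<noteq> {}"
  shows "0 < emeasure nu U"
proof -
  have "open (uminus ` U)" unfolding group_image_eq_vimage
    by (intro open_vimage assms continuous_intros)
  then show ?thesis
    using assms emeasure_open_pos by (simp add: emeasure_reflect[OF sets_mu])
qed

sublocale nu: sigma_finite_measure nu
proof
  obtain \<U> :: "'g set set" where \<U>: "countable \<U>" "\<Union>\<U> = UNIV"
    "\<And>U. U \<in> \<U> \<Longrightarrow> open U \<and> (\<exists>K. compact K \<and> U \<subseteq> K)"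
    using countable_open_compact_cover by blast
  have "emeasure nu U \<noteq> \<infinity>" if U: "U \<in> \<U>" for U
  proof -
    obtain K where K: "compact K" "U \<subseteq> K" using \<U>(3)[OF U] by blast
    have "K \<in> sets nu" using compact_imp_closed[OF K(1)] by (simp add: sets_nu)
    then have "emeasure nu U \<le> emeasure nu K" using K by (intro emeasure_mono)
    then show ?thesis using emeasure_nu_compact[OF K(1)] by (auto simp: top_unique)
  qed
  then show "\<exists>A. countable A \<and> A \<subseteq> sets nu \<and> \<Union>A = space nu \<and> (\<forall>a\<in>A. emeasure nu a \<noteq> \<infinity>)"
    using \<U> by (intro exI[of _ \<U>]) (auto simp: sets_nu)
qed

lemma nn_integral_nu_right_translate:
  assumes [measurable]: "f \<in> borel_measurable borel"
  shows "(\<integral>\<^sup>+t. f (t + s) \<partial>nu) = (\<integral>\<^sup>+t. f t \<partial>nu)"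
  using nn_integral_translate[of "\<lambda>t. f (- t)" "- s"]
  by (simp add: nn_integral_nu minus_add)

text \<open>Left translation scales the right Haar measure by the modular function; the factor
  \<open>sqrt (Mod t)\<close> in \<open>translation_rep\<close> is there to compensate exactly
  this.\<close>

lemma distr_nu_left_translate: "distr nu borel (\<lambda>t. s + t) = density nu (\<lambda>_. ennreal (Mod s))"
proof (rule measure_eqI)
  fix A assume "A \<in> sets (distr nu borel (\<lambda>t. s + t))"
  then have [measurable]: "A \<in> sets borel" by simp
  have "emeasure (distr nu borel (\<lambda>t. s + t)) A = (\<integral>\<^sup>+t. indicator A t \<partial>distr nu borel (\<lambda>t. s + t))"
    by simp
  also have "\<dots> = (\<integral>\<^sup>+t. indicator A (s + - t) \<partial>mu)"
    by (subst nn_integral_distr) (simp_all add: nn_integral_nu del: nn_integral_indicator)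
  also have "\<dots> = (\<integral>\<^sup>+t. indicator A (- (t + - s)) \<partial>mu)"
    by (simp add: minus_add del: add_uminus_conv_diff)
  also have "\<dots> = ennreal (Mod s) * (\<integral>\<^sup>+t. indicator A (- t) \<partial>mu)"
    by (subst nn_integral_right_translate[of "\<lambda>t. indicator A (- t)" "- s"]) simp_all
  also have "(\<integral>\<^sup>+t. indicator A (- t) \<partial>mu) = emeasure nu A"
    by (subst nn_integral_nu[symmetric]) (simp_all add: sets_nu)
  finally show "emeasure (distr nu borel (\<lambda>t. s + t)) A = emeasure (density nu (\<lambda>_. ennreal (Mod s))) A"
    by (simp add: emeasure_density_const sets_nu)
qed (simp add: sets_nu)

lemma nn_integral_nu_left_translate:
  assumes [measurable]: "f \<in> borel_measurable borel"
  shows "(\<integral>\<^sup>+t. f (s + t) \<partial>nu) = ennreal (Mod s) * (\<integral>\<^sup>+t. f t \<partial>nu)"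
proof -
  have "(\<integral>\<^sup>+t. f (s + t) \<partial>nu) = (\<integral>\<^sup>+t. f t \<partial>distr nu borel (\<lambda>t. s + t))"
    by (simp add: nn_integral_distr)
  then show ?thesis
    by (simp add: distr_nu_left_translate nn_integral_density nn_integral_cmult)
qed

lemma integral_nu_left_translate:
  fixes f :: "'g \<Rightarrow> 'b::{banach,second_countable_topology}"
  assumes [measurable]: "f \<in> borel_measurable borel"
  shows "(\<integral>t. f (s + t) \<partial>nu) = Mod s *\<^sub>R (\<integral>t. f t \<partial>nu)"
proof -
  have "(\<integral>t. f (s + t) \<partial>nu) = (\<integral>t. f t \<partial>distr nu borel (\<lambda>t. s + t))"
    by (simp add: integral_distr)
  then show ?thesis
    by (simp add: distr_nu_left_translate integral_density)
qed

end

section \<open>Square-integrable functions\<close>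

lemma borel_measurable_cnj [measurable]: "cnj \<in> borel_measurable borel"
  by (intro borel_measurable_continuous_onI continuous_intros)

text \<open>Inner product and norm live on functions, not on classes. The estimates are made at this
  level and are carried over to \<open>L2\<close> through the representatives
  \<open>some_in\<close>.\<close>

definition l2_inner :: "'a measure \<Rightarrow> ('a \<Rightarrow> complex) \<Rightarrow> ('a \<Rightarrow> complex) \<Rightarrow> complex" where
  "l2_inner M f g = (\<integral>s. f s * cnj (g s) \<partial>M)"

definition l2_norm :: "'a measure \<Rightarrow> ('a \<Rightarrow> complex) \<Rightarrow> real" where
  "l2_norm M f = sqrt (\<integral>s. (cmod (f s))\<^sup>2 \<partial>M)"

lemma L2_funsD: 
  assumes "f \<in> L2_funs M"
  shows "f \<in> borel_measurable M" "integrable M (\<lambda>s. (cmod (f s))\<^sup>2)"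
  using assms by (auto simp: L2_funs_def)

lemma L2_funsI:
  assumes "f \<in> borel_measurable M" "(\<integral>\<^sup>+s. ennreal (cmod (f s))^2 \<partial>M) < \<infinity>"
  shows "f \<in> L2_funs M"
  using assms by (auto simp: L2_funs_def integrable_iff_bounded ennreal_power)

lemma nn_integral_L2_funs:
  assumes "f \<in> L2_funs M"
  shows "(\<integral>\<^sup>+s. ennreal (cmod (f s))^2 \<partial>M) = ennreal ((l2_norm M f)\<^sup>2)"
  using assms by (simp add: L2_funs_def l2_norm_def ennreal_power nn_integral_eq_integral)

lemma l2_norm_nonneg [simp]: "0 \<le> l2_norm M f"
  by (simp add: l2_norm_def)

lemma integrable_l2_inner:
  assumes f: "f \<in> L2_funs M" and g: "g \<in> L2_funs M"
  shows "integrable M (\<lambda>s. f s * cnj (g s))"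
proof (rule Bochner_Integration.integrable_bound)
  note [measurable] = L2_funsD(1)[OF f] L2_funsD(1)[OF g]
  show "integrable M (\<lambda>s. (cmod (f s))\<^sup>2 + (cmod (g s))\<^sup>2)"
    using L2_funsD(2)[OF f] L2_funsD(2)[OF g] by simp
  show "(\<lambda>s. f s * cnj (g s)) \<in> borel_measurable M" by measurable
  have "a * b \<le> a\<^sup>2 + b\<^sup>2" if "0 \<le> a" "0 \<le> b" for a b :: real
    using sum_squares_bound[of a b] mult_nonneg_nonneg[OF that] by simp
  then show "AE s in M. norm (f s * cnj (g s)) \<le> norm ((cmod (f s))\<^sup>2 + (cmod (g s))\<^sup>2)"
    by (simp add: norm_mult)
qed

lemma L2_funs_zero [simp]: "(\<lambda>s. 0) \<in> L2_funs M"
  by (simp add: L2_funs_def)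

lemma L2_funs_mult: "f \<in> L2_funs M \<Longrightarrow> (\<lambda>s. c * f s) \<in> L2_funs M"
  by (auto simp: L2_funs_def norm_mult power_mult_distrib)

lemma cmod_add_square_le: "(cmod (a + b))\<^sup>2 \<le> 2 * (cmod a)\<^sup>2 + 2 * (cmod b)\<^sup>2"
proof -
  have "(cmod (a + b))\<^sup>2 \<le> (cmod a + cmod b)\<^sup>2"
    by (intro power_mono norm_triangle_ineq) simp
  also have "\<dots> \<le> 2 * (cmod a)\<^sup>2 + 2 * (cmod b)\<^sup>2"
    using sum_squares_bound[of "cmod a" "cmod b"] by (simp add: power2_sum)
  finally show ?thesis .
qed

lemma L2_funs_add:
  assumes f: "f \<in> L2_funs M" and g: "g \<in> L2_funs M"
  shows "(\<lambda>s. f s + g s) \<in> L2_funs M"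
proof -
  note [measurable] = L2_funsD(1)[OF f] L2_funsD(1)[OF g]
  have "integrable M (\<lambda>s. (cmod (f s + g s))\<^sup>2)"
  proof (rule Bochner_Integration.integrable_bound)
    show "integrable M (\<lambda>s. 2 * (cmod (f s))\<^sup>2 + 2 * (cmod (g s))\<^sup>2)"
      using L2_funsD(2)[OF f] L2_funsD(2)[OF g] by simp
    show "AE s in M. norm ((cmod (f s + g s))\<^sup>2) \<le> norm (2 * (cmod (f s))\<^sup>2 + 2 * (cmod (g s))\<^sup>2)"
      by (simp add: cmod_add_square_le)
  qed simp
  then show ?thesis by (simp add: L2_funs_def)
qed

lemma L2_funs_diff:
  assumes f: "f \<in> L2_funs M" and g: "g \<in> L2_funs M"
  shows "(\<lambda>s. f s - g s) \<in> L2_funs M"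
  using L2_funs_add[OF f L2_funs_mult[OF g, of "- 1"]] by simp

lemma L2_funs_sum:
  assumes "\<And>i. i \<in> I \<Longrightarrow> f i \<in> L2_funs M"
  shows "(\<lambda>s. \<Sum>i\<in>I. f i s) \<in> L2_funs M"
  using assms by (induction I rule: infinite_finite_induct) (auto intro: L2_funs_add)

lemma l2_norm_cong_AE:
  assumes "f \<in> borel_measurable M" "g \<in> borel_measurable M" "AE s in M. f s = g s"
  shows "l2_norm M f = l2_norm M g"
  unfolding l2_norm_def using assms by (intro arg_cong[of _ _ sqrt] integral_cong_AE) auto

lemma l2_inner_cong_AE:
  assumes [measurable]: "f \<in> borel_measurable M" "f' \<in> borel_measurable M"
    "g \<in> borel_measurable M" "g' \<in> borel_measurable M"
    and "AE s in M. f s = f' s" "AE s in M. g s = g' s"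
  shows "l2_inner M f g = l2_inner M f' g'"
  unfolding l2_inner_def using assms by (intro integral_cong_AE) auto

lemma l2_inner_add_left:
  "f \<in> L2_funs M \<Longrightarrow> g \<in> L2_funs M \<Longrightarrow> h \<in> L2_funs M \<Longrightarrow>
    l2_inner M (\<lambda>s. f s + g s) h = l2_inner M f h + l2_inner M g h"
  by (simp add: l2_inner_def integrable_l2_inner distrib_right)

lemma l2_inner_diff_left:
  "f \<in> L2_funs M \<Longrightarrow> g \<in> L2_funs M \<Longrightarrow> h \<in> L2_funs M \<Longrightarrow>
    l2_inner M (\<lambda>s. f s - g s) h = l2_inner M f h - l2_inner M g h"
  by (simp add: l2_inner_def integrable_l2_inner left_diff_distrib)

lemma l2_inner_mult_left: "l2_inner M (\<lambda>s. c * f s) g = c * l2_inner M f g"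
  by (simp add: l2_inner_def mult.assoc)

lemma l2_inner_sum_left:
  assumes "\<And>i. i \<in> I \<Longrightarrow> f i \<in> L2_funs M" "g \<in> L2_funs M"
  shows "l2_inner M (\<lambda>s. \<Sum>i\<in>I. f i s) g = (\<Sum>i\<in>I. l2_inner M (f i) g)"
  using assms by (simp add: l2_inner_def sum_distrib_right integrable_l2_inner)

lemma l2_inner_commute: "l2_inner M g f = cnj (l2_inner M f g)"
  unfolding l2_inner_def by (subst Bochner_Integration.integral_cnj[symmetric]) (simp add: mult.commute)

lemma l2_inner_self: "l2_inner M f f = complex_of_real ((l2_norm M f)\<^sup>2)"
  by (simp add: l2_inner_def l2_norm_def complex_norm_square[symmetric] flip: integral_complex_of_real)

lemma l2_norm_mult: "l2_norm M (\<lambda>s. c * f s) = cmod c * l2_norm M f"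
  by (simp add: l2_norm_def norm_mult power_mult_distrib real_sqrt_mult)

lemma l2_Cauchy_Schwarz:
  assumes f: "f \<in> L2_funs M" and g: "g \<in> L2_funs M"
  shows "cmod (l2_inner M f g) \<le> l2_norm M f * l2_norm M g"
proof -
  note [measurable] = L2_funsD(1)[OF f] L2_funsD(1)[OF g]
  have "ennreal (cmod (l2_inner M f g)) \<le> (\<integral>\<^sup>+s. ennreal (cmod (f s)) * ennreal (cmod (g s)) \<partial>M)"
    using integral_norm_bound_ennreal[OF integrable_l2_inner[OF f g]]
    by (simp add: l2_inner_def norm_mult ennreal_mult)
  then have "ennreal (cmod (l2_inner M f g))^2 \<le> (\<integral>\<^sup>+s. ennreal (cmod (f s)) * ennreal (cmod (g s)) \<partial>M)^2"
    by (rule power_mono) simp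
  also have "\<dots> \<le> (\<integral>\<^sup>+s. ennreal (cmod (f s))^2 \<partial>M) * (\<integral>\<^sup>+s. ennreal (cmod (g s))^2 \<partial>M)"
    by (intro Cauchy_Schwarz_nn_integral) measurable
  also have "\<dots> = ennreal ((l2_norm M f * l2_norm M g)\<^sup>2)"
    using f g by (simp add: nn_integral_L2_funs ennreal_mult power_mult_distrib)
  finally have "(cmod (l2_inner M f g))\<^sup>2 \<le> (l2_norm M f * l2_norm M g)\<^sup>2"
    by (simp add: ennreal_power)
  then show ?thesis by (rule power2_le_imp_le) simp
qed

lemma l2_norm_triangle:
  assumes f: "f \<in> L2_funs M" and g: "g \<in> L2_funs M"
  shows "l2_norm M (\<lambda>s. f s + g s) \<le> l2_norm M f + l2_norm M g"
proof (rule power2_le_imp_le)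
  have h: "(\<lambda>s. f s + g s) \<in> L2_funs M" by (rule L2_funs_add[OF f g])
  have "complex_of_real ((l2_norm M (\<lambda>s. f s + g s))\<^sup>2)
      = l2_inner M f f + l2_inner M g f + (l2_inner M f g + l2_inner M g g)"
    unfolding l2_inner_self[symmetric]
    by (subst l2_inner_add_left[OF f g h], subst l2_inner_commute, subst l2_inner_add_left[OF f g f],
        subst (3) l2_inner_commute, subst l2_inner_add_left[OF f g g], simp flip: l2_inner_commute)
  then have "(l2_norm M (\<lambda>s. f s + g s))\<^sup>2
      = (l2_norm M f)\<^sup>2 + Re (l2_inner M g f) + (Re (l2_inner M f g) + (l2_norm M g)\<^sup>2)"
    by (metis Re_complex_of_real l2_inner_self plus_complex.sel(1))
  moreover have "Re (l2_inner M g f) \<le> l2_norm M g * l2_norm M f" "Re (l2_inner M f g) \<le> l2_norm M f * l2_norm M g"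
    using l2_Cauchy_Schwarz[OF f g] l2_Cauchy_Schwarz[OF g f] complex_Re_le_cmod order_trans by blast+
  ultimately show "(l2_norm M (\<lambda>s. f s + g s))\<^sup>2 \<le> (l2_norm M f + l2_norm M g)\<^sup>2"
    by (simp add: power2_sum mult.assoc mult.commute[of "l2_norm M g"])
qed simp

lemma l2_norm_eq_0_iff:
  assumes "f \<in> L2_funs M"
  shows "l2_norm M f = 0 \<longleftrightarrow> (AE s in M. f s = 0)"
  using assms by (simp add: l2_norm_def L2_funs_def integral_nonneg_eq_0_iff_AE)

lemma l2_norm_le_dual:
  assumes f: "f \<in> L2_funs M" and "0 \<le> C"
    and "\<And>g. g \<in> L2_funs M \<Longrightarrow> cmod (l2_inner M f g) \<le> C * l2_norm M g"
  shows "l2_norm M f \<le> C"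
proof -
  have "l2_norm M f * l2_norm M f \<le> C * l2_norm M f"
    using assms(3)[OF f] unfolding l2_inner_self by (simp add: power2_eq_square norm_mult)
  then show ?thesis
    using \<open>0 \<le> C\<close> l2_norm_nonneg[of M f] by (cases "l2_norm M f = 0") (auto simp: mult_le_cancel_right)
qed

lemma l2_Bessel:
  assumes "finite I" and e: "\<And>i. i \<in> I \<Longrightarrow> e i \<in> L2_funs M"
    and on: "\<And>i j. i \<in> I \<Longrightarrow> j \<in> I \<Longrightarrow> l2_inner M (e i) (e j) = (if i = j then 1 else 0)"
    and u: "u \<in> L2_funs M"
  shows "(\<Sum>i\<in>I. (cmod (l2_inner M u (e i)))\<^sup>2) \<le> (l2_norm M u)\<^sup>2"
proof -
  define c where "c i = l2_inner M u (e i)" for i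
  \<comment> \<open>\<open>p\<close> is the orthogonal projection of \<open>u\<close> onto the span
    of the family. The claim is the nonnegativity of the squared norm of \<open>u - p\<close>, which
    equals that of \<open>u\<close> minus \<open>S\<close>.\<close>
  define p where "p s = (\<Sum>i\<in>I. c i * e i s)" for s
  define S where "S = (\<Sum>i\<in>I. (cmod (c i))\<^sup>2)"
  have ce: "(\<lambda>s. c i * e i s) \<in> L2_funs M" if "i \<in> I" for i by (rule L2_funs_mult[OF e[OF that]])
  have p: "p \<in> L2_funs M" unfolding p_def by (rule L2_funs_sum) (rule ce)
  have pv: "l2_inner M p v = (\<Sum>i\<in>I. c i * l2_inner M (e i) v)" if "v \<in> L2_funs M" for v
    unfolding p_def by (subst l2_inner_sum_left[OF ce that]) (simp_all add: l2_inner_mult_left)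
  have pu: "l2_inner M p u = complex_of_real S"
    using l2_inner_commute[of M "e _" u] 
    by (simp add: pv[OF u] S_def complex_norm_square c_def del: of_real_power)
  have ep: "l2_inner M (e i) p = cnj (c i)" if "i \<in> I" for i
  proof -
    have "l2_inner M p (e i) = (\<Sum>j\<in>I. c j * (if j = i then 1 else 0))"
      using that by (subst pv[OF e[OF that]]) (simp add: on)
    also have "\<dots> = c i" using \<open>finite I\<close> that by (simp add: if_distrib sum.delta cong: if_cong)
    finally show ?thesis by (subst l2_inner_commute) simp
  qed
  have pp: "l2_inner M p p = complex_of_real S"
    by (simp add: pv[OF p] S_def complex_norm_square ep del: of_real_power)
  have d: "(\<lambda>s. u s - p s) \<in> L2_funs M" by (rule L2_funs_diff[OF u p])
  have up: "l2_inner M u p = complex_of_real S"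
    using pu by (subst l2_inner_commute) simp
  have "l2_inner M (\<lambda>s. u s - p s) p = 0"
    by (simp add: l2_inner_diff_left u p pp up)
  then have pd: "l2_inner M p (\<lambda>s. u s - p s) = 0" by (subst l2_inner_commute) simp
  have "l2_inner M (\<lambda>s. u s - p s) u = complex_of_real ((l2_norm M u)\<^sup>2 - S)"
    by (simp add: l2_inner_diff_left u p pu l2_inner_self)
  then have ud: "l2_inner M u (\<lambda>s. u s - p s) = complex_of_real ((l2_norm M u)\<^sup>2 - S)"
    by (subst l2_inner_commute) simp
  have "complex_of_real ((l2_norm M (\<lambda>s. u s - p s))\<^sup>2) = complex_of_real ((l2_norm M u)\<^sup>2 - S)"
    unfolding l2_inner_self[symmetric] by (subst l2_inner_diff_left[OF u p d]) (simp add: pd ud)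
  then have "(l2_norm M u)\<^sup>2 - S = (l2_norm M (\<lambda>s. u s - p s))\<^sup>2"
    using of_real_eq_iff by metis
  then show ?thesis unfolding S_def c_def using zero_le_power2[of "l2_norm M (\<lambda>s. u s - p s)"] by linarith
qed

section \<open>The induced representations on functions\<close>

context left_haar
begin

text \<open>A majorant for the induced operators. It takes values in \<open>ennreal\<close>, so
  Tonelli and Cauchy-Schwarz apply before any integrability is known.\<close>

definition twisted_conv :: "('g \<Rightarrow> ennreal) \<Rightarrow> ('g \<Rightarrow> ennreal) \<Rightarrow> 'g \<Rightarrow> ennreal" where
  "twisted_conv F u s = (\<integral>\<^sup>+t. F t * (ennreal (sqrt (Mod t)) * u (- t + s)) \<partial>mu)"

lemma borel_measurable_twisted_conv [measurable]:
  assumes [measurable]: "F \<in> borel_measurable borel" "u \<in> borel_measurable borel"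
  shows "twisted_conv F u \<in> borel_measurable borel"
  unfolding twisted_conv_def by measurable

text \<open>Young's inequality for L^1 acting on L^2. Cauchy-Schwarz for the measure with density
  \<open>F\<close> pulls the square inside; after Tonelli the factor \<open>Mod t\<close> cancels
  the factor by which left translation scales \<open>nu\<close>.\<close>

lemma twisted_conv_square_le:
  assumes [measurable]: "F \<in> borel_measurable borel" "u \<in> borel_measurable borel"
  shows "(\<integral>\<^sup>+s. (twisted_conv F u s)\<^sup>2 \<partial>nu) \<le> (\<integral>\<^sup>+t. F t \<partial>mu)\<^sup>2 * (\<integral>\<^sup>+s. (u s)\<^sup>2 \<partial>nu)"
proof -
  interpret P: pair_sigma_finite mu nu ..
  define D where "D = (\<integral>\<^sup>+t. F t \<partial>mu)"
  define U where "U = (\<integral>\<^sup>+s. (u s)\<^sup>2 \<partial>nu)"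
  have sqrt2: "(ennreal (sqrt (Mod t)))\<^sup>2 = ennreal (Mod t)" for t
    by (simp add: ennreal_power)
  have "(twisted_conv F u s)\<^sup>2 \<le> (\<integral>\<^sup>+t. F t * (ennreal (Mod t) * (u (- t + s))\<^sup>2) \<partial>mu) * D" for s
  proof -
    have "twisted_conv F u s = (\<integral>\<^sup>+t. (ennreal (sqrt (Mod t)) * u (- t + s)) * 1 \<partial>density mu F)"
      unfolding twisted_conv_def by (subst nn_integral_density) simp_all
    also have "\<dots>\<^sup>2 \<le> (\<integral>\<^sup>+t. (ennreal (sqrt (Mod t)) * u (- t + s))\<^sup>2 \<partial>density mu F) * (\<integral>\<^sup>+t. 1\<^sup>2 \<partial>density mu F)"
      by (rule Cauchy_Schwarz_nn_integral) measurable
    also have "(\<integral>\<^sup>+t. (ennreal (sqrt (Mod t)) * u (- t + s))\<^sup>2 \<partial>density mu F)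
        = (\<integral>\<^sup>+t. F t * (ennreal (Mod t) * (u (- t + s))\<^sup>2) \<partial>mu)"
      by (subst nn_integral_density) (simp_all add: power_mult_distrib sqrt2)
    also have "(\<integral>\<^sup>+t. 1\<^sup>2 \<partial>density mu F) = D"
      by (subst nn_integral_density) (simp_all add: D_def)
    finally show ?thesis .
  qed
  then have "(\<integral>\<^sup>+s. (twisted_conv F u s)\<^sup>2 \<partial>nu)
      \<le> (\<integral>\<^sup>+s. (\<integral>\<^sup>+t. F t * (ennreal (Mod t) * (u (- t + s))\<^sup>2) \<partial>mu) * D \<partial>nu)"
    by (intro nn_integral_mono)
  also have "\<dots> = (\<integral>\<^sup>+s. (\<integral>\<^sup>+t. F t * (ennreal (Mod t) * (u (- t + s))\<^sup>2) \<partial>mu) \<partial>nu) * D"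
    by (rule nn_integral_multc) measurable
  also have "(\<integral>\<^sup>+s. (\<integral>\<^sup>+t. F t * (ennreal (Mod t) * (u (- t + s))\<^sup>2) \<partial>mu) \<partial>nu)
      = (\<integral>\<^sup>+t. (\<integral>\<^sup>+s. F t * (ennreal (Mod t) * (u (- t + s))\<^sup>2) \<partial>nu) \<partial>mu)"
    by (rule P.Fubini') measurable
  also have "\<dots> = (\<integral>\<^sup>+t. F t * U \<partial>mu)"
  proof (rule nn_integral_cong)
    fix t
    have "(\<integral>\<^sup>+s. F t * (ennreal (Mod t) * (u (- t + s))\<^sup>2) \<partial>nu)
        = F t * (ennreal (Mod t) * (\<integral>\<^sup>+s. (u (- t + s))\<^sup>2 \<partial>nu))"
      by (simp add: nn_integral_cmult)
    also have "(\<integral>\<^sup>+s. (u (- t + s))\<^sup>2 \<partial>nu) = ennreal (Mod (- t)) * U"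
      unfolding U_def by (subst nn_integral_nu_left_translate[of "\<lambda>s. (u s)\<^sup>2" "- t"]) simp_all
    also have "ennreal (Mod t) * (ennreal (Mod (- t)) * U) = U"
      by (simp add: Mod_minus mult.assoc[symmetric] ennreal_mult[symmetric])
    finally show "(\<integral>\<^sup>+s. F t * (ennreal (Mod t) * (u (- t + s))\<^sup>2) \<partial>nu) = F t * U" .
  qed
  also have "\<dots> = D * U"
    unfolding D_def by (rule nn_integral_multc) measurable
  finally show ?thesis by (simp add: D_def U_def power2_eq_square ac_simps)
qed

end

locale haar_action = left_haar mu for mu :: "'g::{topological_group_add,t2_space,second_countable_topology} measure" +
  fixes act :: "'g \<Rightarrow> 'x::{t2_space,second_countable_topology} \<Rightarrow> 'x"
  assumes transformation_group: "transformation_group act"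
begin

lemma act_0 [simp]: "act 0 y = y" and act_act: "act s (act t y) = act (s + t) y"
  using transformation_group by (simp_all add: transformation_group_def)

lemma continuous_on_act [continuous_intros]:
  assumes "continuous_on S f" "continuous_on S k"
  shows "continuous_on S (\<lambda>t. act (f t) (k t))"
proof -
  have "continuous_on UNIV (\<lambda>(s, x). act s x)"
    using transformation_group by (simp add: transformation_group_def)
  then have "continuous_on S (\<lambda>t. case (f t, k t) of (s, x) \<Rightarrow> act s x)"
    by (rule continuous_on_compose2) (intro continuous_on_Pair assms, simp)
  then show ?thesis by simp
qed

lemma borel_measurable_act [measurable (raw)]:
  assumes [measurable]: "f \<in> borel_measurable M" "k \<in> borel_measurable M"
  shows "(\<lambda>t. act (f t) (k t)) \<in> borel_measurable M"
proof -
  have "(\<lambda>p::'g \<times> 'x. act (fst p) (snd p)) \<in> borel_measurable borel"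
    by (intro borel_measurable_continuous_onI continuous_intros)
  then have "(\<lambda>t. (\<lambda>p. act (fst p) (snd p)) (f t, k t)) \<in> borel_measurable M"
    by (rule measurable_compose[rotated]) measurable
  then show ?thesis by simp
qed

text \<open>The integrated form of the covariant pair at \<open>x\<close>, written pointwise. For
  integrable \<open>f\<close> and square-integrable \<open>\<xi>\<close> the integral converges for
  almost all \<open>s\<close>; at the other points a Bochner integral may take its default value 0,
  which the class in \<open>L2\<close> does not see.\<close>

definition ind_op :: "'x \<Rightarrow> ('g \<Rightarrow> 'x c0) \<Rightarrow> ('g \<Rightarrow> complex) \<Rightarrow> 'g \<Rightarrow> complex" where
  "ind_op x f \<xi> s = (\<integral>t. c0_apply (f t) (act s x) * (complex_of_real (sqrt (Mod t)) * \<xi> (- t + s)) \<partial>mu)"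

lemma borel_measurable_ind_op [measurable]:
  assumes [measurable]: "f \<in> borel_measurable borel" "\<xi> \<in> borel_measurable borel"
  shows "ind_op x f \<xi> \<in> borel_measurable borel"
  unfolding ind_op_def by measurable

context
  fixes f :: "'g \<Rightarrow> 'x c0" and \<xi> :: "'g \<Rightarrow> complex"
  assumes f: "integrable mu f" and \<xi>: "\<xi> \<in> L2_funs nu"
begin

lemma borel_measurable_L1_L2 [measurable]: "f \<in> borel_measurable borel" "\<xi> \<in> borel_measurable borel"
  using borel_measurable_integrable[OF f] L2_funsD(1)[OF \<xi>]
  by (simp_all add: measurable_cong_sets[OF sets_mu] measurable_cong_sets[OF sets_nu])

abbreviation "dominating \<equiv> twisted_conv (\<lambda>t. ennreal (norm (f t))) (\<lambda>s. ennreal (cmod (\<xi> s)))"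

lemma nn_integral_dominating:
  "(\<integral>\<^sup>+s. (dominating s)\<^sup>2 \<partial>nu) \<le> ennreal (((\<integral>t. norm (f t) \<partial>mu) * l2_norm nu \<xi>)\<^sup>2)"
proof -
  have "(\<integral>\<^sup>+t. ennreal (norm (f t)) \<partial>mu) = ennreal (\<integral>t. norm (f t) \<partial>mu)"
    using f by (intro nn_integral_eq_integral) auto
  moreover have "(\<integral>\<^sup>+s. (ennreal (cmod (\<xi> s)))\<^sup>2 \<partial>nu) = ennreal ((l2_norm nu \<xi>)\<^sup>2)"
    by (rule nn_integral_L2_funs[OF \<xi>])
  ultimately show ?thesis
    using twisted_conv_square_le[of "\<lambda>t. ennreal (norm (f t))" "\<lambda>s. ennreal (cmod (\<xi> s))"]
    by (simp add: ennreal_power power_mult_distrib ennreal_mult)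
qed

lemma norm_integrand_le:
  "ennreal (norm (c0_apply (f t) y * (complex_of_real (sqrt (Mod t)) * \<xi> (- t + s))))
    \<le> ennreal (norm (f t)) * (ennreal (sqrt (Mod t)) * ennreal (cmod (\<xi> (- t + s))))"
  by (auto simp: norm_mult ennreal_mult[symmetric] intro!: ennreal_leI mult_right_mono norm_c0_apply_le)

lemma AE_dominating_finite: "AE s in nu. dominating s < \<infinity>"
proof -
  have "(\<integral>\<^sup>+s. (dominating s)\<^sup>2 \<partial>nu) \<noteq> \<infinity>"
    using nn_integral_dominating by (auto simp: top_unique)
  then have "AE s in nu. (dominating s)\<^sup>2 \<noteq> \<infinity>"
    by (intro nn_integral_PInf_AE) measurable
  then show ?thesis by eventually_elim (simp add: power_eq_top_ennreal less_top)
qed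

lemma integrable_ind_op:
  assumes "dominating s < \<infinity>"
  shows "integrable mu (\<lambda>t. c0_apply (f t) (act s x) * (complex_of_real (sqrt (Mod t)) * \<xi> (- t + s)))"
proof (rule integrableI_bounded)
  have "(\<integral>\<^sup>+t. ennreal (norm (c0_apply (f t) (act s x) * (complex_of_real (sqrt (Mod t)) * \<xi> (- t + s)))) \<partial>mu)
      \<le> dominating s"
    unfolding twisted_conv_def by (intro nn_integral_mono norm_integrand_le)
  then show "(\<integral>\<^sup>+t. ennreal (norm (c0_apply (f t) (act s x) * (complex_of_real (sqrt (Mod t)) * \<xi> (- t + s)))) \<partial>mu) < \<infinity>"
    using assms by (rule le_less_trans)
qed measurable

lemma norm_ind_op_le: "ennreal (cmod (ind_op x f \<xi> s)) \<le> dominating s"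
proof (cases "dominating s < \<infinity>")
  case True
  then have "ennreal (cmod (ind_op x f \<xi> s))
      \<le> (\<integral>\<^sup>+t. ennreal (norm (c0_apply (f t) (act s x) * (complex_of_real (sqrt (Mod t)) * \<xi> (- t + s)))) \<partial>mu)"
    unfolding ind_op_def by (intro integral_norm_bound_ennreal integrable_ind_op)
  also have "\<dots> \<le> dominating s"
    unfolding twisted_conv_def by (intro nn_integral_mono norm_integrand_le)
  finally show ?thesis .
qed (auto simp: top_unique not_less)

lemma nn_integral_ind_op_le:
  "(\<integral>\<^sup>+s. (ennreal (cmod (ind_op x f \<xi> s)))\<^sup>2 \<partial>nu) \<le> ennreal (((\<integral>t. norm (f t) \<partial>mu) * l2_norm nu \<xi>)\<^sup>2)"
proof -
  have "(\<integral>\<^sup>+s. (ennreal (cmod (ind_op x f \<xi> s)))\<^sup>2 \<partial>nu) \<le> (\<integral>\<^sup>+s. (dominating s)\<^sup>2 \<partial>nu)"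
    by (intro nn_integral_mono power_mono norm_ind_op_le) simp
  then show ?thesis using nn_integral_dominating by (rule order_trans)
qed

lemma ind_op_L2: "ind_op x f \<xi> \<in> L2_funs nu"
proof (rule L2_funsI)
  show "ind_op x f \<xi> \<in> borel_measurable nu" by measurable
  show "(\<integral>\<^sup>+s. (ennreal (cmod (ind_op x f \<xi> s)))\<^sup>2 \<partial>nu) < \<infinity>"
    using nn_integral_ind_op_le by (rule le_less_trans) simp
qed

lemma l2_norm_ind_op_le: "l2_norm nu (ind_op x f \<xi>) \<le> (\<integral>t. norm (f t) \<partial>mu) * l2_norm nu \<xi>"
proof (rule power2_le_imp_le)
  show "(l2_norm nu (ind_op x f \<xi>))\<^sup>2 \<le> ((\<integral>t. norm (f t) \<partial>mu) * l2_norm nu \<xi>)\<^sup>2"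
    using nn_integral_ind_op_le[of x] unfolding nn_integral_L2_funs[OF ind_op_L2]
    by (subst (asm) ennreal_le_iff) simp_all
qed simp

text \<open>Joint integrability, from the square-integrable majorant and Cauchy-Schwarz against
  \<open>\<eta>\<close>. It licenses Fubini, which identifies the pointwise integral
  \<open>ind_op\<close> with the weak integral demanded by \<open>integrated_form\<close>.\<close>

lemma integrable_pairing:
  assumes \<eta>: "\<eta> \<in> L2_funs nu"
  shows "integrable (mu \<Otimes>\<^sub>M nu) (\<lambda>(t, s). c0_apply (f t) (act s x) * (complex_of_real (sqrt (Mod t)) * \<xi> (- t + s)) * cnj (\<eta> s))"
    (is "integrable _ ?k")
proof (rule integrableI_bounded)
  interpret P: pair_sigma_finite mu nu ..
  have [measurable]: "\<eta> \<in> borel_measurable borel"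
    using L2_funsD(1)[OF \<eta>] by (simp add: measurable_cong_sets[OF sets_nu])
  show meas_k: "?k \<in> borel_measurable (mu \<Otimes>\<^sub>M nu)" by measurable
  have "(\<integral>\<^sup>+p. ennreal (norm (?k p)) \<partial>(mu \<Otimes>\<^sub>M nu)) = (\<integral>\<^sup>+s. (\<integral>\<^sup>+t. ennreal (norm (?k (t, s))) \<partial>mu) \<partial>nu)"
    using meas_k by (intro P.nn_integral_snd[symmetric]) simp
  also have "\<dots> \<le> (\<integral>\<^sup>+s. dominating s * ennreal (cmod (\<eta> s)) \<partial>nu)"
  proof (rule nn_integral_mono)
    fix s
    have "(\<integral>\<^sup>+t. ennreal (norm (?k (t, s))) \<partial>mu)
        \<le> (\<integral>\<^sup>+t. ennreal (norm (f t)) * (ennreal (sqrt (Mod t)) * ennreal (cmod (\<xi> (- t + s)))) * ennreal (cmod (\<eta> s)) \<partial>mu)"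
      using norm_integrand_le[of _ "act s x" s]
      by (intro nn_integral_mono) (auto simp: norm_mult[of _ "cnj (\<eta> s)"] ennreal_mult[of _ "cmod (\<eta> s)"] intro!: mult_right_mono)
    also have "\<dots> = dominating s * ennreal (cmod (\<eta> s))"
      unfolding twisted_conv_def by (rule nn_integral_multc) measurable
    finally show "(\<integral>\<^sup>+t. ennreal (norm (?k (t, s))) \<partial>mu) \<le> dominating s * ennreal (cmod (\<eta> s))" .
  qed
  also have "\<dots> < \<infinity>"
  proof -
    have "(\<integral>\<^sup>+s. dominating s * ennreal (cmod (\<eta> s)) \<partial>nu)\<^sup>2
      \<le> (\<integral>\<^sup>+s. (dominating s)\<^sup>2 \<partial>nu) * (\<integral>\<^sup>+s. (ennreal (cmod (\<eta> s)))\<^sup>2 \<partial>nu)"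
      by (rule Cauchy_Schwarz_nn_integral) measurable
    also have "\<dots> < \<infinity>"
      using le_less_trans[OF nn_integral_dominating ennreal_less_top]
      by (simp add: nn_integral_L2_funs[OF \<eta>] ennreal_mult_less_top)
    finally show ?thesis by (simp add: power_less_top_ennreal)
  qed
  finally show "(\<integral>\<^sup>+p. ennreal (norm (?k p)) \<partial>(mu \<Otimes>\<^sub>M nu)) < \<infinity>" .
qed

lemma l2_inner_ind_op:
  assumes \<eta>: "\<eta> \<in> L2_funs nu"
  shows "l2_inner nu (ind_op x f \<xi>) \<eta>
    = (\<integral>t. (\<integral>s. c0_apply (f t) (act s x) * (complex_of_real (sqrt (Mod t)) * \<xi> (- t + s)) * cnj (\<eta> s) \<partial>nu) \<partial>mu)"
proof -
  interpret P: pair_sigma_finite mu nu ..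
  have "l2_inner nu (ind_op x f \<xi>) \<eta>
      = (\<integral>s. (\<integral>t. c0_apply (f t) (act s x) * (complex_of_real (sqrt (Mod t)) * \<xi> (- t + s)) * cnj (\<eta> s) \<partial>mu) \<partial>nu)"
    by (simp add: l2_inner_def ind_op_def)
  then show ?thesis using P.Fubini_integral[OF integrable_pairing[OF \<eta>]] by simp
qed

end

declare borel_measurable_L1_L2 [measurable del]

end

lemma borel_measurable_c0_cnj [measurable (raw)]:
  fixes f :: "'a \<Rightarrow> 'x::second_countable_topology c0"
  assumes [measurable]: "f \<in> borel_measurable M"
  shows "(\<lambda>t. c0_cnj (f t)) \<in> borel_measurable M"
  by (rule borel_measurable_c0I) simp

lemma borel_measurable_c0_scale [measurable (raw)]:
  fixes f :: "'a \<Rightarrow> 'x::second_countable_topology c0"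
  assumes [measurable]: "f \<in> borel_measurable M"
  shows "(\<lambda>t. c0_scale c (f t)) \<in> borel_measurable M"
  by (rule borel_measurable_c0I) simp

section \<open>The algebra operations and the induced operators\<close>

context haar_action
begin

lemma borel_measurable_c0_translate [measurable (raw)]:
  assumes [measurable]: "k \<in> borel_measurable M" "f \<in> borel_measurable M"
  shows "(\<lambda>t. c0_translate act (k t) (f t)) \<in> borel_measurable M"
  by (rule borel_measurable_c0I) (simp add: c0_apply_translate[OF transformation_group])

lemmas c0_apply_act = c0_apply_translate[OF transformation_group]

abbreviation "L1alg \<equiv> L1_algebra act mu"

lemma L1_algebra_simps [simp]:
  "f \<in> elems L1alg \<longleftrightarrow> integrable mu f"
  "sadd L1alg = (\<lambda>f g s. f s + g s)"
  "sscale L1alg = (\<lambda>c f s. c0_scale c (f s))"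
  "smult L1alg = (\<lambda>f g s. \<integral>r. f r * c0_translate act r (g (- r + s)) \<partial>mu)"
  "sstar L1alg = (\<lambda>f s. Mod (- s) *\<^sub>R c0_translate act s (c0_cnj (f (- s))))"
  "snorm L1alg = (\<lambda>f. \<integral>s. norm (f s) \<partial>mu)"
  by (simp_all add: L1_algebra_def)

lemma borel_measurable_integrable_mu: "integrable mu f \<Longrightarrow> f \<in> borel_measurable borel"
  for f :: "'g \<Rightarrow> 'b::{banach,second_countable_topology}"
  using borel_measurable_integrable[of mu f] by (simp add: measurable_cong_sets[OF sets_mu])

lemma borel_measurable_L2_funs_nu: "\<xi> \<in> L2_funs nu \<Longrightarrow> \<xi> \<in> borel_measurable borel"
  using L2_funsD(1)[of \<xi> nu] by (simp add: measurable_cong_sets[OF sets_nu])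

lemma nn_integral_norm_finite: "integrable mu f \<Longrightarrow> (\<integral>\<^sup>+t. ennreal (norm (f t)) \<partial>mu) < top"
  for f :: "'g \<Rightarrow> 'b::{banach,second_countable_topology}"
  using integrable_iff_bounded[of mu f] by simp

lemma integrable_sscale: "integrable mu f \<Longrightarrow> integrable mu (sscale L1alg c f)"
proof -
  assume f: "integrable mu f"
  note [measurable] = borel_measurable_integrable_mu[OF f]
  show "integrable mu (sscale L1alg c f)"
    unfolding L1_algebra_simps
  proof (rule Bochner_Integration.integrable_bound)
    show "integrable mu (\<lambda>s. cmod c *\<^sub>R norm (f s))" using f by simp
    show "AE s in mu. norm (c0_scale c (f s)) \<le> norm (cmod c *\<^sub>R norm (f s))"
      using norm_c0_scale[of c] by auto
  qed measurable
qed

text \<open>The factor \<open>Mod (- s)\<close> in the involution is the Jacobian of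
  \<open>s \<mapsto> - s\<close> for \<open>mu\<close>, so the involution does not increase the L^1
  norm.\<close>

lemma integrable_sstar:
  assumes f: "integrable mu f"
  shows "integrable mu (sstar L1alg f)"
  unfolding L1_algebra_simps
proof (rule integrableI_bounded)
  note [measurable] = borel_measurable_integrable_mu[OF f]
  show "(\<lambda>s. Mod (- s) *\<^sub>R c0_translate act s (c0_cnj (f (- s)))) \<in> borel_measurable mu"
    by measurable
  have "(\<integral>\<^sup>+s. ennreal (norm (Mod (- s) *\<^sub>R c0_translate act s (c0_cnj (f (- s))))) \<partial>mu)
      \<le> (\<integral>\<^sup>+s. ennreal (Mod (- s)) * ennreal (norm (f (- s))) \<partial>mu)"
    using order_trans[OF norm_c0_translate[OF transformation_group] norm_c0_cnj]
    by (intro nn_integral_mono) (auto simp: ennreal_mult[symmetric] intro!: ennreal_leI mult_left_mono)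
  also have "\<dots> = (\<integral>\<^sup>+s. ennreal (norm (f s)) \<partial>mu)"
    by (rule nn_integral_reflect) measurable
  also have "\<dots> < \<infinity>" using nn_integral_norm_finite[OF f] by simp
  finally show "(\<integral>\<^sup>+s. ennreal (norm (Mod (- s) *\<^sub>R c0_translate act s (c0_cnj (f (- s))))) \<partial>mu) < \<infinity>" .
qed

lemma nn_integral_convolution:
  assumes [measurable]: "F \<in> borel_measurable borel" "G \<in> borel_measurable borel"
  shows "(\<integral>\<^sup>+s. (\<integral>\<^sup>+r. F r * G (- r + s) \<partial>mu) \<partial>mu) = (\<integral>\<^sup>+s. F s \<partial>mu) * (\<integral>\<^sup>+s. G s \<partial>mu)"
proof -
  interpret P: pair_sigma_finite mu mu ..
  have "(\<integral>\<^sup>+s. (\<integral>\<^sup>+r. F r * G (- r + s) \<partial>mu) \<partial>mu) = (\<integral>\<^sup>+r. (\<integral>\<^sup>+s. F r * G (- r + s) \<partial>mu) \<partial>mu)"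
    by (rule P.Fubini') measurable
  also have "\<dots> = (\<integral>\<^sup>+r. F r * (\<integral>\<^sup>+s. G s \<partial>mu) \<partial>mu)"
    by (simp add: nn_integral_cmult nn_integral_translate)
  also have "\<dots> = (\<integral>\<^sup>+s. F s \<partial>mu) * (\<integral>\<^sup>+s. G s \<partial>mu)"
    by (rule nn_integral_multc) measurable
  finally show ?thesis .
qed

lemma norm_convolution_integrand:
  "norm (f r * c0_translate act r (g (- r + s))) \<le> norm (f r) * norm (g (- r + s))"
  by (rule order_trans[OF norm_mult_ineq]) (intro mult_left_mono norm_c0_translate transformation_group norm_ge_zero)

lemma integrable_smult_pair:
  assumes f: "integrable mu f" and g: "integrable mu g"
  shows "integrable (mu \<Otimes>\<^sub>M mu) (\<lambda>(r, s). f r * c0_translate act r (g (- r + s)))" (is "integrable _ ?k")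
proof (rule integrableI_bounded)
  interpret P: pair_sigma_finite mu mu ..
  note [measurable] = borel_measurable_integrable_mu[OF f] borel_measurable_integrable_mu[OF g]
  show meas: "?k \<in> borel_measurable (mu \<Otimes>\<^sub>M mu)" by measurable
  have "(\<integral>\<^sup>+p. ennreal (norm (?k p)) \<partial>(mu \<Otimes>\<^sub>M mu)) = (\<integral>\<^sup>+s. (\<integral>\<^sup>+r. ennreal (norm (?k (r, s))) \<partial>mu) \<partial>mu)"
    using meas by (intro P.nn_integral_snd[symmetric]) simp
  also have "\<dots> \<le> (\<integral>\<^sup>+s. (\<integral>\<^sup>+r. ennreal (norm (f r)) * ennreal (norm (g (- r + s))) \<partial>mu) \<partial>mu)"
    using norm_convolution_integrand[of f _ g]
    by (intro nn_integral_mono) (auto simp: ennreal_mult[symmetric] intro!: ennreal_leI)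
  also have "\<dots> = (\<integral>\<^sup>+s. ennreal (norm (f s)) \<partial>mu) * (\<integral>\<^sup>+s. ennreal (norm (g s)) \<partial>mu)"
    by (rule nn_integral_convolution) measurable
  also have "\<dots> < \<infinity>" using nn_integral_norm_finite[OF f] nn_integral_norm_finite[OF g] by (simp add: ennreal_mult_less_top)
  finally show "(\<integral>\<^sup>+p. ennreal (norm (?k p)) \<partial>(mu \<Otimes>\<^sub>M mu)) < \<infinity>" .
qed

lemma integrable_smult:
  assumes f: "integrable mu f" and g: "integrable mu g"
  shows "integrable mu (smult L1alg f g)"
proof -
  interpret P: pair_sigma_finite mu mu ..
  show ?thesis
    unfolding L1_algebra_simps by (rule P.integrable_snd[OF integrable_smult_pair[OF f g]])
qed

text \<open>Multiplicativity is Fubini followed by the substitution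
  \<open>r \<mapsto> t + r\<close>. It holds almost everywhere only, namely where the majorant of
  the double integral is finite.\<close>

lemma ind_op_smult:
  assumes f: "integrable mu f" and g: "integrable mu g" and \<xi>: "\<xi> \<in> L2_funs nu"
  shows "AE s in nu. ind_op x (smult L1alg f g) \<xi> s = ind_op x f (ind_op x g \<xi>) s"
proof -
  interpret P: pair_sigma_finite mu mu ..
  note [measurable] = borel_measurable_integrable_mu[OF f] borel_measurable_integrable_mu[OF g]
    borel_measurable_L2_funs_nu[OF \<xi>]
  have [measurable]: "smult L1alg f g \<in> borel_measurable borel"
    by (rule borel_measurable_integrable_mu[OF integrable_smult[OF f g]])
  \<comment> \<open>The scalar convolution of the two norm functions. It is integrable, so its
    twisted convolution with the modulus of \<open>\<xi>\<close> is square integrable and hence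
    finite at almost every \<open>s\<close>.\<close>
  define G where "G r = (\<integral>\<^sup>+t. ennreal (norm (f t)) * ennreal (norm (g (- t + r))) \<partial>mu)" for r
  have [measurable]: "G \<in> borel_measurable borel" unfolding G_def by measurable
  have "(\<integral>\<^sup>+r. G r \<partial>mu) < \<infinity>"
    unfolding G_def using nn_integral_norm_finite[OF f] nn_integral_norm_finite[OF g]
    by (subst nn_integral_convolution) (simp_all add: ennreal_mult_less_top)
  then have "(\<integral>\<^sup>+r. G r \<partial>mu)\<^sup>2 * (\<integral>\<^sup>+s. (ennreal (cmod (\<xi> s)))\<^sup>2 \<partial>nu) < \<infinity>"
    by (simp add: nn_integral_L2_funs[OF \<xi>] ennreal_mult_less_top power_less_top_ennreal)
  then have "(\<integral>\<^sup>+s. (twisted_conv G (\<lambda>s. ennreal (cmod (\<xi> s))) s)\<^sup>2 \<partial>nu) < \<infinity>"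
    by (rule le_less_trans[OF twisted_conv_square_le, rotated 2]) measurable
  then have "AE s in nu. (twisted_conv G (\<lambda>s. ennreal (cmod (\<xi> s))) s)\<^sup>2 \<noteq> \<infinity>"
    by (intro nn_integral_PInf_AE) simp_all
  then show ?thesis
  proof eventually_elim
    fix s assume "(twisted_conv G (\<lambda>s. ennreal (cmod (\<xi> s))) s)\<^sup>2 \<noteq> \<infinity>"
    then have fin: "twisted_conv G (\<lambda>s. ennreal (cmod (\<xi> s))) s < \<infinity>"
      by (simp add: power_eq_top_ennreal less_top)
    define y where "y = act s x"
    define w where "w r = complex_of_real (sqrt (Mod r)) * \<xi> (- r + s)" for r
    have [measurable]: "w \<in> borel_measurable borel" unfolding w_def by measurable
    define m where "m t r = c0_apply (f t) y * c0_apply (g (- t + r)) (act (- t) y) * w r" for t r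
    have "integrable (mu \<Otimes>\<^sub>M mu) (case_prod m)"
    proof (rule integrableI_bounded)
      show meas: "case_prod m \<in> borel_measurable (mu \<Otimes>\<^sub>M mu)" unfolding m_def by measurable
      have "(\<integral>\<^sup>+p. ennreal (norm (case_prod m p)) \<partial>(mu \<Otimes>\<^sub>M mu)) = (\<integral>\<^sup>+r. (\<integral>\<^sup>+t. ennreal (norm (m t r)) \<partial>mu) \<partial>mu)"
        using meas by (subst P.nn_integral_snd[symmetric]) simp_all
      also have "\<dots> \<le> (\<integral>\<^sup>+r. G r * ennreal (cmod (w r)) \<partial>mu)"
      proof (rule nn_integral_mono)
        fix r
        have "(\<integral>\<^sup>+t. ennreal (norm (m t r)) \<partial>mu)
            \<le> (\<integral>\<^sup>+t. ennreal (norm (f t)) * ennreal (norm (g (- t + r))) * ennreal (cmod (w r)) \<partial>mu)"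
          unfolding m_def
          by (intro nn_integral_mono) (auto simp: norm_mult ennreal_mult[symmetric] simp del: ennreal_mult''
              intro!: ennreal_leI mult_right_mono mult_mono norm_c0_apply_le)
        also have "\<dots> = G r * ennreal (cmod (w r))"
          unfolding G_def by (rule nn_integral_multc) measurable
        finally show "(\<integral>\<^sup>+t. ennreal (norm (m t r)) \<partial>mu) \<le> G r * ennreal (cmod (w r))" .
      qed
      also have "\<dots> = twisted_conv G (\<lambda>s. ennreal (cmod (\<xi> s))) s"
        unfolding twisted_conv_def w_def by (simp add: norm_mult ennreal_mult)
      finally show "(\<integral>\<^sup>+p. ennreal (norm (case_prod m p)) \<partial>(mu \<Otimes>\<^sub>M mu)) < \<infinity>"
        using fin by (rule le_less_trans)
    qed
    then have Fub: "(\<integral>r. (\<integral>t. m t r \<partial>mu) \<partial>mu) = (\<integral>t. (\<integral>r. m t r \<partial>mu) \<partial>mu)"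
      by (rule P.Fubini_integral)
    \<comment> \<open>Evaluation at \<open>y\<close> may be pulled inside the function-valued
      convolution integral only where that integral converges, that is for almost all
      \<open>r\<close>; this is enough under the outer integral.\<close>
    have "AE r in mu. integrable mu (\<lambda>t. f t * c0_translate act t (g (- t + r)))"
      by (rule P.AE_integrable_snd[OF integrable_smult_pair[OF f g]])
    then have "AE r in mu. c0_apply (smult L1alg f g r) y * w r = (\<integral>t. m t r \<partial>mu)"
    proof eventually_elim
      fix r assume "integrable mu (\<lambda>t. f t * c0_translate act t (g (- t + r)))"
      then have "c0_apply (smult L1alg f g r) y
          = (\<integral>t. c0_apply (f t * c0_translate act t (g (- t + r))) y \<partial>mu)"
        unfolding L1_algebra_simps by (rule integral_bounded_linear[OF bounded_linear_c0_apply, symmetric])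
      then show "c0_apply (smult L1alg f g r) y * w r = (\<integral>t. m t r \<partial>mu)"
        by (simp add: m_def c0_apply_act)
    qed
    then have "(\<integral>r. c0_apply (smult L1alg f g r) y * w r \<partial>mu) = (\<integral>r. (\<integral>t. m t r \<partial>mu) \<partial>mu)"
    proof (rule integral_cong_AE[rotated 2])
      show "(\<lambda>r. c0_apply (smult L1alg f g r) y * w r) \<in> borel_measurable mu" by measurable
      show "(\<lambda>r. \<integral>t. m t r \<partial>mu) \<in> borel_measurable mu" unfolding m_def by measurable
    qed
    then have "ind_op x (smult L1alg f g) \<xi> s = (\<integral>t. (\<integral>r. m t r \<partial>mu) \<partial>mu)"
      unfolding ind_op_def y_def[symmetric] w_def[symmetric] by (simp only: Fub)
    moreover have "(\<integral>r. m t r \<partial>mu) = c0_apply (f t) y * (complex_of_real (sqrt (Mod t)) * ind_op x g \<xi> (- t + s))" for t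
    proof -
      have shift: "m t (t + r) = c0_apply (f t) y * (complex_of_real (sqrt (Mod t)) *
          (c0_apply (g r) (act (- t + s) x) * (complex_of_real (sqrt (Mod r)) * \<xi> (- r + (- t + s)))))" for r
      proof -
        have "- t + (t + r) = r" "- (t + r) + s = - r + (- t + s)" "act (- t) y = act (- t + s) x"
          by (simp_all add: minus_add add.assoc y_def act_act del: add_uminus_conv_diff)
        then show ?thesis
          unfolding m_def w_def by (simp add: Mod_add real_sqrt_mult)
      qed
      have "(\<integral>r. m t r \<partial>mu) = (\<integral>r. m t (t + r) \<partial>mu)"
        unfolding m_def by (rule integral_translate[symmetric]) measurable
      also have "\<dots> = c0_apply (f t) y * (complex_of_real (sqrt (Mod t)) * ind_op x g \<xi> (- t + s))"
        by (simp add: shift ind_op_def)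
      finally show ?thesis .
    qed
    ultimately show "ind_op x (smult L1alg f g) \<xi> s = ind_op x f (ind_op x g \<xi>) s"
      unfolding ind_op_def[of x f] y_def by simp
  qed
qed

text \<open>Shifting the integration variable by \<open>t\<close> costs \<open>Mod (- t)\<close> for
  \<open>nu\<close>, which is precisely the Jacobian for replacing \<open>t\<close> by
  \<open>- t\<close> under \<open>mu\<close>. The factor \<open>Mod (- t)\<close> of the involution
  itself turns \<open>sqrt (Mod t)\<close> into \<open>sqrt (Mod (- t))\<close>, as the translation
  operator at \<open>- t\<close> requires.\<close>

lemma l2_inner_ind_op_sstar:
  assumes f: "integrable mu f" and \<xi>: "\<xi> \<in> L2_funs nu" and \<eta>: "\<eta> \<in> L2_funs nu"
  shows "l2_inner nu (ind_op x (sstar L1alg f) \<xi>) \<eta> = l2_inner nu \<xi> (ind_op x f \<eta>)"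
proof -
  note [measurable] = borel_measurable_integrable_mu[OF f]
    borel_measurable_L2_funs_nu[OF \<xi>] borel_measurable_L2_funs_nu[OF \<eta>]
  define L where "L t = (\<integral>s. cnj (c0_apply (f t) (act s x) * (complex_of_real (sqrt (Mod t)) * \<eta> (- t + s)) * cnj (\<xi> s)) \<partial>nu)" for t
  have [measurable]: "L \<in> borel_measurable borel" unfolding L_def by measurable
  have "l2_inner nu (ind_op x (sstar L1alg f) \<xi>) \<eta> = (\<integral>t. Mod (- t) *\<^sub>R L (- t) \<partial>mu)"
    unfolding l2_inner_ind_op[OF integrable_sstar[OF f] \<xi> \<eta>]
  proof (rule Bochner_Integration.integral_cong[OF refl])
    fix t
    define k where "k s = c0_apply (sstar L1alg f t) (act s x) * (complex_of_real (sqrt (Mod t)) * \<xi> (- t + s)) * cnj (\<eta> s)" for s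
    have [measurable]: "k \<in> borel_measurable borel" unfolding k_def by measurable
    have "(\<integral>s. k s \<partial>nu) = Mod (- t) *\<^sub>R (\<integral>s. k (t + s) \<partial>nu)"
      by (subst integral_nu_left_translate) (simp_all add: Mod_minus)
    moreover have "k (t + s) = cnj (c0_apply (f (- t)) (act s x) * (complex_of_real (sqrt (Mod (- t))) * \<eta> (- (- t) + s)) * cnj (\<xi> s))" for s
    proof -
      have ts: "- t + (t + s) = s" by (simp flip: add.assoc)
      then have "c0_apply (sstar L1alg f t) (act (t + s) x)
          = complex_of_real (Mod (- t)) * cnj (c0_apply (f (- t)) (act s x))"
        by (simp add: c0_apply_act act_act scaleR_conv_of_real)
      then have "k (t + s) = (complex_of_real (Mod (- t)) * complex_of_real (sqrt (Mod t)))
          * (cnj (c0_apply (f (- t)) (act s x)) * \<xi> s * cnj (\<eta> (t + s)))"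
        unfolding k_def ts by (simp only: ac_simps)
      moreover have "Mod (- t) * sqrt (Mod t) = sqrt (Mod (- t))"
      proof (rule real_sqrt_unique[symmetric])
        show "(Mod (- t) * sqrt (Mod t))\<^sup>2 = Mod (- t)"
          unfolding power_mult_distrib real_sqrt_pow2[OF Mod_nonneg] by (simp add: Mod_minus power2_eq_square)
      qed simp
      then have "complex_of_real (Mod (- t)) * complex_of_real (sqrt (Mod t)) = complex_of_real (sqrt (Mod (- t)))"
        by (simp flip: of_real_mult)
      ultimately show ?thesis
        by (simp add: ac_simps)
    qed
    ultimately show "(\<integral>s. c0_apply (sstar L1alg f t) (act s x) * (complex_of_real (sqrt (Mod t)) * \<xi> (- t + s)) * cnj (\<eta> s) \<partial>nu) = Mod (- t) *\<^sub>R L (- t)"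
      unfolding L_def k_def[symmetric] by (simp only:)
  qed
  also have "\<dots> = (\<integral>t. L t \<partial>mu)"
    by (rule integral_reflect) measurable
  also have "\<dots> = cnj (l2_inner nu (ind_op x f \<eta>) \<xi>)"
    unfolding l2_inner_ind_op[OF f \<eta> \<xi>] L_def
    by (simp only: Bochner_Integration.integral_cnj)
  also have "\<dots> = l2_inner nu \<xi> (ind_op x f \<eta>)"
    by (rule l2_inner_commute[symmetric])
  finally show ?thesis .
qed

lemma ind_op_sadd:
  assumes f: "integrable mu f" and g: "integrable mu g" and \<xi>: "\<xi> \<in> L2_funs nu"
  shows "AE s in nu. ind_op x (sadd L1alg f g) \<xi> s = ind_op x f \<xi> s + ind_op x g \<xi> s"
  using AE_dominating_finite[OF f \<xi>] AE_dominating_finite[OF g \<xi>]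
  by eventually_elim (simp add: ind_op_def distrib_right integrable_ind_op f g \<xi>)

lemma ind_op_sscale: "ind_op x (sscale L1alg c f) \<xi> s = c * ind_op x f \<xi> s"
  by (simp add: ind_op_def mult.assoc)

section \<open>The operator norm is a C*-seminorm\<close>

text \<open>The operator norm on square-integrable functions, as an infimum of admissible bounds. In
  this form it needs no unit vectors and no passage to classes.\<close>

definition ind_norm :: "'x \<Rightarrow> ('g \<Rightarrow> 'x c0) \<Rightarrow> real" where
  "ind_norm x f = Inf {C. 0 \<le> C \<and> (\<forall>\<xi>\<in>L2_funs nu. l2_norm nu (ind_op x f \<xi>) \<le> C * l2_norm nu \<xi>)}"

lemma ind_norm_le:
  assumes "0 \<le> C" "\<And>\<xi>. \<xi> \<in> L2_funs nu \<Longrightarrow> l2_norm nu (ind_op x f \<xi>) \<le> C * l2_norm nu \<xi>"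
  shows "ind_norm x f \<le> C"
  unfolding ind_norm_def using assms by (intro cInf_lower bdd_belowI[of _ 0]) auto

context
  fixes f :: "'g \<Rightarrow> 'x c0" and x :: 'x
  assumes f: "integrable mu f"
begin

lemma ind_norm_le_snorm: "ind_norm x f \<le> (\<integral>s. norm (f s) \<partial>mu)"
  by (rule ind_norm_le) (auto intro: l2_norm_ind_op_le[OF f])

lemma ind_norm_set_nonempty:
  "(\<integral>s. norm (f s) \<partial>mu) \<in> {C. 0 \<le> C \<and> (\<forall>\<xi>\<in>L2_funs nu. l2_norm nu (ind_op x f \<xi>) \<le> C * l2_norm nu \<xi>)}"
  using l2_norm_ind_op_le[OF f] by simp

lemma ind_norm_nonneg: "0 \<le> ind_norm x f"
  unfolding ind_norm_def using ind_norm_set_nonempty by (intro cInf_greatest) blast+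

lemma ind_norm_bound:
  assumes \<xi>: "\<xi> \<in> L2_funs nu"
  shows "l2_norm nu (ind_op x f \<xi>) \<le> ind_norm x f * l2_norm nu \<xi>"
proof (cases "l2_norm nu \<xi> = 0")
  case True
  then show ?thesis using l2_norm_ind_op_le[OF f \<xi>, of x] by simp
next
  case False
  then have pos: "0 < l2_norm nu \<xi>" using l2_norm_nonneg[of nu \<xi>] by linarith
  have "l2_norm nu (ind_op x f \<xi>) / l2_norm nu \<xi> \<le> ind_norm x f"
    unfolding ind_norm_def
  proof (rule cInf_greatest)
    show "{C. 0 \<le> C \<and> (\<forall>\<xi>\<in>L2_funs nu. l2_norm nu (ind_op x f \<xi>) \<le> C * l2_norm nu \<xi>)} \<noteq> {}"
      using ind_norm_set_nonempty by blast
  qed (use \<xi> pos in \<open>auto simp: divide_le_eq\<close>)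
  then show ?thesis using pos by (simp add: divide_le_eq)
qed

end

lemma ind_norm_sscale_le:
  assumes f: "integrable mu f"
  shows "ind_norm x (sscale L1alg c f) \<le> cmod c * ind_norm x f"
proof (rule ind_norm_le)
  fix \<xi> assume \<xi>: "\<xi> \<in> L2_funs nu"
  have "l2_norm nu (ind_op x (sscale L1alg c f) \<xi>) = cmod c * l2_norm nu (ind_op x f \<xi>)"
    unfolding l2_norm_mult[symmetric] by (simp only: ind_op_sscale[abs_def])
  also have "\<dots> \<le> cmod c * (ind_norm x f * l2_norm nu \<xi>)"
    by (intro mult_left_mono ind_norm_bound f \<xi>) simp
  finally show "l2_norm nu (ind_op x (sscale L1alg c f) \<xi>) \<le> cmod c * ind_norm x f * l2_norm nu \<xi>"
    by (simp add: mult.assoc)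
qed (simp add: ind_norm_nonneg[OF f])

lemma ind_norm_sscale:
  assumes f: "integrable mu f"
  shows "ind_norm x (sscale L1alg c f) = cmod c * ind_norm x f"
proof (cases "c = 0")
  case True
  then show ?thesis
    using ind_norm_sscale_le[OF f, of x c] ind_norm_nonneg[OF integrable_sscale[OF f], of x c] by simp
next
  case False
  \<comment> \<open>The reverse inequality is the one already known, applied to
    \<open>inverse c\<close> and the scaled function.\<close>
  have "sscale L1alg (inverse c) (sscale L1alg c f) = f"
    using False by (auto intro!: c0_eqI)
  then have "ind_norm x f \<le> cmod (inverse c) * ind_norm x (sscale L1alg c f)"
    using ind_norm_sscale_le[OF integrable_sscale[OF f], of x "inverse c" c] by simp
  then have "cmod c * ind_norm x f \<le> ind_norm x (sscale L1alg c f)"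
    using False mult_left_mono[of "ind_norm x f" _ "cmod c"] by (fastforce simp: norm_inverse mult.assoc[symmetric] simp del: L1_algebra_simps)
  then show ?thesis using ind_norm_sscale_le[OF f, of x c] by simp
qed

lemma ind_norm_sadd:
  assumes f: "integrable mu f" and g: "integrable mu g"
  shows "ind_norm x (sadd L1alg f g) \<le> ind_norm x f + ind_norm x g"
proof (rule ind_norm_le)
  fix \<xi> assume \<xi>: "\<xi> \<in> L2_funs nu"
  have fg: "integrable mu (sadd L1alg f g)" using f g by simp
  have "l2_norm nu (ind_op x (sadd L1alg f g) \<xi>) = l2_norm nu (\<lambda>s. ind_op x f \<xi> s + ind_op x g \<xi> s)"
    by (intro l2_norm_cong_AE ind_op_sadd f g \<xi> L2_funsD(1)[OF L2_funs_add] L2_funsD(1) ind_op_L2 fg)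
  also have "\<dots> \<le> l2_norm nu (ind_op x f \<xi>) + l2_norm nu (ind_op x g \<xi>)"
    by (intro l2_norm_triangle ind_op_L2 f g \<xi>)
  also have "\<dots> \<le> ind_norm x f * l2_norm nu \<xi> + ind_norm x g * l2_norm nu \<xi>"
    by (intro add_mono ind_norm_bound f g \<xi>)
  finally show "l2_norm nu (ind_op x (sadd L1alg f g) \<xi>) \<le> (ind_norm x f + ind_norm x g) * l2_norm nu \<xi>"
    by (simp add: distrib_right)
qed (simp add: ind_norm_nonneg f g)

lemma ind_norm_smult:
  assumes f: "integrable mu f" and g: "integrable mu g"
  shows "ind_norm x (smult L1alg f g) \<le> ind_norm x f * ind_norm x g"
proof (rule ind_norm_le)
  fix \<xi> assume \<xi>: "\<xi> \<in> L2_funs nu"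
  have gxi: "ind_op x g \<xi> \<in> L2_funs nu" by (rule ind_op_L2[OF g \<xi>])
  have "l2_norm nu (ind_op x (smult L1alg f g) \<xi>) = l2_norm nu (ind_op x f (ind_op x g \<xi>))"
    by (intro l2_norm_cong_AE ind_op_smult f g \<xi> L2_funsD(1) ind_op_L2 gxi integrable_smult)
  also have "\<dots> \<le> ind_norm x f * l2_norm nu (ind_op x g \<xi>)"
    by (intro ind_norm_bound f gxi)
  also have "\<dots> \<le> ind_norm x f * (ind_norm x g * l2_norm nu \<xi>)"
    by (intro mult_left_mono ind_norm_bound ind_norm_nonneg f g \<xi>)
  finally show "l2_norm nu (ind_op x (smult L1alg f g) \<xi>) \<le> ind_norm x f * ind_norm x g * l2_norm nu \<xi>"
    by (simp add: mult.assoc)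
qed (simp add: ind_norm_nonneg f g)

lemma ind_norm_sstar_le:
  assumes f: "integrable mu f"
  shows "ind_norm x (sstar L1alg f) \<le> ind_norm x f"
proof (rule ind_norm_le)
  fix \<xi> assume \<xi>: "\<xi> \<in> L2_funs nu"
  show "l2_norm nu (ind_op x (sstar L1alg f) \<xi>) \<le> ind_norm x f * l2_norm nu \<xi>"
  proof (rule l2_norm_le_dual)
    fix \<eta> assume \<eta>: "\<eta> \<in> L2_funs nu"
    have "cmod (l2_inner nu (ind_op x (sstar L1alg f) \<xi>) \<eta>) \<le> l2_norm nu \<xi> * l2_norm nu (ind_op x f \<eta>)"
      unfolding l2_inner_ind_op_sstar[OF f \<xi> \<eta>] by (intro l2_Cauchy_Schwarz \<xi> ind_op_L2 f \<eta>)
    also have "\<dots> \<le> l2_norm nu \<xi> * (ind_norm x f * l2_norm nu \<eta>)"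
      by (intro mult_left_mono ind_norm_bound f \<eta>) simp
    finally show "cmod (l2_inner nu (ind_op x (sstar L1alg f) \<xi>) \<eta>) \<le> ind_norm x f * l2_norm nu \<xi> * l2_norm nu \<eta>"
      by (simp add: ac_simps)
  qed (use ind_op_L2[OF integrable_sstar[OF f] \<xi>] ind_norm_nonneg[OF f] in auto)
qed (simp add: ind_norm_nonneg[OF f])

text \<open>This serves twice: it gives the hard half of the C*-identity, and it is the reason why
  vector states are later tested on a product of this shape.\<close>

lemma l2_inner_ind_op_star_smult:
  assumes f: "integrable mu f" and \<xi>: "\<xi> \<in> L2_funs nu"
  shows "l2_inner nu (ind_op x (smult L1alg (sstar L1alg f) f) \<xi>) \<xi> = complex_of_real ((l2_norm nu (ind_op x f \<xi>))\<^sup>2)"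
proof -
  have sf: "integrable mu (sstar L1alg f)" by (rule integrable_sstar[OF f])
  have fxi: "ind_op x f \<xi> \<in> L2_funs nu" by (rule ind_op_L2[OF f \<xi>])
  have "l2_inner nu (ind_op x (smult L1alg (sstar L1alg f) f) \<xi>) \<xi>
      = l2_inner nu (ind_op x (sstar L1alg f) (ind_op x f \<xi>)) \<xi>"
    by (rule l2_inner_cong_AE[OF _ _ _ _ ind_op_smult[OF sf f \<xi>]])
      (intro L2_funsD(1) ind_op_L2 integrable_smult sf f \<xi> fxi AE_I2 refl)+
  also have "\<dots> = l2_inner nu (ind_op x f \<xi>) (ind_op x f \<xi>)"
    by (rule l2_inner_ind_op_sstar[OF f fxi \<xi>])
  finally show ?thesis by (simp only: l2_inner_self)
qed

text \<open>One half is submultiplicativity together with contractivity of the involution. For the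
  other, Cauchy-Schwarz shows that \<open>sqrt C\<close> is an admissible bound for
  \<open>f\<close>.\<close>

lemma ind_norm_star_smult:
  assumes f: "integrable mu f"
  shows "ind_norm x (smult L1alg (sstar L1alg f) f) = (ind_norm x f)\<^sup>2"
proof (rule antisym)
  have sf: "integrable mu (sstar L1alg f)" by (rule integrable_sstar[OF f])
  have sff: "integrable mu (smult L1alg (sstar L1alg f) f)" by (rule integrable_smult[OF sf f])
  have "ind_norm x (smult L1alg (sstar L1alg f) f) \<le> ind_norm x (sstar L1alg f) * ind_norm x f"
    by (rule ind_norm_smult[OF sf f])
  also have "\<dots> \<le> ind_norm x f * ind_norm x f"
    by (intro mult_right_mono ind_norm_sstar_le ind_norm_nonneg f)
  finally show "ind_norm x (smult L1alg (sstar L1alg f) f) \<le> (ind_norm x f)\<^sup>2"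
    by (simp add: power2_eq_square)
  define C where "C = ind_norm x (smult L1alg (sstar L1alg f) f)"
  have C: "0 \<le> C" unfolding C_def by (rule ind_norm_nonneg[OF sff])
  have "ind_norm x f \<le> sqrt C"
  proof (rule ind_norm_le)
    fix \<xi> assume \<xi>: "\<xi> \<in> L2_funs nu"
    have "(l2_norm nu (ind_op x f \<xi>))\<^sup>2 = cmod (l2_inner nu (ind_op x (smult L1alg (sstar L1alg f) f) \<xi>) \<xi>)"
      unfolding l2_inner_ind_op_star_smult[OF f \<xi>] norm_of_real by simp
    also have "\<dots> \<le> l2_norm nu (ind_op x (smult L1alg (sstar L1alg f) f) \<xi>) * l2_norm nu \<xi>"
      by (intro l2_Cauchy_Schwarz ind_op_L2 sff \<xi>)
    also have "\<dots> \<le> C * l2_norm nu \<xi> * l2_norm nu \<xi>"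
      unfolding C_def by (intro mult_right_mono ind_norm_bound sff \<xi>) simp
    also have "\<dots> = (sqrt C * l2_norm nu \<xi>)\<^sup>2"
      using C by (simp add: power2_eq_square)
    finally show "l2_norm nu (ind_op x f \<xi>) \<le> sqrt C * l2_norm nu \<xi>"
      by (rule power2_le_imp_le) (use C in simp)
  qed (use C in simp)
  then have "(ind_norm x f)\<^sup>2 \<le> (sqrt C)\<^sup>2"
    by (intro power_mono ind_norm_nonneg f)
  then show "(ind_norm x f)\<^sup>2 \<le> C" using C by simp
qed

text \<open>Hence the enveloping norm dominates the norm of every induced operator, which makes the
  induced representations extend by continuity.\<close>

theorem cstar_seminorm_ind_norm: "cstar_seminorm L1alg (ind_norm x)"
  unfolding cstar_seminorm_def
  using ind_norm_nonneg ind_norm_le_snorm ind_norm_star_smult ind_norm_sscale ind_norm_sadd ind_norm_smult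
  by (simp del: L1_algebra_simps(2-5))

end

lemma cstar_seminorm_le_enveloping_norm:
  assumes "cstar_seminorm B p" "b \<in> elems B"
  shows "p b \<le> enveloping_norm B b"
  unfolding enveloping_norm_def
proof (rule cSup_upper)
  show "bdd_above {p b | p. cstar_seminorm B p}"
    using assms(2) by (intro bdd_aboveI[of _ "snorm B b"]) (auto simp: cstar_seminorm_def)
qed (use assms(1) in blast)

section \<open>Induced representations on constant sequences\<close>

lemma L2_class_eqI: "AE s in M. f s = g s \<Longrightarrow> L2_class M f = L2_class M g"
  unfolding L2_class_def by (auto elim: AE_mp)

lemma some_in_L2_class:
  assumes "f \<in> L2_funs M"
  shows "some_in (L2_class M f) \<in> L2_funs M" "AE s in M. some_in (L2_class M f) s = f s"
proof -
  have "some_in (L2_class M f) \<in> L2_class M f"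
    unfolding some_in_def by (rule someI[of _ f]) (simp add: L2_class_def assms)
  then show "some_in (L2_class M f) \<in> L2_funs M" "AE s in M. some_in (L2_class M f) s = f s"
    by (simp_all add: L2_class_def)
qed

lemma L2_simps:
  "vecs (L2 M) = L2_class M ` L2_funs M"
  "hadd (L2 M) \<xi> \<eta> = L2_class M (\<lambda>s. some_in \<xi> s + some_in \<eta> s)"
  "hscale (L2 M) c \<xi> = L2_class M (\<lambda>s. c * some_in \<xi> s)"
  "hinner (L2 M) \<xi> \<eta> = l2_inner M (some_in \<xi>) (some_in \<eta>)"
  by (simp_all add: L2_def l2_inner_def)

lemma L2_class_vecs: "f \<in> L2_funs M \<Longrightarrow> L2_class M f \<in> vecs (L2 M)"
  by (simp add: L2_simps)

lemma vecs_L2D: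
  assumes "\<xi> \<in> vecs (L2 M)"
  shows "some_in \<xi> \<in> L2_funs M" "L2_class M (some_in \<xi>) = \<xi>"
proof -
  obtain f where f: "f \<in> L2_funs M" "\<xi> = L2_class M f" using assms by (auto simp: L2_simps)
  show "some_in \<xi> \<in> L2_funs M" using some_in_L2_class[OF f(1)] f(2) by simp
  show "L2_class M (some_in \<xi>) = \<xi>"
    unfolding f(2) by (rule L2_class_eqI) (rule some_in_L2_class[OF f(1)])
qed

lemma l2_inner_some_in_left:
  assumes f: "f \<in> L2_funs M" and g: "g \<in> L2_funs M"
  shows "l2_inner M (some_in (L2_class M f)) g = l2_inner M f g"
  by (rule l2_inner_cong_AE) (use some_in_L2_class[OF f] f g in \<open>auto intro: L2_funsD\<close>)

lemma l2_inner_some_in_right: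
  assumes f: "f \<in> L2_funs M" and g: "g \<in> L2_funs M"
  shows "l2_inner M f (some_in (L2_class M g)) = l2_inner M f g"
  by (rule l2_inner_cong_AE) (use some_in_L2_class[OF g] f g in \<open>auto intro: L2_funsD\<close>)

lemma hnorm_L2: "hnorm (L2 M) \<xi> = l2_norm M (some_in \<xi>)"
  by (simp add: hnorm_def L2_simps l2_inner_self del: of_real_power)

lemma hnorm_hdiff_L2:
  assumes f: "f \<in> L2_funs M" and g: "g \<in> L2_funs M"
  shows "hnorm (L2 M) (hdiff (L2 M) (L2_class M f) (L2_class M g)) = l2_norm M (\<lambda>s. f s - g s)"
proof -
  have g': "(\<lambda>s. - 1 * some_in (L2_class M g) s) \<in> L2_funs M"
    by (rule L2_funs_mult[OF some_in_L2_class(1)[OF g]])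
  have "hdiff (L2 M) (L2_class M f) (L2_class M g) = L2_class M (\<lambda>s. f s - g s)"
    unfolding hdiff_def L2_simps
    by (rule L2_class_eqI) (use some_in_L2_class(2)[OF f] some_in_L2_class(2)[OF g] some_in_L2_class(2)[OF g'] in \<open>eventually_elim, simp\<close>)
  moreover have "l2_norm M (some_in (L2_class M (\<lambda>s. f s - g s))) = l2_norm M (\<lambda>s. f s - g s)"
    using some_in_L2_class[OF L2_funs_diff[OF f g]] L2_funs_diff[OF f g]
    by (intro l2_norm_cong_AE) (auto intro: L2_funsD)
  ultimately show ?thesis by (simp add: hnorm_L2)
qed

lemma L2_class_eq_iff:
  assumes f: "f \<in> L2_funs M" and g: "g \<in> L2_funs M"
  shows "L2_class M f = L2_class M g \<longleftrightarrow> l2_norm M (\<lambda>s. f s - g s) = 0"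
proof
  assume "l2_norm M (\<lambda>s. f s - g s) = 0"
  then have "AE s in M. f s - g s = 0" by (simp add: l2_norm_eq_0_iff[OF L2_funs_diff[OF f g]])
  then show "L2_class M f = L2_class M g" by (intro L2_class_eqI) (auto elim: AE_mp)
next
  assume eq: "L2_class M f = L2_class M g"
  have "AE s in M. f s - g s = 0"
    using some_in_L2_class(2)[OF f] some_in_L2_class(2)[OF g] unfolding eq by eventually_elim simp
  then show "l2_norm M (\<lambda>s. f s - g s) = 0" by (simp add: l2_norm_eq_0_iff[OF L2_funs_diff[OF f g]])
qed

section \<open>The integrated form and its extension to the crossed product\<close>

context haar_action
begin

lemma translation_L2:
  assumes \<xi>: "\<xi> \<in> L2_funs nu"
  shows "(\<lambda>s. complex_of_real (sqrt (Mod t)) * \<xi> (- t + s)) \<in> L2_funs nu"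
proof (intro L2_funs_mult L2_funsI)
  note [measurable] = borel_measurable_L2_funs_nu[OF \<xi>]
  show "(\<lambda>s. \<xi> (- t + s)) \<in> borel_measurable nu" by measurable
  have "(\<integral>\<^sup>+s. (ennreal (cmod (\<xi> (- t + s))))\<^sup>2 \<partial>nu) = ennreal (Mod (- t)) * (\<integral>\<^sup>+s. (ennreal (cmod (\<xi> s)))\<^sup>2 \<partial>nu)"
    by (rule nn_integral_nu_left_translate[of "\<lambda>s. (ennreal (cmod (\<xi> s)))\<^sup>2"]) measurable
  also have "\<dots> < \<infinity>" by (simp add: nn_integral_L2_funs[OF \<xi>] ennreal_mult_less_top)
  finally show "(\<integral>\<^sup>+s. (ennreal (cmod (\<xi> (- t + s))))\<^sup>2 \<partial>nu) < \<infinity>" .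
qed

lemma eval_mult_L2:
  assumes \<xi>: "\<xi> \<in> L2_funs nu"
  shows "(\<lambda>s. c0_apply h (act s x) * \<xi> s) \<in> L2_funs nu"
proof (rule L2_funsI)
  note [measurable] = borel_measurable_L2_funs_nu[OF \<xi>]
  show "(\<lambda>s. c0_apply h (act s x) * \<xi> s) \<in> borel_measurable nu" by measurable
  have "(\<integral>\<^sup>+s. (ennreal (cmod (c0_apply h (act s x) * \<xi> s)))\<^sup>2 \<partial>nu)
      \<le> (\<integral>\<^sup>+s. (ennreal (norm h))\<^sup>2 * (ennreal (cmod (\<xi> s)))\<^sup>2 \<partial>nu)"
    unfolding power_mult_distrib[symmetric]
    by (intro nn_integral_mono power_mono)
      (auto simp: norm_mult ennreal_mult[symmetric] intro!: ennreal_leI mult_right_mono norm_c0_apply_le)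
  also have "\<dots> < \<infinity>"
    by (simp add: nn_integral_cmult nn_integral_L2_funs[OF \<xi>] ennreal_mult_less_top power_less_top_ennreal)
  finally show "(\<integral>\<^sup>+s. (ennreal (cmod (c0_apply h (act s x) * \<xi> s)))\<^sup>2 \<partial>nu) < \<infinity>" .
qed

lemma hinner_covariant_pair:
  assumes \<xi>: "\<xi> \<in> vecs (L2 nu)" and \<eta>: "\<eta> \<in> vecs (L2 nu)"
  shows "hinner (L2 nu) (eval_rep act nu x h (translation_rep mu nu t \<xi>)) \<eta>
    = (\<integral>s. c0_apply h (act s x) * (complex_of_real (sqrt (Mod t)) * some_in \<xi> (- t + s)) * cnj (some_in \<eta> s) \<partial>nu)"
proof -
  let ?\<tau> = "\<lambda>s. complex_of_real (sqrt (Mod t)) * some_in \<xi> (- t + s)"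
  have \<tau>: "?\<tau> \<in> L2_funs nu" by (rule translation_L2[OF vecs_L2D(1)[OF \<xi>]])
  have "eval_rep act nu x h (translation_rep mu nu t \<xi>) = L2_class nu (\<lambda>s. c0_apply h (act s x) * ?\<tau> s)"
    unfolding eval_rep_def translation_rep_def
    by (rule L2_class_eqI) (use some_in_L2_class(2)[OF \<tau>] in \<open>eventually_elim, simp\<close>)
  then have "hinner (L2 nu) (eval_rep act nu x h (translation_rep mu nu t \<xi>)) \<eta>
      = l2_inner nu (\<lambda>s. c0_apply h (act s x) * ?\<tau> s) (some_in \<eta>)"
    by (simp only: L2_simps l2_inner_some_in_left[OF eval_mult_L2[OF \<tau>] vecs_L2D(1)[OF \<eta>]])
  then show ?thesis by (simp only: l2_inner_def)
qed

abbreviation "integrated x \<equiv> integrated_form mu (L2 nu) (eval_rep act nu x) (translation_rep mu nu)"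

text \<open>Resolves the definite description: existence is the Fubini identity for the pairing, and
  uniqueness follows since a vector is determined by its inner products.\<close>

lemma integrated_form_eq:
  assumes f: "integrable mu f" and \<xi>: "\<xi> \<in> vecs (L2 nu)"
  shows "integrated x f \<xi> = L2_class nu (ind_op x f (some_in \<xi>))"
  unfolding integrated_form_def
proof (rule the_equality, intro conjI ballI)
  let ?v = "ind_op x f (some_in \<xi>)"
  have v: "?v \<in> L2_funs nu" by (rule ind_op_L2[OF f vecs_L2D(1)[OF \<xi>]])
  show "L2_class nu ?v \<in> vecs (L2 nu)" by (rule L2_class_vecs[OF v])
  have inner: "l2_inner nu ?v (some_in \<eta>)
      = (\<integral>t. hinner (L2 nu) (eval_rep act nu x (f t) (translation_rep mu nu t \<xi>)) \<eta> \<partial>mu)"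
    if \<eta>: "\<eta> \<in> vecs (L2 nu)" for \<eta>
    using hinner_covariant_pair[OF \<xi> \<eta>] l2_inner_ind_op[OF f vecs_L2D(1)[OF \<xi>] vecs_L2D(1)[OF \<eta>]] by simp
  fix \<eta> assume \<eta>: "\<eta> \<in> vecs (L2 nu)"
  show "hinner (L2 nu) (L2_class nu ?v) \<eta>
      = (\<integral>t. hinner (L2 nu) (eval_rep act nu x (f t) (translation_rep mu nu t \<xi>)) \<eta> \<partial>mu)"
    unfolding L2_simps(4)[of _ "L2_class nu ?v"] l2_inner_some_in_left[OF v vecs_L2D(1)[OF \<eta>]] by (rule inner[OF \<eta>])
next
  fix \<zeta> assume "\<zeta> \<in> vecs (L2 nu) \<and>
    (\<forall>\<eta>\<in>vecs (L2 nu). hinner (L2 nu) \<zeta> \<eta>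
      = (\<integral>t. hinner (L2 nu) (eval_rep act nu x (f t) (translation_rep mu nu t \<xi>)) \<eta> \<partial>mu))"
  then have \<zeta>: "\<zeta> \<in> vecs (L2 nu)"
    and eq: "\<forall>\<eta>\<in>vecs (L2 nu). hinner (L2 nu) \<zeta> \<eta>
      = (\<integral>t. hinner (L2 nu) (eval_rep act nu x (f t) (translation_rep mu nu t \<xi>)) \<eta> \<partial>mu)"
    by simp_all
  let ?v = "ind_op x f (some_in \<xi>)" and ?u = "some_in \<zeta>"
  have v: "?v \<in> L2_funs nu" by (rule ind_op_L2[OF f vecs_L2D(1)[OF \<xi>]])
  have u: "?u \<in> L2_funs nu" by (rule vecs_L2D(1)[OF \<zeta>])
  have d: "(\<lambda>s. ?u s - ?v s) \<in> L2_funs nu" by (rule L2_funs_diff[OF u v])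
  \<comment> \<open>Testing against the difference of the two candidates makes its norm
    vanish.\<close>
  let ?\<eta> = "L2_class nu (\<lambda>s. ?u s - ?v s)"
  have \<eta>: "?\<eta> \<in> vecs (L2 nu)" by (rule L2_class_vecs[OF d])
  have "l2_inner nu ?u (some_in ?\<eta>) = l2_inner nu ?v (some_in ?\<eta>)"
    using bspec[OF eq \<eta>] hinner_covariant_pair[OF \<xi> \<eta>] l2_inner_ind_op[OF f vecs_L2D(1)[OF \<xi>] vecs_L2D(1)[OF \<eta>]]
    by (simp add: L2_simps(4)[of _ \<zeta>])
  then have "l2_inner nu ?u (\<lambda>s. ?u s - ?v s) = l2_inner nu ?v (\<lambda>s. ?u s - ?v s)"
    by (simp add: l2_inner_some_in_right u v d)
  then have "l2_inner nu (\<lambda>s. ?u s - ?v s) (\<lambda>s. ?u s - ?v s) = 0"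
    by (subst l2_inner_diff_left[OF u v d]) simp
  then have "l2_norm nu (\<lambda>s. ?u s - ?v s) = 0"
    by (simp add: l2_inner_self)
  then have "L2_class nu ?u = L2_class nu ?v"
    by (simp add: L2_class_eq_iff[OF u v])
  then show "\<zeta> = L2_class nu ?v" by (simp add: vecs_L2D(2)[OF \<zeta>])
qed

lemma ind_norm_le_enveloping_norm: "integrable mu f \<Longrightarrow> ind_norm x f \<le> enveloping_norm L1alg f"
  by (rule cstar_seminorm_le_enveloping_norm[OF cstar_seminorm_ind_norm]) simp

lemma integrable_sdiff:
  "integrable mu f \<Longrightarrow> integrable mu g \<Longrightarrow> integrable mu (sdiff L1alg f g)"
  using integrable_sscale[of g "- 1"] by (simp add: sdiff_def)

text \<open>A real supremum over the empty set is unspecified, so the existence of some C*-seminorm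
  matters even here; \<open>ind_norm\<close> provides one. The value is then squeezed between 0 and
  the vanishing L^1 norm.\<close>

lemma enveloping_norm_sdiff_self:
  assumes f: "integrable mu f"
  shows "enveloping_norm L1alg (sdiff L1alg f f) = 0"
proof (rule antisym)
  have d: "integrable mu (sdiff L1alg f f)" by (rule integrable_sdiff[OF f f])
  have "sdiff L1alg f f = (\<lambda>s. 0)"
    by (auto simp: sdiff_def intro!: c0_eqI)
  then have "snorm L1alg (sdiff L1alg f f) = 0" by simp
  moreover have "enveloping_norm L1alg (sdiff L1alg f f) \<le> snorm L1alg (sdiff L1alg f f)"
    unfolding enveloping_norm_def
  proof (rule cSup_least)
    show "{p (sdiff L1alg f f) | p. cstar_seminorm L1alg p} \<noteq> {}"
      using cstar_seminorm_ind_norm by blast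
    fix r assume "r \<in> {p (sdiff L1alg f f) | p. cstar_seminorm L1alg p}"
    then obtain p where p: "r = p (sdiff L1alg f f)" "cstar_seminorm L1alg p" by blast
    have "sdiff L1alg f f \<in> elems L1alg" using d by simp
    with p show "r \<le> snorm L1alg (sdiff L1alg f f)"
      unfolding cstar_seminorm_def by blast
  qed
  ultimately show "enveloping_norm L1alg (sdiff L1alg f f) \<le> 0" by linarith
  show "0 \<le> enveloping_norm L1alg (sdiff L1alg f f)"
    using ind_norm_nonneg[OF d] ind_norm_le_enveloping_norm[OF d] by (rule order_trans)
qed

text \<open>The canonical image of an L^1 element in the enveloping algebra.\<close>

abbreviation "const_class f \<equiv> enveloping_class L1alg (\<lambda>_. f)"

lemma const_enveloping_cauchy: "integrable mu f \<Longrightarrow> (\<lambda>_. f) \<in> enveloping_cauchy L1alg"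
  by (simp add: enveloping_cauchy_def enveloping_norm_sdiff_self)

lemma const_in_const_class: "integrable mu f \<Longrightarrow> (\<lambda>_. f) \<in> const_class f"
  by (simp add: enveloping_class_def const_enveloping_cauchy enveloping_norm_sdiff_self)

lemma const_class_in_crossed_product: "integrable mu f \<Longrightarrow> const_class f \<in> elems (crossed_product act mu)"
  using const_enveloping_cauchy by (simp add: crossed_product_def enveloping_cstar_algebra_def)

lemma ind_op_sdiff:
  assumes f: "integrable mu f" and g: "integrable mu g" and \<xi>: "\<xi> \<in> L2_funs nu"
  shows "l2_norm nu (\<lambda>s. ind_op x g \<xi> s - ind_op x f \<xi> s) \<le> enveloping_norm L1alg (sdiff L1alg f g) * l2_norm nu \<xi>"
proof -
  have d: "integrable mu (sdiff L1alg f g)" by (rule integrable_sdiff[OF f g])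
  have "AE s in nu. - 1 * ind_op x (sdiff L1alg f g) \<xi> s = ind_op x g \<xi> s - ind_op x f \<xi> s"
    using ind_op_sadd[OF f integrable_sscale[OF g] \<xi>, of x "- 1"]
    unfolding sdiff_def ind_op_sscale by eventually_elim simp
  then have "AE s in nu. ind_op x g \<xi> s - ind_op x f \<xi> s = - 1 * ind_op x (sdiff L1alg f g) \<xi> s"
    by eventually_elim (rule sym)
  then have "l2_norm nu (\<lambda>s. ind_op x g \<xi> s - ind_op x f \<xi> s) = l2_norm nu (\<lambda>s. - 1 * ind_op x (sdiff L1alg f g) \<xi> s)"
    by (intro l2_norm_cong_AE L2_funsD(1)[OF L2_funs_diff] L2_funsD(1)[OF L2_funs_mult] ind_op_L2 f g d \<xi>)
  also have "\<dots> = l2_norm nu (ind_op x (sdiff L1alg f g) \<xi>)"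
    by (simp only: l2_norm_mult) simp
  also have "\<dots> \<le> ind_norm x (sdiff L1alg f g) * l2_norm nu \<xi>"
    by (rule ind_norm_bound[OF d \<xi>])
  also have "\<dots> \<le> enveloping_norm L1alg (sdiff L1alg f g) * l2_norm nu \<xi>"
    by (intro mult_right_mono ind_norm_le_enveloping_norm d) simp
  finally show ?thesis .
qed

text \<open>Along any sequence in the class the operators converge because the enveloping norm
  dominates theirs. The limit is unique because the constant sequence itself belongs to the
  class.\<close>

lemma enveloping_extension_const_class:
  assumes f: "integrable mu f" and \<xi>: "\<xi> \<in> vecs (L2 nu)"
  shows "enveloping_extension (L2 nu) (integrated x) (const_class f) \<xi> = L2_class nu (ind_op x f (some_in \<xi>))"
  unfolding enveloping_extension_def
proof (rule the_equality, intro conjI ballI)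
  let ?v = "ind_op x f (some_in \<xi>)"
  have \<xi>': "some_in \<xi> \<in> L2_funs nu" by (rule vecs_L2D(1)[OF \<xi>])
  have v: "?v \<in> L2_funs nu" by (rule ind_op_L2[OF f \<xi>'])
  show "L2_class nu ?v \<in> vecs (L2 nu)" by (rule L2_class_vecs[OF v])
  fix u assume "u \<in> const_class f"
  then have u: "\<And>n. integrable mu (u n)" and lim: "(\<lambda>n. enveloping_norm L1alg (sdiff L1alg f (u n))) \<longlonglongrightarrow> 0"
    by (simp_all add: enveloping_class_def enveloping_cauchy_def)
  have eq: "hnorm (L2 nu) (hdiff (L2 nu) (integrated x (u n) \<xi>) (L2_class nu ?v))
      = l2_norm nu (\<lambda>s. ind_op x (u n) (some_in \<xi>) s - ?v s)" for n
    unfolding integrated_form_eq[OF u \<xi>] by (rule hnorm_hdiff_L2[OF ind_op_L2[OF u \<xi>'] v])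
  have "(\<lambda>n. enveloping_norm L1alg (sdiff L1alg f (u n)) * l2_norm nu (some_in \<xi>)) \<longlonglongrightarrow> 0"
    using tendsto_mult_right[OF lim, of "l2_norm nu (some_in \<xi>)"] by simp
  then show "(\<lambda>n. hnorm (L2 nu) (hdiff (L2 nu) (integrated x (u n) \<xi>) (L2_class nu ?v))) \<longlonglongrightarrow> 0"
    unfolding eq by (rule tendsto_sandwich[OF _ _ tendsto_const, rotated 2])
      (auto intro!: always_eventually ind_op_sdiff f u \<xi>')
next
  fix \<zeta> assume "\<zeta> \<in> vecs (L2 nu) \<and> (\<forall>u\<in>const_class f. (\<lambda>n. hnorm (L2 nu) (hdiff (L2 nu) (integrated x (u n) \<xi>) \<zeta>)) \<longlonglongrightarrow> 0)"
  then have \<zeta>: "\<zeta> \<in> vecs (L2 nu)" and lim: "\<forall>u\<in>const_class f. (\<lambda>n. hnorm (L2 nu) (hdiff (L2 nu) (integrated x (u n) \<xi>) \<zeta>)) \<longlonglongrightarrow> 0"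
    by simp_all
  have v: "ind_op x f (some_in \<xi>) \<in> L2_funs nu" by (rule ind_op_L2[OF f vecs_L2D(1)[OF \<xi>]])
  have "hnorm (L2 nu) (hdiff (L2 nu) (integrated x f \<xi>) \<zeta>) = 0"
    using bspec[OF lim const_in_const_class[OF f]] by (simp add: LIMSEQ_const_iff)
  then have "l2_norm nu (\<lambda>s. ind_op x f (some_in \<xi>) s - some_in \<zeta> s) = 0"
    using hnorm_hdiff_L2[OF v vecs_L2D(1)[OF \<zeta>]] by (simp add: integrated_form_eq[OF f \<xi>] vecs_L2D(2)[OF \<zeta>])
  then show "\<zeta> = L2_class nu (ind_op x f (some_in \<xi>))"
    using L2_class_eq_iff[OF v vecs_L2D(1)[OF \<zeta>]] by (simp add: vecs_L2D(2)[OF \<zeta>])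
qed

lemma rspace_Ind: "rspace (Ind act mu x) = L2 nu"
  by (simp add: Ind_def Let_def)

lemma vector_functional_const_class:
  assumes f: "integrable mu f" and \<eta>: "\<eta> \<in> vecs (L2 nu)"
  shows "vector_functional (crossed_product act mu) (Ind act mu x) \<eta> (const_class f)
    = l2_inner nu (ind_op x f (some_in \<eta>)) (some_in \<eta>)"
proof -
  have \<eta>': "some_in \<eta> \<in> L2_funs nu" by (rule vecs_L2D(1)[OF \<eta>])
  have "rop (Ind act mu x) (const_class f) \<eta> = L2_class nu (ind_op x f (some_in \<eta>))"
    by (simp add: Ind_def Let_def enveloping_extension_const_class[OF f \<eta>])
  then show ?thesis
    by (simp add: vector_functional_def const_class_in_crossed_product[OF f] rspace_Ind L2_simps(4)
        l2_inner_some_in_left[OF ind_op_L2[OF f \<eta>'] \<eta>'])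
qed

end

section \<open>Continuous functions approximating indicators of open sets\<close>

lemma locally_compact_Urysohn_c0:
  fixes K :: "'x::t2_space set"
  assumes lc: "locally_compact_space (euclidean :: 'x topology)"
    and K: "compact K" and W: "open W" and KW: "K \<subseteq> W"
  obtains F :: "'x c0" and r :: "'x \<Rightarrow> real" where "\<And>y. c0_apply F y = complex_of_real (r y)"
    "\<And>y. 0 \<le> r y" "\<And>y. r y \<le> 1" "\<And>y. y \<in> K \<Longrightarrow> r y = 1" "\<And>y. y \<notin> W \<Longrightarrow> r y = 0"
proof -
  have haus: "Hausdorff_space (euclidean :: 'x topology)"
    unfolding Hausdorff_space_def using hausdorff[where 'a = 'x] by (simp add: disjnt_def)
  then have "\<exists>U L. openin (euclidean :: 'x topology) U \<and> compactin euclidean L \<and> closedin euclidean L \<and> K \<subseteq> U \<and> U \<subseteq> L"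
    using lc K locally_compact_space_compact_closed_compact[of "euclidean :: 'x topology"] by simp
  then obtain U L where U: "open U" "K \<subseteq> U" and L: "compact L" "U \<subseteq> L" by auto
  \<comment> \<open>The function is made to vanish off \<open>W \<inter> U\<close> instead of off
    \<open>W\<close>: \<open>U\<close> lies in the compact set \<open>L\<close>, so the result
    vanishes at infinity.\<close>
  have "closedin euclidean (- (W \<inter> U))" using W U by (auto intro: closed_Un)
  moreover have "completely_regular_space (euclidean :: 'x topology)"
    using lc haus by (intro locally_compact_regular_imp_completely_regular_space) auto
  moreover have "disjnt K (- (W \<inter> U))" using KW U by (auto simp: disjnt_def)
  ultimately obtain r :: "'x \<Rightarrow> real" where r: "continuous_map euclidean (top_of_set {0..1}) r"
    "r ` (- (W \<inter> U)) \<subseteq> {0}" "r ` K \<subseteq> {1}"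
    using Urysohn_completely_regular_compact_closed[of 0 1 "euclidean :: 'x topology" K "- (W \<inter> U)"] K by auto
  have cont: "continuous_on UNIV r" and range: "r y \<in> {0..1}" for y
    using r(1) by (auto simp: continuous_map_in_subtopology)
  have "c0_apply (c0_of (\<lambda>y. complex_of_real (r y))) = (\<lambda>y. complex_of_real (r y))"
  proof (rule c0_apply_c0_of)
    show cont': "continuous_on UNIV (\<lambda>y. complex_of_real (r y))" by (intro continuous_intros cont)
    fix e :: real assume "0 < e"
    show "compact {y. e \<le> cmod (complex_of_real (r y))}"
    proof (rule compact_ge_subset[OF cont' L(1)], clarify)
      fix y assume "e \<le> cmod (complex_of_real (r y))"
      then have "r y \<noteq> 0" using \<open>0 < e\<close> by auto
      then have "y \<in> U" using r(2) by auto
      then show "y \<in> L" using L(2) by blast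
    qed
  qed
  then show thesis
    using r range by (intro that[of "c0_of (\<lambda>y. complex_of_real (r y))" r]) auto
qed

text \<open>Level sets of cutoff functions at height 1/2 give open sets sandwiched between a point
  and a compact subset of \<open>W\<close>. Lindelof selects countably many, and finite unions of
  the compact sets eventually absorb each point.\<close>

lemma open_exhausted_by_compacts:
  fixes W :: "'x::{t2_space,second_countable_topology} set"
  assumes lc: "locally_compact_space (euclidean :: 'x topology)" and W: "open W"
  obtains K :: "nat \<Rightarrow> 'x set" where "\<And>n. compact (K n)" "\<And>n. K n \<subseteq> W" "\<And>y. y \<in> W \<Longrightarrow> \<exists>N. \<forall>n\<ge>N. y \<in> K n"
proof (cases "W = {}")
  case True
  then show thesis using that[of "\<lambda>_. {}"] by simp
next
  case False
  define \<C> where "\<C> = {U. open U \<and> (\<exists>K. compact K \<and> U \<subseteq> K \<and> K \<subseteq> W)}"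
  have "y \<in> \<Union>\<C>" if "y \<in> W" for y
  proof -
    obtain F :: "'x c0" and r where F: "\<And>y. c0_apply F y = complex_of_real (r y)" "\<And>y. 0 \<le> r y"
      "r y = 1" "\<And>y. y \<notin> W \<Longrightarrow> r y = 0"
      by (rule locally_compact_Urysohn_c0[OF lc compact_sing W, of y]) (use \<open>y \<in> W\<close> in auto)
    let ?U = "{y. 1 / 2 < cmod (c0_apply F y)}" and ?K = "{y. 1 / 2 \<le> cmod (c0_apply F y)}"
    have "open ?U" by (intro open_Collect_less continuous_intros)
    moreover have "compact ?K" by (rule compact_c0_apply) simp
    moreover have "?U \<subseteq> ?K" by auto
    moreover have "?K \<subseteq> W"
    proof clarify
      fix y assume "1 / 2 \<le> cmod (c0_apply F y)"
      then have "r y \<noteq> 0" using F(1)[of y] by auto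
      then show "y \<in> W" using F(4) by blast
    qed
    ultimately have "?U \<in> \<C>" unfolding \<C>_def by blast
    moreover have "y \<in> ?U" using F by simp
    ultimately show ?thesis by blast
  qed
  then have "W \<subseteq> \<Union>\<C>" by blast
  have op: "open U" if "U \<in> \<C>" for U using that by (simp add: \<C>_def)
  obtain \<U> where \<U>: "\<U> \<subseteq> \<C>" "countable \<U>" "\<Union>\<U> = \<Union>\<C>"
    by (rule Lindelof[OF op])
  have "\<Union>\<U> \<noteq> {}" using \<open>W \<subseteq> \<Union>\<C>\<close> False unfolding \<U>(3) by blast
  then have "\<U> \<noteq> {}" by blast
  define U where "U = from_nat_into \<U>"
  have U: "range U = \<U>" unfolding U_def by (rule range_from_nat_into[OF \<open>\<U> \<noteq> {}\<close> \<U>(2)])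
  have "\<exists>K. compact K \<and> U i \<subseteq> K \<and> K \<subseteq> W" for i
  proof -
    have "U i \<in> \<C>" using U \<U>(1) by blast
    then show ?thesis unfolding \<C>_def by blast
  qed
  then obtain L where L: "\<And>i. compact (L i)" "\<And>i. U i \<subseteq> L i" "\<And>i. L i \<subseteq> W" by metis
  show thesis
  proof (rule that[of "\<lambda>n. \<Union>i\<le>n. L i"])
    show "\<exists>N. \<forall>n\<ge>N. y \<in> (\<Union>i\<le>n. L i)" if "y \<in> W" for y
    proof -
      have "y \<in> \<Union>(range U)" using \<open>W \<subseteq> \<Union>\<C>\<close> \<open>y \<in> W\<close> unfolding U \<U>(3) by blast
      then obtain i where "y \<in> U i" by blast
      then show ?thesis using L(2) by (intro exI[of _ i]) auto
    qed
    show "(\<Union>i\<le>n. L i) \<subseteq> W" for n using L(3) by (intro UN_least)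
  qed (use L(1) in \<open>auto intro!: compact_UN\<close>)
qed

lemma open_indicator_limit_c0:
  fixes W :: "'x::{t2_space,second_countable_topology} set"
  assumes lc: "locally_compact_space (euclidean :: 'x topology)" and W: "open W"
  obtains F :: "nat \<Rightarrow> 'x c0" where "\<And>n y. cmod (c0_apply (F n) y) \<le> 1" "\<And>n y. y \<notin> W \<Longrightarrow> c0_apply (F n) y = 0"
    "\<And>y. (\<lambda>n. c0_apply (F n) y) \<longlonglongrightarrow> indicator W y"
proof -
  obtain K :: "nat \<Rightarrow> 'x set" where K: "\<And>n. compact (K n)" "\<And>n. K n \<subseteq> W" "\<And>y. y \<in> W \<Longrightarrow> \<exists>N. \<forall>n\<ge>N. y \<in> K n"
    using open_exhausted_by_compacts[OF lc W] by blast
  have "\<exists>F :: 'x c0. (\<forall>y. cmod (c0_apply F y) \<le> 1) \<and> (\<forall>y. y \<notin> W \<longrightarrow> c0_apply F y = 0) \<and> (\<forall>y\<in>K n. c0_apply F y = 1)" for n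
  proof -
    obtain F :: "'x c0" and r where F: "\<And>y. c0_apply F y = complex_of_real (r y)" "\<And>y. 0 \<le> r y" "\<And>y. r y \<le> 1"
      "\<And>y. y \<in> K n \<Longrightarrow> r y = 1" "\<And>y. y \<notin> W \<Longrightarrow> r y = 0"
      using locally_compact_Urysohn_c0[OF lc K(1) W K(2)] by blast
    then show ?thesis by (intro exI[of _ F]) auto
  qed
  then obtain F :: "nat \<Rightarrow> 'x c0" where F: "\<And>n y. cmod (c0_apply (F n) y) \<le> 1"
    "\<And>n y. y \<notin> W \<Longrightarrow> c0_apply (F n) y = 0" "\<And>n y. y \<in> K n \<Longrightarrow> c0_apply (F n) y = 1"
    by metis
  have "(\<lambda>n. c0_apply (F n) y) \<longlonglongrightarrow> indicator W y" for y
  proof (cases "y \<in> W")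
    case True
    then obtain N where "\<forall>n\<ge>N. y \<in> K n" using K(3) by blast
    then have "\<forall>\<^sub>F n in sequentially. c0_apply (F n) y = 1"
      using F(3) by (auto simp: eventually_sequentially)
    then show ?thesis using True by (simp add: tendsto_eventually)
  qed (use F in simp)
  then show thesis using F that by blast
qed

section \<open>Density of functions pulled back from an orbit\<close>

text \<open>The factors 2 stem from |a + b|^2 \<le> 2 |a|^2 + 2 |b|^2; hence the quarter of
  \<open>e\<close> in each closure argument below.\<close>

lemma quarter_ennreal: "0 < e \<Longrightarrow> 2 * ennreal (e / 4) + 2 * ennreal (e / 4) = ennreal e"
proof -
  assume "0 < e"
  have "2 * ennreal (e / 4) = ennreal (2 * (e / 4))"
    using \<open>0 < e\<close> ennreal_mult[of 2 "e / 4"] by simp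
  then have "2 * ennreal (e / 4) + 2 * ennreal (e / 4) = ennreal (2 * (e / 4) + 2 * (e / 4))"
    using \<open>0 < e\<close> by (subst ennreal_plus) simp_all
  then show ?thesis by simp
qed

lemma nn_integral_square_add_le:
  assumes [measurable]: "f \<in> borel_measurable M" "g \<in> borel_measurable M"
  shows "(\<integral>\<^sup>+s. (ennreal (cmod (f s + g s)))\<^sup>2 \<partial>M)
    \<le> 2 * (\<integral>\<^sup>+s. (ennreal (cmod (f s)))\<^sup>2 \<partial>M) + 2 * (\<integral>\<^sup>+s. (ennreal (cmod (g s)))\<^sup>2 \<partial>M)"
proof -
  have "(ennreal (cmod (a + b)))\<^sup>2 \<le> 2 * (ennreal (cmod a))\<^sup>2 + 2 * (ennreal (cmod b))\<^sup>2" for a b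
    using ennreal_leI[OF cmod_add_square_le[of a b]]
    by (simp add: ennreal_power ennreal_plus ennreal_mult del: ennreal_plus_if)
  then have "(\<integral>\<^sup>+s. (ennreal (cmod (f s + g s)))\<^sup>2 \<partial>M)
      \<le> (\<integral>\<^sup>+s. 2 * (ennreal (cmod (f s)))\<^sup>2 + 2 * (ennreal (cmod (g s)))\<^sup>2 \<partial>M)"
    by (intro nn_integral_mono)
  then show ?thesis by (simp add: nn_integral_add nn_integral_cmult)
qed

context haar_action
begin

text \<open>The condition concerns the pullback of \<open>g\<close> to the group, not the support of
  \<open>g\<close> in X. The compact set \<open>R\<close> later enters the truncation set.\<close>

definition compact_on_orbit :: "'x \<Rightarrow> 'x c0 \<Rightarrow> bool" where
  "compact_on_orbit z g \<longleftrightarrow> (\<exists>R. compact R \<and> (\<forall>s. c0_apply g (act s z) \<noteq> 0 \<longrightarrow> s \<in> R))"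

text \<open>The closure of the pullbacks in the L^2 distance of \<open>nu\<close>. Stated with
  \<open>ennreal\<close> integrals, it can be verified before \<open>\<xi>\<close> is known to be
  square integrable.\<close>

definition orbit_approximable :: "'x \<Rightarrow> ('g \<Rightarrow> complex) \<Rightarrow> bool" where
  "orbit_approximable z \<xi> \<longleftrightarrow> \<xi> \<in> borel_measurable borel \<and>
    (\<forall>e>0. \<exists>g. compact_on_orbit z g \<and> (\<integral>\<^sup>+s. (ennreal (cmod (\<xi> s - c0_apply g (act s z))))\<^sup>2 \<partial>nu) < ennreal e)"

lemma orbit_approximable_measurable: "orbit_approximable z \<xi> \<Longrightarrow> \<xi> \<in> borel_measurable borel"
  by (simp add: orbit_approximable_def)

lemma orbit_approximable_c0:
  assumes "compact_on_orbit z g"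
  shows "orbit_approximable z (\<lambda>s. c0_apply g (act s z))"
  unfolding orbit_approximable_def using assms by (auto intro!: exI[of _ g])

lemma compact_on_orbit_add:
  assumes "compact_on_orbit z g" "compact_on_orbit z h"
  shows "compact_on_orbit z (g + h)"
proof -
  obtain R S where "compact R" "\<forall>s. c0_apply g (act s z) \<noteq> 0 \<longrightarrow> s \<in> R"
    "compact S" "\<forall>s. c0_apply h (act s z) \<noteq> 0 \<longrightarrow> s \<in> S"
    using assms by (auto simp: compact_on_orbit_def)
  then show ?thesis
    unfolding compact_on_orbit_def
    by (intro exI[of _ "R \<union> S"]) (metis Un_iff add.right_neutral c0_apply_add compact_Un)
qed

lemma orbit_approximable_limit:
  assumes [measurable]: "\<xi> \<in> borel_measurable borel"
    and lim: "\<And>e. 0 < e \<Longrightarrow> \<exists>\<eta>. orbit_approximable z \<eta> \<and> (\<integral>\<^sup>+s. (ennreal (cmod (\<xi> s - \<eta> s)))\<^sup>2 \<partial>nu) < ennreal e"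
  shows "orbit_approximable z \<xi>"
  unfolding orbit_approximable_def
proof (intro conjI allI impI assms)
  fix e :: real assume "0 < e"
  then obtain \<eta> where \<eta>: "orbit_approximable z \<eta>" "(\<integral>\<^sup>+s. (ennreal (cmod (\<xi> s - \<eta> s)))\<^sup>2 \<partial>nu) < ennreal (e / 4)"
    using lim[of "e / 4"] by auto
  obtain g where g: "compact_on_orbit z g" "(\<integral>\<^sup>+s. (ennreal (cmod (\<eta> s - c0_apply g (act s z))))\<^sup>2 \<partial>nu) < ennreal (e / 4)"
    using \<eta>(1) \<open>0 < e\<close> unfolding orbit_approximable_def by (meson divide_pos_pos zero_less_numeral)
  have [measurable]: "\<eta> \<in> borel_measurable borel" using \<eta>(1) by (rule orbit_approximable_measurable)
  have "(\<integral>\<^sup>+s. (ennreal (cmod ((\<xi> s - \<eta> s) + (\<eta> s - c0_apply g (act s z)))))\<^sup>2 \<partial>nu)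
      \<le> 2 * (\<integral>\<^sup>+s. (ennreal (cmod (\<xi> s - \<eta> s)))\<^sup>2 \<partial>nu) + 2 * (\<integral>\<^sup>+s. (ennreal (cmod (\<eta> s - c0_apply g (act s z))))\<^sup>2 \<partial>nu)"
    by (rule nn_integral_square_add_le) measurable
  also have "\<dots> < 2 * ennreal (e / 4) + 2 * ennreal (e / 4)"
    using \<eta>(2) g(2) by (intro add_strict_mono ennreal_mult_strict_left_mono) (auto simp: top.not_eq_extremum)
  also have "\<dots> = ennreal e"
    using \<open>0 < e\<close> by (rule quarter_ennreal)
  finally show "\<exists>g. compact_on_orbit z g \<and> (\<integral>\<^sup>+s. (ennreal (cmod (\<xi> s - c0_apply g (act s z))))\<^sup>2 \<partial>nu) < ennreal e"
    using g(1) by auto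
qed

lemma orbit_approximable_add:
  assumes "orbit_approximable z \<xi>" "orbit_approximable z \<eta>"
  shows "orbit_approximable z (\<lambda>s. \<xi> s + \<eta> s)"
  unfolding orbit_approximable_def
proof (intro conjI allI impI)
  have [measurable]: "\<xi> \<in> borel_measurable borel" "\<eta> \<in> borel_measurable borel"
    using assms by (auto intro: orbit_approximable_measurable)
  show "(\<lambda>s. \<xi> s + \<eta> s) \<in> borel_measurable borel" by measurable
  fix e :: real assume "0 < e"
  then obtain g h where gh: "compact_on_orbit z g" "compact_on_orbit z h"
    "(\<integral>\<^sup>+s. (ennreal (cmod (\<xi> s - c0_apply g (act s z))))\<^sup>2 \<partial>nu) < ennreal (e / 4)"
    "(\<integral>\<^sup>+s. (ennreal (cmod (\<eta> s - c0_apply h (act s z))))\<^sup>2 \<partial>nu) < ennreal (e / 4)"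
    using assms unfolding orbit_approximable_def by (meson divide_pos_pos zero_less_numeral)
  have "(\<integral>\<^sup>+s. (ennreal (cmod (\<xi> s + \<eta> s - c0_apply (g + h) (act s z))))\<^sup>2 \<partial>nu)
      = (\<integral>\<^sup>+s. (ennreal (cmod ((\<xi> s - c0_apply g (act s z)) + (\<eta> s - c0_apply h (act s z)))))\<^sup>2 \<partial>nu)"
    by (simp add: algebra_simps)
  also have "\<dots> \<le> 2 * (\<integral>\<^sup>+s. (ennreal (cmod (\<xi> s - c0_apply g (act s z))))\<^sup>2 \<partial>nu)
      + 2 * (\<integral>\<^sup>+s. (ennreal (cmod (\<eta> s - c0_apply h (act s z))))\<^sup>2 \<partial>nu)"
    by (rule nn_integral_square_add_le) measurable
  also have "\<dots> < 2 * ennreal (e / 4) + 2 * ennreal (e / 4)"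
    using gh(3,4) by (intro add_strict_mono ennreal_mult_strict_left_mono) (auto simp: top.not_eq_extremum)
  also have "\<dots> = ennreal e"
    using \<open>0 < e\<close> by (rule quarter_ennreal)
  finally show "\<exists>g. compact_on_orbit z g \<and> (\<integral>\<^sup>+s. (ennreal (cmod (\<xi> s + \<eta> s - c0_apply g (act s z))))\<^sup>2 \<partial>nu) < ennreal e"
    using compact_on_orbit_add[OF gh(1,2)] by blast
qed

lemma orbit_approximable_zero: "orbit_approximable z (\<lambda>s. 0)"
proof -
  have "compact_on_orbit z 0" unfolding compact_on_orbit_def by (intro exI[of _ "{}"]) simp
  from orbit_approximable_c0[OF this] show ?thesis by simp
qed

lemma orbit_approximable_mult:
  assumes "orbit_approximable z \<xi>"
  shows "orbit_approximable z (\<lambda>s. c * \<xi> s)"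
proof (cases "c = 0")
  case False
  show ?thesis
    unfolding orbit_approximable_def
  proof (intro conjI allI impI)
    have [measurable]: "\<xi> \<in> borel_measurable borel"
      using assms by (rule orbit_approximable_measurable)
    show "(\<lambda>s. c * \<xi> s) \<in> borel_measurable borel" by measurable
    fix e :: real assume "0 < e"
    then have "0 < e / (cmod c)\<^sup>2" using False by simp
    then obtain g where g: "compact_on_orbit z g"
      "(\<integral>\<^sup>+s. (ennreal (cmod (\<xi> s - c0_apply g (act s z))))\<^sup>2 \<partial>nu) < ennreal (e / (cmod c)\<^sup>2)"
      using assms unfolding orbit_approximable_def by blast
    have "compact_on_orbit z (c0_scale c g)"
      using g(1) by (auto simp: compact_on_orbit_def)
    moreover have "(\<integral>\<^sup>+s. (ennreal (cmod (c * \<xi> s - c0_apply (c0_scale c g) (act s z))))\<^sup>2 \<partial>nu)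
        = (\<integral>\<^sup>+s. ennreal ((cmod c)\<^sup>2) * (ennreal (cmod (\<xi> s - c0_apply g (act s z))))\<^sup>2 \<partial>nu)"
      by (simp add: right_diff_distrib[symmetric] norm_mult ennreal_power power_mult_distrib ennreal_mult)
    moreover have "\<dots> = ennreal ((cmod c)\<^sup>2) * (\<integral>\<^sup>+s. (ennreal (cmod (\<xi> s - c0_apply g (act s z))))\<^sup>2 \<partial>nu)"
      by (rule nn_integral_cmult) measurable
    moreover have "\<dots> < ennreal ((cmod c)\<^sup>2) * ennreal (e / (cmod c)\<^sup>2)"
      using g(2) False by (intro ennreal_mult_strict_left_mono) auto
    moreover have "\<dots> = ennreal e"
      using False by (subst ennreal_mult'[symmetric]) auto
    ultimately show "\<exists>g. compact_on_orbit z g \<and> (\<integral>\<^sup>+s. (ennreal (cmod (c * \<xi> s - c0_apply g (act s z))))\<^sup>2 \<partial>nu) < ennreal e"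
      by (intro exI[of _ "c0_scale c g"]) simp
  qed
qed (simp add: orbit_approximable_zero)

lemma orbit_approximable_sum:
  "(\<And>i. i \<in> I \<Longrightarrow> orbit_approximable z (f i)) \<Longrightarrow> orbit_approximable z (\<lambda>s. \<Sum>i\<in>I. f i s)"
  by (induction I rule: infinite_finite_induct) (auto intro: orbit_approximable_zero orbit_approximable_add)

lemma orbit_approximable_dominated_limit:
  assumes X: "\<And>n. orbit_approximable z (X n)" and lim: "\<And>s. (\<lambda>n. X n s) \<longlonglongrightarrow> \<xi> s"
    and bound: "\<And>n s. cmod (X n s) \<le> w s" and [measurable]: "w \<in> borel_measurable borel"
    and fin: "(\<integral>\<^sup>+s. (ennreal (w s))\<^sup>2 \<partial>nu) < \<infinity>"
  shows "orbit_approximable z \<xi>"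
proof (rule orbit_approximable_limit)
  have X'[measurable]: "X n \<in> borel_measurable borel" for n by (rule orbit_approximable_measurable[OF X])
  show [measurable]: "\<xi> \<in> borel_measurable borel"
    by (rule borel_measurable_LIMSEQ_metric[OF X' lim])
  have bound': "cmod (\<xi> s) \<le> w s" for s
    by (rule tendsto_upperbound[OF tendsto_norm[OF lim]]) (auto intro: bound always_eventually)
  have "(\<lambda>n. \<integral>\<^sup>+s. (ennreal (cmod (\<xi> s - X n s)))\<^sup>2 \<partial>nu) \<longlonglongrightarrow> (\<integral>\<^sup>+s. 0 \<partial>nu)"
  proof (rule nn_integral_dominated_convergence)
    show "AE s in nu. (ennreal (cmod (\<xi> s - X n s)))\<^sup>2 \<le> 4 * (ennreal (w s))\<^sup>2" for n
    proof (rule AE_I2)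
      fix s
      have "cmod (\<xi> s - X n s) \<le> 2 * w s"
        using norm_triangle_ineq4[of "\<xi> s" "X n s"] bound[of n s] bound'[of s] by linarith
      then have "(cmod (\<xi> s - X n s))\<^sup>2 \<le> (2 * w s)\<^sup>2" by (intro power_mono) auto
      then have "ennreal ((cmod (\<xi> s - X n s))\<^sup>2) \<le> ennreal (4 * (w s)\<^sup>2)"
        by (intro ennreal_leI) (simp add: power_mult_distrib)
      moreover have "0 \<le> w s" using bound'[of s] norm_ge_zero order_trans by blast
      ultimately show "(ennreal (cmod (\<xi> s - X n s)))\<^sup>2 \<le> 4 * (ennreal (w s))\<^sup>2"
        by (simp add: ennreal_power ennreal_mult)
    qed
    show "(\<integral>\<^sup>+s. 4 * (ennreal (w s))\<^sup>2 \<partial>nu) < \<infinity>"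
      using fin by (subst nn_integral_cmult) (auto simp: ennreal_mult_less_top)
    show "AE s in nu. (\<lambda>n. (ennreal (cmod (\<xi> s - X n s)))\<^sup>2) \<longlonglongrightarrow> 0"
    proof (rule AE_I2)
      fix s
      have "(\<lambda>n. (cmod (\<xi> s - X n s))\<^sup>2) \<longlonglongrightarrow> (cmod (\<xi> s - \<xi> s))\<^sup>2"
        by (intro tendsto_intros lim)
      then have "(\<lambda>n. ennreal ((cmod (\<xi> s - X n s))\<^sup>2)) \<longlonglongrightarrow> ennreal 0"
        by (intro tendsto_ennrealI) simp
      then show "(\<lambda>n. (ennreal (cmod (\<xi> s - X n s)))\<^sup>2) \<longlonglongrightarrow> 0" by (simp add: ennreal_power)
    qed
  qed measurable
  then have lim0: "(\<lambda>n. \<integral>\<^sup>+s. (ennreal (cmod (\<xi> s - X n s)))\<^sup>2 \<partial>nu) \<longlonglongrightarrow> 0" by simp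
  fix e :: real assume "0 < e"
  then have "\<forall>\<^sub>F n in sequentially. (\<integral>\<^sup>+s. (ennreal (cmod (\<xi> s - X n s)))\<^sup>2 \<partial>nu) < ennreal e"
    using order_tendstoD(2)[OF lim0, of "ennreal e"] by simp
  then obtain n where "(\<integral>\<^sup>+s. (ennreal (cmod (\<xi> s - X n s)))\<^sup>2 \<partial>nu) < ennreal e"
    by (auto simp: eventually_sequentially)
  then show "\<exists>\<eta>. orbit_approximable z \<eta> \<and> (\<integral>\<^sup>+s. (ennreal (cmod (\<xi> s - \<eta> s)))\<^sup>2 \<partial>nu) < ennreal e"
    using X by blast
qed

text \<open>Disjointness turns the partial sums into indicators, and the set \<open>C\<close> of
  finite measure dominates them.\<close>

lemma orbit_approximable_indicator_disjoint_UN: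
  assumes A: "\<And>i::nat. orbit_approximable z (indicator (A i))" and disj: "disjoint_family A"
    and C: "(\<Union>i. A i) \<subseteq> C" "C \<in> sets borel" "emeasure nu C < \<infinity>"
  shows "orbit_approximable z (indicator (\<Union>i. A i))"
proof (rule orbit_approximable_dominated_limit)
  have eq: "(\<Sum>i<n. indicator (A i) s :: complex) = indicator (\<Union>i<n. A i) s" for n s
    using disj by (subst indicator_UN_disjoint) (auto simp: disjoint_family_on_def)
  show "orbit_approximable z (\<lambda>s. \<Sum>i<n. indicator (A i) s)" for n
    by (rule orbit_approximable_sum) (rule A)
  show "(\<lambda>n. \<Sum>i<n. indicator (A i) s) \<longlonglongrightarrow> (indicator (\<Union>i. A i) s :: complex)" for s
    unfolding eq by (rule LIMSEQ_indicator_UN)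
  show "cmod (\<Sum>i<n. indicator (A i) s) \<le> indicator C s" for n s
    unfolding eq using C(1) by (auto simp: indicator_def)
  show "indicator C \<in> borel_measurable borel" using C(2) by simp
  have "(\<integral>\<^sup>+s. (ennreal (indicator C s))\<^sup>2 \<partial>nu) = (\<integral>\<^sup>+s. indicator C s \<partial>nu)"
    by (intro nn_integral_cong) (auto simp: indicator_def)
  then show "(\<integral>\<^sup>+s. (ennreal (indicator C s))\<^sup>2 \<partial>nu) < \<infinity>"
    using C by (simp add: sets_nu)
qed

end

section \<open>Density on the orbit of a free action\<close>

locale free_haar_action = haar_action mu act for mu and act ::
    "'g::{topological_group_add,t2_space,second_countable_topology} \<Rightarrow> 'x::{t2_space,second_countable_topology} \<Rightarrow> 'x" +
  assumes free: "free_action act"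
begin

lemma act_inject: "act s z = act t z \<longleftrightarrow> s = t"
proof
  assume "act s z = act t z"
  then have "act (- t) (act s z) = act (- t) (act t z)" by simp
  then have "act (- t + s) z = z" by (simp add: act_act)
  then have "- t + s = 0" using free unfolding free_action_def by blast
  then have "t + (- t + s) = t + 0" by simp
  then show "s = t" by (simp flip: add.assoc)
qed simp

lemma locally_compact_space_X: "locally_compact_space (euclidean :: 'x topology)"
  using transformation_group by (simp add: transformation_group_def)

text \<open>Freeness lets an open set of group elements be cut out by an open subset of X:
  \<open>C - U\<close> is compact, so its image in X is closed and may be removed from
  \<open>V\<close>, and injectivity of the orbit map leaves exactly \<open>U\<close>.\<close>

lemma orbit_approximable_indicator_open:
  assumes V: "open V" and C: "compact C" "{s. act s z \<in> V} \<subseteq> C"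
    and U: "open U" "U \<subseteq> {s. act s z \<in> V}"
  shows "orbit_approximable z (indicator U)"
proof -
  define W where "W = V - (\<lambda>s. act s z) ` (C - U)"
  have "compact ((\<lambda>s. act s z) ` (C - U))"
    using C(1) U(1) by (intro compact_continuous_image continuous_intros compact_diff)
  then have "open W" unfolding W_def using V by (intro open_Diff compact_imp_closed)
  have W: "act s z \<in> W \<longleftrightarrow> s \<in> U" for s
    using C(2) U(2) by (auto simp: W_def act_inject)
  obtain F :: "nat \<Rightarrow> 'x c0" where F: "\<And>n y. cmod (c0_apply (F n) y) \<le> 1"
    "\<And>n y. y \<notin> W \<Longrightarrow> c0_apply (F n) y = 0" "\<And>y. (\<lambda>n. c0_apply (F n) y) \<longlonglongrightarrow> indicator W y"
    using open_indicator_limit_c0[OF locally_compact_space_X \<open>open W\<close>] by blast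
  have supp: "s \<in> C" if "c0_apply (F n) (act s z) \<noteq> 0" for n s
    using F(2)[of "act s z" n] that W[of s] U(2) C(2) by blast
  have C'[measurable]: "C \<in> sets borel" using C(1) by (simp add: compact_imp_closed)
  show ?thesis
  proof (rule orbit_approximable_dominated_limit)
    show "orbit_approximable z (\<lambda>s. c0_apply (F n) (act s z))" for n
      using C(1) supp by (intro orbit_approximable_c0) (auto simp: compact_on_orbit_def)
    show "(\<lambda>n. c0_apply (F n) (act s z)) \<longlonglongrightarrow> indicator U s" for s
      using F(3)[of "act s z"] W[of s] by (simp add: indicator_def)
    show "cmod (c0_apply (F n) (act s z)) \<le> indicator C s" for n s
      using F(1)[of n "act s z"] supp[of n s] by (auto simp: indicator_def)
    have "(\<integral>\<^sup>+s. (ennreal (indicator C s))\<^sup>2 \<partial>nu) = (\<integral>\<^sup>+s. indicator C s \<partial>nu)"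
      by (intro nn_integral_cong) (auto simp: indicator_def)
    then show "(\<integral>\<^sup>+s. (ennreal (indicator C s))\<^sup>2 \<partial>nu) < \<infinity>"
      using emeasure_nu_compact[OF C(1)] by (simp add: sets_nu)
  qed measurable
qed

text \<open>A pi-lambda argument over the open sets, relative to the preimage of \<open>V\<close>.
  The compact set \<open>C\<close> supplies the finite measure that the step to disjoint unions
  requires.\<close>

lemma orbit_approximable_indicator_Int:
  assumes V: "open V" and C: "compact C" "{s. act s z \<in> V} \<subseteq> C"
    and E: "E \<in> sets borel"
  shows "orbit_approximable z (indicator (E \<inter> {s. act s z \<in> V}))"
proof -
  let ?W = "{s. act s z \<in> V}"
  have oW: "open ?W"
    using open_vimage[OF V, of "\<lambda>s. act s z"] continuous_on_act[OF continuous_on_id continuous_on_const]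
    by (simp add: vimage_def)
  have C': "C \<in> sets borel" using C(1) by (simp add: compact_imp_closed)
  have "Int_stable {S. open S}" by (auto simp: Int_stable_def)
  moreover have "{S. open S} \<subseteq> Pow (UNIV :: 'g set)" by simp
  moreover have "E \<in> sigma_sets UNIV {S. open S}"
    using E by (simp add: borel_def)
  ultimately show ?thesis
  proof (induction rule: sigma_sets_induct_disjoint)
    case (basic A)
    then have "open (A \<inter> ?W)" using oW by (simp add: open_Int)
    then show ?case by (intro orbit_approximable_indicator_open[OF V C]) auto
  next
    case empty
    then show ?case using orbit_approximable_zero by (simp add: indicator_def[abs_def])
  next
    case (compl A)
    have "orbit_approximable z (\<lambda>s. indicator ?W s + (- 1) * indicator (A \<inter> ?W) s)"
      by (intro orbit_approximable_add orbit_approximable_mult compl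
          orbit_approximable_indicator_open[OF V C oW]) simp
    also have "(\<lambda>s. indicator ?W s + (- 1) * indicator (A \<inter> ?W) s :: complex) = indicator ((UNIV - A) \<inter> ?W)"
      by (auto simp: indicator_def)
    finally show ?case .
  next
    case (union A)
    have "orbit_approximable z (indicator (\<Union>i. A i \<inter> ?W))"
    proof (rule orbit_approximable_indicator_disjoint_UN)
      show "disjoint_family (\<lambda>i. A i \<inter> ?W)"
        using union(1) by (auto simp: disjoint_family_on_def)
    qed (use union C C' emeasure_nu_compact[OF C(1)] in auto)
    then show ?case by (simp only: UN_extend_simps(4))
  qed
qed

text \<open>Countably many translates of the preimage of \<open>V\<close> cover the group. Made
  disjoint, they cut a set of finite measure into pieces covered by the relative result; simple
  functions and dominated convergence do the rest.\<close>

lemma orbit_approximable_L2_funs: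
  assumes V: "open V" "z \<in> V" and C: "compact C" "{s. act s z \<in> V} \<subseteq> C" and \<xi>: "\<xi> \<in> L2_funs nu"
  shows "orbit_approximable z \<xi>"
proof -
  \<comment> \<open>The translate by \<open>t\<close> of the preimage of \<open>V\<close> under the
    orbit map.\<close>
  define W where "W t = {s. act (- t + s) z \<in> V}" for t
  have oW: "open (W t)" for t
  proof -
    have "continuous_on UNIV (\<lambda>s. act (- t + s) z)" by (intro continuous_intros)
    then show ?thesis using open_vimage[OF V(1), of "\<lambda>s. act (- t + s) z"] by (simp add: W_def vimage_def)
  qed
  have part: "orbit_approximable z (indicator (E \<inter> W t))" if E: "E \<in> sets borel" for E t
  proof -
    \<comment> \<open>This is the translate of \<open>V\<close> by \<open>t\<close> in X. Its
      preimage under the orbit map is \<open>W t\<close>, contained in the translate of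
      \<open>C\<close>.\<close>
    let ?V = "{y. act (- t) y \<in> V}"
    have "open ?V"
      using open_vimage[OF V(1), of "act (- t)"] continuous_on_act[OF continuous_on_const continuous_on_id]
      by (simp add: vimage_def)
    moreover have "compact ((\<lambda>s. t + s) ` C)"
      by (intro compact_continuous_image continuous_intros C)
    moreover have "{s. act s z \<in> ?V} \<subseteq> (\<lambda>s. t + s) ` C"
      using C(2) by (auto simp: act_act group_image_eq_vimage)
    ultimately show ?thesis
      using orbit_approximable_indicator_Int[OF _ _ _ E, of ?V "(\<lambda>s. t + s) ` C" z] by (simp add: act_act W_def)
  qed
  have op: "open U" if "U \<in> range W" for U using that oW by auto
  obtain \<F> where \<F>: "\<F> \<subseteq> range W" "countable \<F>" "\<Union>\<F> = \<Union>(range W)"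
    by (rule Lindelof[OF op])
  have "s \<in> W s" for s using V(2) by (simp add: W_def)
  then have UN: "\<Union>\<F> = UNIV" using \<F>(3) by auto
  then have "\<F> \<noteq> {}" by auto
  define Y where "Y = from_nat_into \<F>"
  have Y: "range Y = \<F>" unfolding Y_def by (rule range_from_nat_into[OF \<open>\<F> \<noteq> {}\<close> \<F>(2)])
  have Y': "Y i \<in> range W" for i using Y \<F>(1) by blast
  then have "Y i \<in> sets borel" for i using op by simp
  then have dY: "disjointed Y i \<in> sets borel" for i 
    using sets.range_disjointed_sets[of Y borel] by auto
  have fin: "orbit_approximable z (indicator E)" if E: "E \<in> sets borel" "emeasure nu E < \<infinity>" for E
  proof -
    have "orbit_approximable z (indicator (\<Union>i. E \<inter> disjointed Y i))"
    proof (rule orbit_approximable_indicator_disjoint_UN)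
      fix i
      obtain t where t: "Y i = W t" using Y'[of i] by blast
      have "E \<inter> disjointed Y i = (E \<inter> disjointed Y i) \<inter> W t"
        using disjointed_subset[of Y i] t by auto
      then show "orbit_approximable z (indicator (E \<inter> disjointed Y i))"
        using part[of "E \<inter> disjointed Y i" t] E(1) dY[of i] by simp
    next
      show "disjoint_family (\<lambda>i. E \<inter> disjointed Y i)"
        using disjoint_family_disjointed[of Y] by (auto simp: disjoint_family_on_def)
    qed (use E in auto)
    moreover have "(\<Union>i. E \<inter> disjointed Y i) = E"
      using UN_disjointed_eq[of Y] Y UN by (simp flip: UN_extend_simps(4)) 
    ultimately show ?thesis by simp
  qed
  have [measurable]: "\<xi> \<in> borel_measurable borel" by (rule borel_measurable_L2_funs_nu[OF \<xi>])
  obtain F where F: "\<And>i. simple_function borel (F i)" "\<And>s. (\<lambda>i. F i s) \<longlonglongrightarrow> \<xi> s"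
    "\<And>i s. dist (F i s) 0 \<le> 2 * dist (\<xi> s) 0"
    using borel_measurable_implies_sequence_metric[of \<xi> borel 0] by auto
  have "orbit_approximable z (F i)" for i
  proof -
    have fr: "finite (range (F i))" using F(1)[of i] by (simp add: simple_function_def)
    have meas: "F i -` {c} \<in> sets borel" for c 
      using simple_functionD(2)[OF F(1), of i "{c}"] by simp
    have "orbit_approximable z (\<lambda>s. \<Sum>c\<in>range (F i). c * indicator (F i -` {c}) s)"
    proof (rule orbit_approximable_sum)
      fix c
      show "orbit_approximable z (\<lambda>s. c * indicator (F i -` {c}) s)"
      proof (cases "c = 0")
        case False
        \<comment> \<open>Chebyshev: on this level set |c| is at most twice the modulus of
          \<open>\<xi>\<close>, which is square integrable.\<close>
        have "emeasure nu (F i -` {c}) < \<infinity>"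
        proof -
          have "ennreal ((cmod c)\<^sup>2) * emeasure nu (F i -` {c}) = (\<integral>\<^sup>+s. ennreal ((cmod c)\<^sup>2) * indicator (F i -` {c}) s \<partial>nu)"
            using meas by (subst nn_integral_cmult_indicator) (simp_all add: sets_nu)
          also have "\<dots> \<le> (\<integral>\<^sup>+s. 4 * (ennreal (cmod (\<xi> s)))\<^sup>2 \<partial>nu)"
          proof (rule nn_integral_mono)
            fix s
            show "ennreal ((cmod c)\<^sup>2) * indicator (F i -` {c}) s \<le> 4 * (ennreal (cmod (\<xi> s)))\<^sup>2"
            proof (cases "F i s = c")
              case True
              then have "(cmod c)\<^sup>2 \<le> (2 * cmod (\<xi> s))\<^sup>2" using F(3)[of i s] by (intro power_mono) auto
              then have "ennreal ((cmod c)\<^sup>2) \<le> ennreal (4 * (cmod (\<xi> s))\<^sup>2)"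
                by (intro ennreal_leI) (simp add: power_mult_distrib)
              then show ?thesis using True by (simp add: ennreal_mult ennreal_power)
            qed simp
          qed
          also have "\<dots> < \<infinity>"
            by (simp add: nn_integral_cmult nn_integral_L2_funs[OF \<xi>] ennreal_mult_less_top)
          finally show ?thesis using False by (auto simp: ennreal_mult_less_top)
        qed
        then show ?thesis by (intro orbit_approximable_mult fin meas)
      qed (simp add: orbit_approximable_zero)
    qed
    moreover have "(\<Sum>c\<in>range (F i). c * indicator (F i -` {c}) s) = F i s" for s
    proof -
      have "(\<Sum>c\<in>range (F i). c * indicator (F i -` {c}) s) = (\<Sum>c\<in>range (F i). if c = F i s then c else 0)"
        by (intro sum.cong) (auto simp: indicator_def)
      then show ?thesis using fr by simp
    qed
    ultimately show ?thesis by simp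
  qed
  moreover have "(\<integral>\<^sup>+s. (ennreal (2 * cmod (\<xi> s)))\<^sup>2 \<partial>nu) < \<infinity>"
    by (simp add: ennreal_mult power_mult_distrib nn_integral_cmult nn_integral_L2_funs[OF \<xi>] ennreal_mult_less_top power_less_top_ennreal)
  ultimately show ?thesis
    by (intro orbit_approximable_dominated_limit[of z F \<xi> "\<lambda>s. 2 * cmod (\<xi> s)"] F(2)) (use F(3) in auto)
qed

end

section \<open>Truncated rank-one kernels\<close>

context haar_action
begin

text \<open>At the point \<open>s.x\<close> the second factor becomes the conjugate of
  \<open>g\<close> at \<open>(- t + s).x\<close>. With \<open>r = - t + s\<close>, so that
  \<open>t = s + - r\<close>, this is the wanted kernel; division by \<open>sqrt (Mod t)\<close>
  cancels the same factor in the translation operator.\<close>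

definition kernel_element :: "'g set \<Rightarrow> 'x c0 \<Rightarrow> 'x c0 \<Rightarrow> 'g \<Rightarrow> 'x c0" where
  "kernel_element B f g t = (indicator B t / sqrt (Mod t)) *\<^sub>R (f * c0_cnj (c0_translate act t g))"

definition kernel_row :: "'g set \<Rightarrow> 'x c0 \<Rightarrow> 'x \<Rightarrow> 'g \<Rightarrow> 'g \<Rightarrow> complex" where
  "kernel_row B g x s r = indicator B (s + - r) * c0_apply g (act r x)"

text \<open>The squared L^2 norm of a kernel row as a function of the point \<open>y = s.x\<close>
  of X, integrated over the reflection of \<open>B\<close>.\<close>

definition row_mass :: "'g set \<Rightarrow> 'x c0 \<Rightarrow> 'x \<Rightarrow> ennreal" where
  "row_mass B g y = (\<integral>\<^sup>+r. indicator B (- r) * (ennreal (cmod (c0_apply g (act r y))))\<^sup>2 \<partial>nu)"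

context
  fixes B :: "'g set"
  assumes B: "compact B"
begin

lemma sets_compact: "B \<in> sets borel"
  using B by (simp add: compact_imp_closed)

lemma compact_uminus: "compact (uminus ` B)"
  by (intro compact_continuous_image B continuous_intros)

lemma integrable_kernel_element: "integrable mu (kernel_element B f g)"
proof -
  note [measurable] = sets_compact
  \<comment> \<open>The bound is taken on the reflection of \<open>B\<close> because
    \<open>1 / sqrt (Mod t)\<close> equals \<open>sqrt (Mod (- t))\<close>.\<close>
  obtain C where C: "\<And>t. t \<in> uminus ` B \<Longrightarrow> Mod t \<le> C"
    using Mod_bounded_on_compact[OF compact_uminus] by blast
  show ?thesis
  proof (rule integrableI_bounded_set)
    show "B \<in> sets mu" "emeasure mu B < \<infinity>" using emeasure_compact[OF B] sets_compact by (simp_all add: sets_mu)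
    show "kernel_element B f g \<in> borel_measurable mu" unfolding kernel_element_def by measurable
    have "norm (kernel_element B f g t) \<le> sqrt C * (norm f * norm g)" if "t \<in> B" for t
    proof -
      have "Mod (- t) \<le> C" using C[of "- t"] that by blast
      then have "0 \<le> C" using Mod_pos[of "- t"] by linarith
      have "1 / sqrt (Mod t) \<le> sqrt C" using \<open>Mod (- t) \<le> C\<close>
        by (simp add: Mod_minus real_sqrt_inverse[symmetric] inverse_eq_divide[symmetric])
      moreover have "norm (f * c0_cnj (c0_translate act t g)) \<le> norm f * norm g"
        by (rule order_trans[OF norm_mult_ineq])
          (intro mult_left_mono order_trans[OF norm_c0_cnj] norm_c0_translate transformation_group norm_ge_zero)
      ultimately have "1 / sqrt (Mod t) * norm (f * c0_cnj (c0_translate act t g)) \<le> sqrt C * (norm f * norm g)"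
        using \<open>0 \<le> C\<close> by (intro mult_mono) auto
      then show ?thesis using that by (simp add: kernel_element_def)
    qed
    then show "AE t in mu. t \<in> B \<longrightarrow> norm (kernel_element B f g t) \<le> sqrt C * (norm f * norm g)" by simp
    show "AE t in mu. t \<notin> B \<longrightarrow> kernel_element B f g t = 0" by (simp add: kernel_element_def)
  qed
qed

lemma borel_measurable_kernel_row: "kernel_row B g x s \<in> borel_measurable borel"
proof -
  note [measurable] = sets_compact
  show ?thesis unfolding kernel_row_def by measurable
qed

text \<open>Right invariance of \<open>nu\<close>: replacing \<open>r\<close> by
  \<open>r + s\<close> turns the cutoff condition into \<open>- r \<in> B\<close>, so
  \<open>s\<close> and \<open>x\<close> enter only through \<open>s.x\<close>.\<close>

lemma nn_integral_kernel_row: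
  "(\<integral>\<^sup>+r. (ennreal (cmod (kernel_row B g x s r)))\<^sup>2 \<partial>nu) = row_mass B g (act s x)"
proof -
  note [measurable] = borel_measurable_kernel_row
  have "(\<integral>\<^sup>+r. (ennreal (cmod (kernel_row B g x s r)))\<^sup>2 \<partial>nu)
      = (\<integral>\<^sup>+r. (ennreal (cmod (kernel_row B g x s (r + s))))\<^sup>2 \<partial>nu)"
    by (rule nn_integral_nu_right_translate[symmetric]) measurable
  also have "\<dots> = row_mass B g (act s x)"
    unfolding row_mass_def
  proof (rule nn_integral_cong)
    fix r
    have "s + - (r + s) = - r" by (simp add: minus_add add.assoc[symmetric] del: add_uminus_conv_diff)
    then show "(ennreal (cmod (kernel_row B g x s (r + s))))\<^sup>2
        = indicator B (- r) * (ennreal (cmod (c0_apply g (act r (act s x)))))\<^sup>2"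
      by (simp add: kernel_row_def act_act norm_mult indicator_def del: add_uminus_conv_diff)
  qed
  finally show ?thesis .
qed

lemma row_mass_bound: "(\<integral>\<^sup>+r. indicator B (- r) * (ennreal (norm (g :: 'x c0)))\<^sup>2 \<partial>nu) < \<infinity>"
proof -
  have "(\<integral>\<^sup>+r. indicator B (- r) * (ennreal (norm g))\<^sup>2 \<partial>nu)
      = (\<integral>\<^sup>+r. (ennreal (norm g))\<^sup>2 * indicator (uminus ` B) r \<partial>nu)"
    by (intro nn_integral_cong) (simp add: group_image_eq_vimage indicator_def)
  also have "\<dots> = (ennreal (norm g))\<^sup>2 * emeasure nu (uminus ` B)"
    using compact_uminus by (intro nn_integral_cmult_indicator) (simp add: sets_nu compact_imp_closed)
  also have "\<dots> < \<infinity>"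
    using emeasure_nu_compact[OF compact_uminus] by (simp add: ennreal_mult_less_top power_less_top_ennreal)
  finally show ?thesis .
qed

lemma row_mass_finite: "row_mass B g y < \<infinity>"
proof -
  have "row_mass B g y \<le> (\<integral>\<^sup>+r. indicator B (- r) * (ennreal (norm g))\<^sup>2 \<partial>nu)"
    unfolding row_mass_def by (intro nn_integral_mono mult_left_mono power_mono ennreal_leI norm_c0_apply_le) auto
  then show ?thesis using row_mass_bound by (rule le_less_trans)
qed

lemma kernel_row_L2: "kernel_row B g x s \<in> L2_funs nu"
  by (rule L2_funsI) (use borel_measurable_kernel_row in \<open>simp_all add: measurable_cong_sets[OF sets_nu]
    nn_integral_kernel_row row_mass_finite[simplified]\<close>)

lemma l2_norm_kernel_row: "ennreal ((l2_norm nu (kernel_row B g x s))\<^sup>2) = row_mass B g (act s x)"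
  using nn_integral_L2_funs[OF kernel_row_L2] by (simp add: nn_integral_kernel_row)

lemma row_mass_orbit_le:
  "row_mass B g (act s x) \<le> (\<integral>\<^sup>+r. (ennreal (cmod (c0_apply g (act r x))))\<^sup>2 \<partial>nu)"
proof -
  have "row_mass B g (act s x) \<le> (\<integral>\<^sup>+r. (ennreal (cmod (c0_apply g (act (r + s) x))))\<^sup>2 \<partial>nu)"
    unfolding row_mass_def by (intro nn_integral_mono) (auto simp: act_act indicator_def)
  also have "\<dots> = (\<integral>\<^sup>+r. (ennreal (cmod (c0_apply g (act r x))))\<^sup>2 \<partial>nu)"
    by (rule nn_integral_nu_right_translate) measurable
  finally show ?thesis .
qed

text \<open>Dominated convergence over the compact reflection of \<open>B\<close>; in the second
  countable space X closedness may be tested on sequences.\<close>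

lemma open_row_mass_less: "open {y. row_mass B g y < c}"
proof -
  note [measurable] = sets_compact
  have "closed {y. c \<le> row_mass B g y}"
    unfolding closed_sequential_limits
  proof (intro allI impI, elim conjE)
    fix Y y assume Y: "\<forall>n. Y n \<in> {y. c \<le> row_mass B g y}" and lim: "Y \<longlonglongrightarrow> y"
    have "(\<lambda>n. row_mass B g (Y n)) \<longlonglongrightarrow> row_mass B g y"
      unfolding row_mass_def
    proof (rule nn_integral_dominated_convergence[where w = "\<lambda>r. indicator B (- r) * (ennreal (norm g))\<^sup>2"])
      show "AE r in nu. indicator B (- r) * (ennreal (cmod (c0_apply g (act r (Y n)))))\<^sup>2
          \<le> indicator B (- r) * (ennreal (norm g))\<^sup>2" for n
        by (intro AE_I2 mult_left_mono power_mono ennreal_leI norm_c0_apply_le) auto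
      show "(\<integral>\<^sup>+r. indicator B (- r) * (ennreal (norm g))\<^sup>2 \<partial>nu) < \<infinity>" by (rule row_mass_bound)
      show "AE r in nu. (\<lambda>n. indicator B (- r) * (ennreal (cmod (c0_apply g (act r (Y n)))))\<^sup>2)
          \<longlonglongrightarrow> indicator B (- r) * (ennreal (cmod (c0_apply g (act r y))))\<^sup>2"
      proof (rule AE_I2)
        fix r
        have "continuous_on UNIV (\<lambda>y. c0_apply g (act r y))"
          by (rule continuous_on_compose2[OF continuous_on_c0_apply[of UNIV]]) (intro continuous_intros, simp)
        then have "(\<lambda>n. c0_apply g (act r (Y n))) \<longlonglongrightarrow> c0_apply g (act r y)"
          by (rule continuous_on_tendsto_compose[OF _ lim]) auto
        then have "(\<lambda>n. ennreal ((cmod (c0_apply g (act r (Y n))))\<^sup>2)) \<longlonglongrightarrow> ennreal ((cmod (c0_apply g (act r y)))\<^sup>2)"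
          by (intro tendsto_ennrealI tendsto_intros)
        then show "(\<lambda>n. indicator B (- r) * (ennreal (cmod (c0_apply g (act r (Y n)))))\<^sup>2)
          \<longlonglongrightarrow> indicator B (- r) * (ennreal (cmod (c0_apply g (act r y))))\<^sup>2"
          by (auto simp: ennreal_power indicator_def)
      qed
    qed measurable
    then show "y \<in> {y. c \<le> row_mass B g y}"
      using Y by (auto intro: tendsto_lowerbound)
  qed
  moreover have "{y. row_mass B g y < c} = - {y. c \<le> row_mass B g y}" by auto
  ultimately show ?thesis by (simp add: open_Compl)
qed

lemma ind_op_kernel_element:
  assumes \<eta>: "\<eta> \<in> L2_funs nu"
  shows "ind_op x (kernel_element B f g) \<eta> s = c0_apply f (act s x) * l2_inner nu \<eta> (kernel_row B g x s)"
proof -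
  note [measurable] = borel_measurable_kernel_row borel_measurable_L2_funs_nu[OF \<eta>]
  \<comment> \<open>Substituting \<open>r = - t + s\<close> turns the \<open>mu\<close>-integral
    over \<open>t\<close> into a \<open>nu\<close>-integral over \<open>r\<close>, by left
    invariance and then reflection.\<close>
  define h where "h r = \<eta> r * cnj (kernel_row B g x s r)" for r
  have [measurable]: "h \<in> borel_measurable borel" unfolding h_def by measurable
  have "c0_apply (kernel_element B f g t) (act s x) * (complex_of_real (sqrt (Mod t)) * \<eta> (- t + s))
      = c0_apply f (act s x) * h (- (- s + t))" for t
  proof -
    have "s + - (- t + s) = t" by (simp add: minus_add add.assoc[symmetric] del: add_uminus_conv_diff)
    moreover have "- (- s + t) = - t + s" by (simp add: minus_add del: add_uminus_conv_diff)
    ultimately show ?thesis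
      by (cases "t \<in> B") (simp_all add: h_def kernel_row_def kernel_element_def c0_apply_act act_act scaleR_conv_of_real del: add_uminus_conv_diff)
  qed
  then have "ind_op x (kernel_element B f g) \<eta> s = (\<integral>t. c0_apply f (act s x) * h (- (- s + t)) \<partial>mu)"
    by (simp only: ind_op_def)
  also have "\<dots> = c0_apply f (act s x) * (\<integral>t. h (- (- s + t)) \<partial>mu)"
    by simp
  also have "(\<integral>t. h (- (- s + t)) \<partial>mu) = (\<integral>t. h (- t) \<partial>mu)"
    by (rule integral_translate[of "\<lambda>t. h (- t)"]) measurable
  also have "\<dots> = (\<integral>t. h t \<partial>nu)"
    by (rule integral_nu[symmetric]) measurable
  finally show ?thesis by (simp add: h_def l2_inner_def)
qed

text \<open>The left-hand side is a partial sum for the squared Hilbert--Schmidt norm of the kernel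
  operator; Bessel's inequality is applied to each row of the kernel.\<close>

lemma sum_l2_norm_kernel_element_le:
  assumes "finite I" and e: "\<And>i. i \<in> I \<Longrightarrow> e i \<in> L2_funs nu"
    and on: "\<And>i j. i \<in> I \<Longrightarrow> j \<in> I \<Longrightarrow> l2_inner nu (e i) (e j) = (if i = j then 1 else 0)"
    and f: "\<And>y. cmod (c0_apply f y) \<le> 1" "\<And>y. c0_apply f y \<noteq> 0 \<Longrightarrow> y \<in> V \<and> row_mass B g y \<le> c"
    and V: "open V"
  shows "(\<Sum>i\<in>I. ennreal ((l2_norm nu (ind_op x (kernel_element B f g) (e i)))\<^sup>2)) \<le> c * emeasure nu {s. act s x \<in> V}"
proof -
  note D = integrable_kernel_element[of f g]
  let ?T = "\<lambda>i. ind_op x (kernel_element B f g) (e i)"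
  have [measurable]: "?T i \<in> borel_measurable nu" if "i \<in> I" for i
    by (rule L2_funsD(1)[OF ind_op_L2[OF D e[OF that]]])
  have oV: "open {s. act s x \<in> V}"
    using open_vimage[OF V, of "\<lambda>s. act s x"] continuous_on_act[OF continuous_on_id continuous_on_const]
    by (simp add: vimage_def)
  have "(\<Sum>i\<in>I. ennreal ((l2_norm nu (?T i))\<^sup>2)) = (\<Sum>i\<in>I. \<integral>\<^sup>+s. (ennreal (cmod (?T i s)))\<^sup>2 \<partial>nu)"
    using nn_integral_L2_funs[OF ind_op_L2[OF D e]] by simp
  also have "\<dots> = (\<integral>\<^sup>+s. (\<Sum>i\<in>I. (ennreal (cmod (?T i s)))\<^sup>2) \<partial>nu)"
    by (rule nn_integral_sum[symmetric]) measurable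
  also have "\<dots> \<le> (\<integral>\<^sup>+s. c * indicator {s. act s x \<in> V} s \<partial>nu)"
  proof (rule nn_integral_mono)
    fix s
    let ?k = "kernel_row B g x s"
    show "(\<Sum>i\<in>I. (ennreal (cmod (?T i s)))\<^sup>2) \<le> c * indicator {s. act s x \<in> V} s"
    proof (cases "c0_apply f (act s x) = 0")
      case True
      then show ?thesis by (simp add: ind_op_kernel_element e)
    next
      case False
      have "cmod (?T i s) \<le> cmod (l2_inner nu ?k (e i))" if "i \<in> I" for i
      proof -
        have "cmod (?T i s) = cmod (c0_apply f (act s x)) * cmod (l2_inner nu (e i) ?k)"
          by (simp add: ind_op_kernel_element e that norm_mult)
        also have "\<dots> \<le> 1 * cmod (l2_inner nu (e i) ?k)"
          by (intro mult_right_mono f) simp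
        also have "\<dots> = cmod (l2_inner nu ?k (e i))"
          by (subst l2_inner_commute) simp
        finally show ?thesis .
      qed
      then have "(\<Sum>i\<in>I. (ennreal (cmod (?T i s)))\<^sup>2) \<le> (\<Sum>i\<in>I. ennreal ((cmod (l2_inner nu ?k (e i)))\<^sup>2))"
        by (intro sum_mono) (simp add: ennreal_power power_mono ennreal_leI)
      also have "\<dots> = ennreal (\<Sum>i\<in>I. (cmod (l2_inner nu ?k (e i)))\<^sup>2)"
        by (rule sum_ennreal) simp
      also have "\<dots> \<le> ennreal ((l2_norm nu ?k)\<^sup>2)"
        by (intro ennreal_leI l2_Bessel \<open>finite I\<close> e on kernel_row_L2)
      also have "\<dots> \<le> c"
        using f(2)[OF False] by (simp add: l2_norm_kernel_row)
      finally show ?thesis using f(2)[OF False] by simp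
    qed
  qed
  also have "\<dots> = c * emeasure nu {s. act s x \<in> V}"
    using oV by (intro nn_integral_cmult_indicator) (simp add: sets_nu)
  finally show ?thesis .
qed

lemma l2_norm_ind_op_kernel_element:
  assumes \<eta>: "\<eta> \<in> L2_funs nu" and g: "(\<lambda>s. c0_apply g (act s z)) \<in> L2_funs nu"
    and supp: "\<And>s r. c0_apply f (act s z) \<noteq> 0 \<Longrightarrow> c0_apply g (act r z) \<noteq> 0 \<Longrightarrow> s + - r \<in> B"
  shows "l2_norm nu (ind_op z (kernel_element B f g) \<eta>)
    = cmod (l2_inner nu \<eta> (\<lambda>s. c0_apply g (act s z))) * l2_norm nu (\<lambda>s. c0_apply f (act s z))"
proof -
  have "ind_op z (kernel_element B f g) \<eta> s
      = l2_inner nu \<eta> (\<lambda>s. c0_apply g (act s z)) * c0_apply f (act s z)" for s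
  proof (cases "c0_apply f (act s z) = 0")
    case False
    then have "kernel_row B g z s = (\<lambda>r. c0_apply g (act r z))"
      using supp[OF False] by (auto simp: kernel_row_def indicator_def fun_eq_iff)
    then show ?thesis by (simp add: ind_op_kernel_element[OF \<eta>])
  qed (simp add: ind_op_kernel_element[OF \<eta>])
  then have "ind_op z (kernel_element B f g) \<eta>
      = (\<lambda>s. l2_inner nu \<eta> (\<lambda>s. c0_apply g (act s z)) * c0_apply f (act s z))"
    by auto
  then show ?thesis by (simp add: l2_norm_mult)
qed

end

lemma compact_on_orbit_L2:
  assumes "compact R" "\<And>s. c0_apply g (act s z) \<noteq> 0 \<Longrightarrow> s \<in> R"
  shows "(\<lambda>s. c0_apply g (act s z)) \<in> L2_funs nu"
proof (rule L2_funsI)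
  have R: "R \<in> sets borel" using assms(1) by (simp add: compact_imp_closed)
  have "(\<integral>\<^sup>+s. (ennreal (cmod (c0_apply g (act s z))))\<^sup>2 \<partial>nu) \<le> (\<integral>\<^sup>+s. (ennreal (norm g))\<^sup>2 * indicator R s \<partial>nu)"
  proof (rule nn_integral_mono)
    fix s
    show "(ennreal (cmod (c0_apply g (act s z))))\<^sup>2 \<le> (ennreal (norm g))\<^sup>2 * indicator R s"
      using assms(2)[of s] by (cases "s \<in> R") (auto intro!: power_mono ennreal_leI norm_c0_apply_le)
  qed
  also have "\<dots> = (ennreal (norm g))\<^sup>2 * emeasure nu R"
    using R by (intro nn_integral_cmult_indicator) (simp add: sets_nu)
  also have "\<dots> < \<infinity>"
    using emeasure_nu_compact[OF assms(1)] by (simp add: ennreal_mult_less_top power_less_top_ennreal)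
  finally show "(\<integral>\<^sup>+s. (ennreal (cmod (c0_apply g (act s z))))\<^sup>2 \<partial>nu) < \<infinity>" .
qed measurable

end


section \<open>The multiplicity bound\<close>

text \<open>At \<open>d = 0\<close> the inequality is \<open>M < real k\<close>, so continuity
  suffices. In its use, two factors \<open>1 - d\<close> come from the inner product of
  \<open>\<xi>\<close> with its approximant and one from the cutoff, the subtracted \<open>d\<close>
  is the radius of the weak-star neighbourhood, and the cube of \<open>1 + d\<close> bounds the row
  mass.\<close>

lemma exists_small_delta:
  fixes M :: real
  assumes "M < real k"
  obtains d where "0 < d" "d < 1" "M * (1 + d)^3 < real k * ((1 - d)^3 - d)"
proof -
  have "((\<lambda>d::real. real k * ((1 - d)^3 - d) - M * (1 + d)^3) \<longlongrightarrow> real k * ((1 - 0)^3 - 0) - M * (1 + 0)^3) (at_right 0)"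
    by (intro tendsto_intros)
  then have "\<forall>\<^sub>F d in at_right 0. 0 < real k * ((1 - d)^3 - d) - M * (1 + d)^3"
    by (rule order_tendstoD) (use assms in simp)
  moreover have "\<forall>\<^sub>F d::real in at_right 0. d \<in> {0<..<1}"
    by (rule eventually_at_right_real) simp
  ultimately have "\<forall>\<^sub>F d in at_right 0. 0 < d \<and> d < 1 \<and> M * (1 + d)^3 < real k * ((1 - d)^3 - d)"
    by eventually_elim auto
  then show thesis
    using that by (auto dest!: eventually_happens simp: trivial_limit_at_right_real)
qed

text \<open>Along cutoffs increasing to the indicator of \<open>W\<close> at each point, the squared
  norms on the orbit converge to the measure of the preimage; the indicator of \<open>K\<close>
  dominates.\<close>

lemma (in haar_action) exists_cutoff:
  assumes W: "open W" and K: "compact K" "\<And>s. act s z \<in> W \<Longrightarrow> s \<in> K"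
    and m: "b < measure nu {s. act s z \<in> W}"
  obtains f :: "'x c0" where "\<And>y. cmod (c0_apply f y) \<le> 1" "\<And>y. y \<notin> W \<Longrightarrow> c0_apply f y = 0"
    "b < (l2_norm nu (\<lambda>s. c0_apply f (act s z)))\<^sup>2"
proof -
  have lc: "locally_compact_space (euclidean :: 'x topology)"
    using transformation_group by (simp add: transformation_group_def)
  obtain F :: "nat \<Rightarrow> 'x c0" where F: "\<And>n y. cmod (c0_apply (F n) y) \<le> 1"
    "\<And>n y. y \<notin> W \<Longrightarrow> c0_apply (F n) y = 0" "\<And>y. (\<lambda>n. c0_apply (F n) y) \<longlonglongrightarrow> indicator W y"
    using open_indicator_limit_c0[OF lc W] by blast
  have K': "K \<in> sets nu" using K(1) by (simp add: sets_nu compact_imp_closed)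
  have oW: "open {s. act s z \<in> W}"
    using open_vimage[OF W, of "\<lambda>s. act s z"] continuous_on_act[OF continuous_on_id continuous_on_const]
    by (simp add: vimage_def)
  have "(\<lambda>n. \<integral>s. (cmod (c0_apply (F n) (act s z)))\<^sup>2 \<partial>nu) \<longlonglongrightarrow> (\<integral>s. indicator {s. act s z \<in> W} s \<partial>nu)"
  proof (rule integral_dominated_convergence[where w = "indicator K"])
    show "integrable nu (indicator K :: 'g \<Rightarrow> real)"
      using K' emeasure_nu_compact[OF K(1)] by (simp add: integrable_indicator_iff)
    show "(indicator {s. act s z \<in> W} :: 'g \<Rightarrow> real) \<in> borel_measurable nu"
      using oW by (intro borel_measurable_indicator) (simp add: sets_nu)
    show "AE s in nu. (\<lambda>n. (cmod (c0_apply (F n) (act s z)))\<^sup>2) \<longlonglongrightarrow> indicator {s. act s z \<in> W} s"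
    proof (rule AE_I2)
      fix s
      have "(\<lambda>n. (cmod (c0_apply (F n) (act s z)))\<^sup>2) \<longlonglongrightarrow> (cmod (indicator W (act s z)))\<^sup>2"
        by (intro tendsto_intros F(3))
      also have "(cmod (indicator W (act s z)))\<^sup>2 = indicator {s. act s z \<in> W} s"
        by (simp add: indicator_def)
      finally show "(\<lambda>n. (cmod (c0_apply (F n) (act s z)))\<^sup>2) \<longlonglongrightarrow> indicator {s. act s z \<in> W} s" .
    qed
    have "(cmod (c0_apply (F n) (act s z)))\<^sup>2 \<le> indicator K s" for n s
    proof (cases "s \<in> K")
      case True
      then show ?thesis using F(1)[of n "act s z"] by (simp add: power_le_one)
    next
      case False
      then show ?thesis using F(2)[of "act s z" n] K(2)[of s] by auto
    qed
    then show "AE s in nu. norm ((cmod (c0_apply (F n) (act s z)))\<^sup>2) \<le> indicator K s" for n by simp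
  qed measurable
  then have "\<forall>\<^sub>F n in sequentially. b < (\<integral>s. (cmod (c0_apply (F n) (act s z)))\<^sup>2 \<partial>nu)"
    using m by (intro order_tendstoD(1)) simp_all
  then obtain n where "b < (\<integral>s. (cmod (c0_apply (F n) (act s z)))\<^sup>2 \<partial>nu)"
    by (auto simp: eventually_sequentially)
  then show thesis
    using F by (intro that[of "F n"]) (auto simp: l2_norm_def)
qed

theorem (in free_haar_action) upper_multiplicity_le:
  fixes M :: real and z :: 'x and x :: "nat \<Rightarrow> 'x"
  assumes M: "1 \<le> M" and V: "open V" "z \<in> V" and C: "compact (closure {s. act s z \<in> V})"
    and ev: "\<forall>\<^sub>F n in sequentially. emeasure nu {s. act s (x n) \<in> V} \<le> ennreal M * emeasure nu {s. act s z \<in> V}"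
    and \<phi>: "\<phi> \<in> associated_pure_states (crossed_product act mu) (Ind act mu z)"
  shows "upper_multiplicity (crossed_product act mu) \<phi> sequentially (\<lambda>n. Ind act mu (x n)) \<le> enat (nat \<lfloor>M\<rfloor>)"
proof -
  let ?A = "crossed_product act mu" and ?W = "{s. act s z \<in> V}" and ?C = "closure {s. act s z \<in> V}"
  \<comment> \<open>The goal becomes \<open>card S < k\<close>. As \<open>k\<close> exceeds the real
    number \<open>M\<close> strictly, there is room for the losses governed by
    \<open>d\<close>.\<close>
  define k where "k = Suc (nat \<lfloor>M\<rfloor>)"
  have "M < real k" unfolding k_def using M by (simp add: nat_add_distrib) linarith
  then obtain d where d: "0 < d" "d < 1" "M * (1 + d)^3 < real k * ((1 - d)^3 - d)"
    by (rule exists_small_delta)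
  \<comment> \<open>\<open>b * m\<close> will be a lower bound for |D eta|^2 at every vector
    counted; \<open>b > 0\<close> is read off from the choice of \<open>d\<close> and permits the
    final cancellation.\<close>
  define b where "b = (1 - d)^3 - d"
  have "0 < M * (1 + d)^3" using M d by simp
  then have "0 < real k * b" using d(3) unfolding b_def by linarith
  then have b: "0 < b" by (simp add: zero_less_mult_iff)

  have oW: "open ?W"
    using open_vimage[OF V(1), of "\<lambda>s. act s z"] continuous_on_act[OF continuous_on_id continuous_on_const]
    by (simp add: vimage_def)
  define m where "m = measure nu ?W"
  have "emeasure nu ?W \<le> emeasure nu ?C"
    by (intro emeasure_mono closure_subset) (simp add: sets_nu)
  also have "\<dots> < \<infinity>" by (rule emeasure_nu_compact[OF C])
  finally have em: "emeasure nu ?W = ennreal m" unfolding m_def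
    by (simp add: emeasure_eq_ennreal_measure less_top)
  have "0 \<in> ?W" using V(2) by simp
  then have "0 < emeasure nu ?W" by (intro emeasure_nu_open_pos[OF oW]) blast
  then have m: "0 < m" by (simp add: em)

  obtain \<zeta> where \<zeta>: "\<zeta> \<in> vecs (L2 nu)" "hnorm (L2 nu) \<zeta> = 1" "\<phi> = vector_functional ?A (Ind act mu z) \<zeta>"
    using \<phi> unfolding associated_pure_states_def by (auto simp: rspace_Ind)
  define \<xi> where "\<xi> = some_in \<zeta>"
  have \<xi>: "\<xi> \<in> L2_funs nu" unfolding \<xi>_def by (rule vecs_L2D[OF \<zeta>(1)])
  have \<xi>1: "l2_norm nu \<xi> = 1" using \<zeta>(2) by (simp add: hnorm_L2 \<xi>_def)

  have "orbit_approximable z \<xi>"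
    by (rule orbit_approximable_L2_funs[OF V C closure_subset \<xi>])
  moreover have "0 < d\<^sup>2" using d by simp
  ultimately obtain g where g: "compact_on_orbit z g"
    "(\<integral>\<^sup>+s. (ennreal (cmod (\<xi> s - c0_apply g (act s z))))\<^sup>2 \<partial>nu) < ennreal (d\<^sup>2)"
    unfolding orbit_approximable_def by blast
  obtain R where R: "compact R" "\<And>s. c0_apply g (act s z) \<noteq> 0 \<Longrightarrow> s \<in> R"
    using g(1) by (auto simp: compact_on_orbit_def)
  define gz where "gz s = c0_apply g (act s z)" for s
  have gz: "gz \<in> L2_funs nu" unfolding gz_def by (rule compact_on_orbit_L2[OF R])
  have diff: "(\<lambda>s. \<xi> s - gz s) \<in> L2_funs nu" by (rule L2_funs_diff[OF \<xi> gz])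
  have "ennreal ((l2_norm nu (\<lambda>s. \<xi> s - gz s))\<^sup>2) < ennreal (d\<^sup>2)"
    using g(2) nn_integral_L2_funs[OF diff] by (simp add: gz_def)
  then have "(l2_norm nu (\<lambda>s. \<xi> s - gz s))\<^sup>2 < d\<^sup>2"
    by (simp add: ennreal_less_iff)
  then have close: "l2_norm nu (\<lambda>s. \<xi> s - gz s) < d"
    by (rule power2_less_imp_less) (use d in simp)
  have "cmod (l2_inner nu (\<lambda>s. \<xi> s - gz s) \<xi>) \<le> d"
    using l2_Cauchy_Schwarz[OF diff \<xi>] close \<xi>1 by simp
  moreover have "l2_inner nu (\<lambda>s. \<xi> s - gz s) \<xi> = 1 - l2_inner nu gz \<xi>"
    by (simp add: l2_inner_diff_left \<xi> gz l2_inner_self \<xi>1)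
  ultimately have "1 - d \<le> cmod (l2_inner nu gz \<xi>)"
    using norm_triangle_ineq2[of 1 "l2_inner nu gz \<xi>"] by simp
  then have inner_ge: "1 - d \<le> cmod (l2_inner nu \<xi> gz)"
    by (subst l2_inner_commute) simp
  \<comment> \<open>\<open>gz\<close> is written as \<open>\<xi>\<close> minus the small
    difference.\<close>
  have "l2_norm nu (\<lambda>s. \<xi> s + (- 1) * (\<xi> s - gz s)) \<le> l2_norm nu \<xi> + l2_norm nu (\<lambda>s. (- 1) * (\<xi> s - gz s))"
    by (intro l2_norm_triangle \<xi> L2_funs_mult diff)
  then have "l2_norm nu gz \<le> 1 + d"
    using close \<xi>1 by (simp only: l2_norm_mult) simp
  then have "(l2_norm nu gz)\<^sup>2 \<le> (1 + d)\<^sup>2" by (intro power_mono) auto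
  \<comment> \<open>The spare factor \<open>1 + d\<close> buys strictness: the whole orbit of
    \<open>z\<close> has to lie in an open set defined by a strict bound on the row mass.\<close>
  also have "\<dots> < (1 + d)^3" using d by (intro power_strict_increasing) auto
  finally have gz_le: "(l2_norm nu gz)\<^sup>2 < (1 + d)^3" .

  \<comment> \<open>If \<open>f\<close> at \<open>s.z\<close> and \<open>g\<close> at
    \<open>r.z\<close> are both nonzero, then \<open>s\<close> lies in \<open>?C\<close> and
    \<open>r\<close> in \<open>R\<close>, so \<open>s + - r\<close> lies in
    \<open>B\<close>.\<close>
  define B where "B = (\<lambda>p. fst p + - snd p) ` (?C \<times> R)"
  have B: "compact B" unfolding B_def
    by (intro compact_continuous_image compact_Times C R continuous_intros)
  \<comment> \<open>The added condition holds on the entire orbit of \<open>z\<close>, so passing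
    from \<open>V\<close> to \<open>W\<close> costs no measure there, while on every other orbit it
    controls all rows at points where \<open>f\<close> is nonzero.\<close>
  define W where "W = V \<inter> {y. row_mass B g y < ennreal ((1 + d)^3)}"
  have W: "open W" unfolding W_def by (intro open_Int V open_row_mass_less[OF B])
  have mass: "row_mass B g (act s z) < ennreal ((1 + d)^3)" for s
  proof -
    have "row_mass B g (act s z) \<le> ennreal ((l2_norm nu gz)\<^sup>2)"
      using row_mass_orbit_le[OF B, of g s z] nn_integral_L2_funs[OF gz] by (simp add: gz_def)
    also have "\<dots> < ennreal ((1 + d)^3)" using gz_le by (simp add: ennreal_less_iff)
    finally show ?thesis .
  qed
  then have Wz: "{s. act s z \<in> W} = ?W" by (auto simp: W_def)
  have "(1 - d) * m < measure nu {s. act s z \<in> W}" using d m unfolding Wz by (simp flip: m_def)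
  moreover have WC: "s \<in> ?C" if "act s z \<in> W" for s
    using that closure_subset[of ?W] by (auto simp: W_def)
  ultimately obtain f :: "'x c0" where f: "\<And>y. cmod (c0_apply f y) \<le> 1" "\<And>y. y \<notin> W \<Longrightarrow> c0_apply f y = 0"
    "(1 - d) * m < (l2_norm nu (\<lambda>s. c0_apply f (act s z)))\<^sup>2"
    using exists_cutoff[OF W C] by blast

  define D where "D = kernel_element B f g"
  have D: "integrable mu D" unfolding D_def by (rule integrable_kernel_element[OF B])
  define a where "a = const_class (smult L1alg (sstar L1alg D) D)"
  have DD: "integrable mu (smult L1alg (sstar L1alg D) D)" by (rule integrable_smult[OF integrable_sstar[OF D] D])
  have a: "a \<in> elems ?A" unfolding a_def by (rule const_class_in_crossed_product[OF DD])
  have vf: "vector_functional ?A (Ind act mu y) \<eta> a = complex_of_real ((l2_norm nu (ind_op y D (some_in \<eta>)))\<^sup>2)"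
    if "\<eta> \<in> vecs (L2 nu)" for y \<eta>
    unfolding a_def vector_functional_const_class[OF DD that]
    by (rule l2_inner_ind_op_star_smult[OF D vecs_L2D(1)[OF that]])

  have "s + - r \<in> B" if "c0_apply f (act s z) \<noteq> 0" "c0_apply g (act r z) \<noteq> 0" for s r
  proof -
    have "s \<in> ?C" using f(2) WC that(1) by blast
    moreover have "r \<in> R" using R(2) that(2) by blast
    ultimately show ?thesis unfolding B_def by force
  qed
  then have "l2_norm nu (ind_op z D \<xi>) = cmod (l2_inner nu \<xi> gz) * l2_norm nu (\<lambda>s. c0_apply f (act s z))"
    unfolding D_def gz_def[abs_def] by (intro l2_norm_ind_op_kernel_element[OF B \<xi>] gz[unfolded gz_def[abs_def]])
  then have "(l2_norm nu (ind_op z D \<xi>))\<^sup>2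
      = (cmod (l2_inner nu \<xi> gz))\<^sup>2 * (l2_norm nu (\<lambda>s. c0_apply f (act s z)))\<^sup>2"
    by (simp add: power_mult_distrib)
  moreover have "(1 - d)\<^sup>2 * ((1 - d) * m) \<le> \<dots>"
    using inner_ge f(3) d m by (intro mult_mono power_mono) auto
  ultimately have \<phi>_ge: "(1 - d)^3 * m \<le> (l2_norm nu (ind_op z D \<xi>))\<^sup>2"
    by (simp add: power3_eq_cube power2_eq_square ac_simps)
  have \<phi>a: "\<phi> a = complex_of_real ((l2_norm nu (ind_op z D \<xi>))\<^sup>2)"
    unfolding \<zeta>(3) \<xi>_def by (rule vf[OF \<zeta>(1)])

  \<comment> \<open>The radius \<open>d * m\<close> accounts for the term \<open>- d\<close> in
    \<open>b\<close>.\<close>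
  define N where "N = {\<psi> \<in> cstar_dual ?A. \<forall>a'\<in>{a}. cmod (\<psi> a') < d * m}"
  have "N \<in> weak_star_nhds ?A"
    unfolding weak_star_nhds_def N_def using a d m by (intro CollectI exI[of _ "{a}"] exI[of _ "d * m"]) auto
  then have "upper_multiplicity ?A \<phi> sequentially (\<lambda>n. Ind act mu (x n))
      \<le> Limsup sequentially (\<lambda>n. vec_dim ?A (Ind act mu (x n)) \<phi> N)"
    unfolding upper_multiplicity_def by (rule INF_lower)
  also have "\<dots> \<le> enat (nat \<lfloor>M\<rfloor>)"
  proof (rule Limsup_bounded)
    show "\<forall>\<^sub>F n in sequentially. vec_dim ?A (Ind act mu (x n)) \<phi> N \<le> enat (nat \<lfloor>M\<rfloor>)"
      using ev
    proof eventually_elim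
      fix n
      assume n: "emeasure nu {s. act s (x n) \<in> V} \<le> ennreal M * emeasure nu ?W"
      show "vec_dim ?A (Ind act mu (x n)) \<phi> N \<le> enat (nat \<lfloor>M\<rfloor>)"
        unfolding vec_dim_def
      proof (rule Sup_least, clarify)
        fix S assume S: "finite S" "S \<subseteq> Vec ?A (Ind act mu (x n)) \<phi> N" "orthonormal (rspace (Ind act mu (x n))) S"
        have vecs: "\<eta> \<in> vecs (L2 nu)" if "\<eta> \<in> S" for \<eta>
          using S(2) that by (auto simp: Vec_def rspace_Ind)
        have ge: "b * m \<le> (l2_norm nu (ind_op (x n) D (some_in \<eta>)))\<^sup>2" if \<eta>: "\<eta> \<in> S" for \<eta>
        proof -
          obtain \<psi> where \<psi>: "\<psi> \<in> N" "vector_functional ?A (Ind act mu (x n)) \<eta> = (\<lambda>a. \<phi> a + \<psi> a)"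
            using S(2) \<eta> unfolding Vec_def by blast
          have "complex_of_real ((l2_norm nu (ind_op (x n) D (some_in \<eta>)))\<^sup>2) = \<phi> a + \<psi> a"
            using vf[OF vecs[OF \<eta>], of "x n"] unfolding \<psi>(2) by simp
          then have "(l2_norm nu (ind_op (x n) D (some_in \<eta>)))\<^sup>2 = (l2_norm nu (ind_op z D \<xi>))\<^sup>2 + Re (\<psi> a)"
            unfolding \<phi>a by (metis Re_complex_of_real plus_complex.sel(1))
          moreover have "\<bar>Re (\<psi> a)\<bar> < d * m"
            using \<psi>(1) abs_Re_le_cmod[of "\<psi> a"] by (auto simp: N_def)
          ultimately show ?thesis using \<phi>_ge by (simp add: b_def left_diff_distrib)
        qed
        \<comment> \<open>The two-sided count: every vector of \<open>S\<close> contributes at least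
          \<open>b * m\<close>, while the sum stays below the row bound times the measure of the
          preimage of \<open>V\<close> at \<open>x n\<close>. Cancelling \<open>m\<close> leaves the
          inequality excluded for \<open>card S \<ge> k\<close> by the choice of
          \<open>d\<close>.\<close>
        have "ennreal (real (card S) * (b * m)) = (\<Sum>\<eta>\<in>S. ennreal (b * m))"
          using b m by (simp add: ennreal_mult ennreal_of_nat_eq_real_of_nat)
        also have "\<dots> \<le> (\<Sum>\<eta>\<in>S. ennreal ((l2_norm nu (ind_op (x n) D (some_in \<eta>)))\<^sup>2))"
          by (intro sum_mono ennreal_leI ge)
        also have "\<dots> \<le> ennreal ((1 + d)^3) * emeasure nu {s. act s (x n) \<in> V}"
          unfolding D_def
        proof (rule sum_l2_norm_kernel_element_le[OF B S(1) _ _ f(1) _ V(1)])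
          show "some_in \<eta> \<in> L2_funs nu" if "\<eta> \<in> S" for \<eta> by (rule vecs_L2D(1)[OF vecs[OF that]])
          show "l2_inner nu (some_in \<eta>) (some_in \<eta>') = (if \<eta> = \<eta>' then 1 else 0)" if "\<eta> \<in> S" "\<eta>' \<in> S" for \<eta> \<eta>'
            using S(3) that by (simp add: orthonormal_def rspace_Ind L2_simps)
          show "y \<in> V \<and> row_mass B g y \<le> ennreal ((1 + d)^3)" if "c0_apply f y \<noteq> 0" for y
            using f(2)[of y] that by (auto simp: W_def intro: less_imp_le)
        qed
        also have "\<dots> \<le> ennreal ((1 + d)^3) * (ennreal M * ennreal m)"
          using n unfolding em by (intro mult_left_mono) auto
        also have "\<dots> = ennreal ((1 + d)^3 * (M * m))"
          using M m d by (simp add: ennreal_mult)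
        finally have "real (card S) * (b * m) \<le> (1 + d)^3 * (M * m)"
          using M m d by (subst (asm) ennreal_le_iff) auto
        then have "(real (card S) * b) * m \<le> (M * (1 + d)^3) * m"
          by (simp add: ac_simps)
        then have "real (card S) * b \<le> M * (1 + d)^3" using m by (simp add: mult_le_cancel_right)
        also have "\<dots> < real k * b" using d(3) by (simp add: b_def)
        finally have "card S < k" using b by (simp add: mult_less_cancel_right)
        then show "enat (card S) \<le> enat (nat \<lfloor>M\<rfloor>)" by (simp add: k_def)
      qed
    qed
  qed
  finally show ?thesis .
qed

section \<open>Passage to the right Haar measure of the statement\<close>

text \<open>The locale integrates against \<open>reflect mu\<close>; when \<open>mu\<close> is
  itself the reflection of a given right Haar measure, this returns the given one.\<close>

lemma reflect_reflect:
  fixes nu :: "'g::{topological_group_add,t2_space} measure"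
  assumes "sets nu = sets borel"
  shows "reflect (reflect nu) = nu"
proof (rule measure_eqI)
  fix E assume "E \<in> sets (reflect (reflect nu))"
  then have E: "E \<in> sets borel" by (simp add: reflect_def)
  have "uminus ` E \<in> sets borel"
    using measurable_sets[OF borel_measurable_uminus_group E] by (simp add: vimage_uminus_group)
  then show "emeasure (reflect (reflect nu)) E = emeasure nu E"
    using E assms by (simp add: emeasure_reflect image_image reflect_def[of nu])
      (simp add: emeasure_reflect image_image flip: reflect_def)
qed (simp add: reflect_def assms)

theorem theorem3p6:
  fixes act :: "'g::{topological_group_add,t2_space,second_countable_topology}
      \<Rightarrow> 'x::{t2_space,second_countable_topology} \<Rightarrow> 'x"
    and nu mu :: "'g measure" and M :: real and z :: 'x and x :: "nat \<Rightarrow> 'x"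
  assumes "transformation_group act" and "free_action act"
    and "right_haar_measure nu" and "mu = reflect nu"
    and "1 \<le> M"
    and "locally_closed (action_orbit act z)"
    and "\<exists>V. open V \<and> z \<in> V \<and> compact (closure (orbit_map act z -` V)) \<and>
      (\<forall>\<^sub>F n in sequentially.
        emeasure nu (orbit_map act (x n) -` V) \<le> ennreal M * emeasure nu (orbit_map act z -` V) \<and>
        ennreal M * emeasure nu (orbit_map act z -` V) < \<infinity>)"
  shows "\<forall>\<phi>\<in>associated_pure_states (crossed_product act mu) (Ind act mu z).
    upper_multiplicity (crossed_product act mu) \<phi> sequentially (\<lambda>n. Ind act mu (x n))
      \<le> enat (nat \<lfloor>M\<rfloor>)"
proof
  fix \<phi> assume \<phi>: "\<phi> \<in> associated_pure_states (crossed_product act mu) (Ind act mu z)"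
  obtain V where V: "open V" "z \<in> V" "compact (closure (orbit_map act z -` V))"
    and ev: "\<forall>\<^sub>F n in sequentially.
        emeasure nu (orbit_map act (x n) -` V) \<le> ennreal M * emeasure nu (orbit_map act z -` V) \<and>
        ennreal M * emeasure nu (orbit_map act z -` V) < \<infinity>"
    using assms(7) by blast
  have nu: "reflect mu = nu"
    using assms(3) unfolding assms(4) by (intro reflect_reflect) (simp add: right_haar_measure_def)
  interpret free_haar_action mu act
  proof
    show "locally_compact_space (euclidean :: 'g topology)"
      using assms(1) by (simp add: transformation_group_def)
    show "left_haar_measure mu"
      unfolding assms(4) by (rule left_haar_measure_reflect[OF assms(3)])
  qed (fact assms)+
  have orbit: "orbit_map act y -` V = {s. act s y \<in> V}" for y
    by (auto simp: orbit_map_def)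
  show "upper_multiplicity (crossed_product act mu) \<phi> sequentially (\<lambda>n. Ind act mu (x n)) \<le> enat (nat \<lfloor>M\<rfloor>)"
  proof (rule upper_multiplicity_le[OF assms(5) V(1,2) _ _ \<phi>])
    show "compact (closure {s. act s z \<in> V})" using V(3) by (simp add: orbit)
    show "\<forall>\<^sub>F n in sequentially. emeasure (reflect mu) {s. act s (x n) \<in> V} \<le> ennreal M * emeasure (reflect mu) {s. act s z \<in> V}"
      using ev by (rule eventually_mono) (simp add: nu orbit)
  qed
qed

end
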